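(* Let $(I,\preceq)$ be a finite poset. An $(I,\preceq)$-configuration $(\sigma,\iota,\pi)$ in an abelian or exact category is best if and only if for all $i\ne j\in I$ with $i\preceq j$ but such that there exists no $k\in I$ with $i\ne k\ne j$ and $i\preceq k\preceq j$, the short exact sequence $$0\to\sigma(\{i\})\xrightarrow{\ \iota(\{i\},\{i,j\})\ }\sigma(\{i,j\})\xrightarrow{\ \pi(\{i,j\},\{j\})\ }\sigma(\{j\})\to0$$ is not split.
   Context: An exact category is a full additive subcategory $\mathcal A$ of an abelian category $\hat{\mathcal A}$, closed under extensions; its exact sequences are the short exact sequences of $\hat{\mathcal A}$ with all terms in $\mathcal A$. A short exact sequence $0\to X\to Y\to Z\to0$ is split if there is a compatible isomorphism $X\oplus Z\cong Y$. For a finite poset $(I,\preceq)$, $J\subseteq I$ is an f-set if $i\in I$, $h,j\in J$, $h\preceq i\preceq j$ imply $i\in J$. $\mathcal F_{(I,\preceq)}$ is the set of f-sets of $I$; $\mathcal G_{(I,\preceq)}$ is the set of pairs $(J,K)$ of f-sets with $J\subseteq K$ such that $j\in J$, $k\in K$, $k\preceq j$ imply $k\in J$; $\mathcal H_{(I,\preceq)}$ is the set of pairs $(J,K)$ of f-sets with $K\subseteq J$ such that $j\in J$, $k\in K$, $k\preceq j$ imply $j\in K$. An $(I,\preceq)$-configuration $(\sigma,\iota,\pi)$ in an abelian or exact category $\mathcal A$ consists of objects $\sigma(J)$ for $J\in\mathcal F_{(I,\preceq)}$ with $\sigma(\emptyset)=0$; injective morphisms $\iota(J,K):\sigma(J)\to\sigma(K)$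 for $(J,K)\in\mathcal G_{(I,\preceq)}$ with $\iota(J,J)=\mathrm{id}_{\sigma(J)}$; and surjective morphisms $\pi(J,K):\sigma(J)\to\sigma(K)$ for $(J,K)\in\mathcal H_{(I,\preceq)}$ with $\pi(J,J)=\mathrm{id}_{\sigma(J)}$, such that: (A) if $(J,K)\in\mathcal G_{(I,\preceq)}$ and $L=K\setminus J$ then $0\to\sigma(J)\xrightarrow{\iota(J,K)}\sigma(K)\xrightarrow{\pi(K,L)}\sigma(L)\to0$ is exact; (B) if $(J,K),(K,L)\in\mathcal G_{(I,\preceq)}$ then $\iota(J,L)=\iota(K,L)\circ\iota(J,K)$; (C) if $(J,K),(K,L)\in\mathcal H_{(I,\preceq)}$ then $\pi(J,L)=\pi(K,L)\circ\pi(J,K)$; (D) if $(J,K)\in\mathcal G_{(I,\preceq)}$ and $(K,L)\in\mathcal H_{(I,\preceq)}$ then $\pi(K,L)\circ\iota(J,K)=\iota(J\cap L,L)\circ\pi(J,J\cap L)$. If $\preceq,\lesssim$ are partial orders on $I$ such that $a\lesssim b$ implies $a\preceq b$, then $\mathcal F_{(I,\preceq)}\subseteq\mathcal F_{(I,\lesssim)}$, $\mathcal G_{(I,\preceq)}\subseteq\mathcal G_{(I,\lesssim)}$, $\mathcal H_{(I,\preceq)}\subseteq\mathcal H_{(I,\lesssim)}$. An improvement of an $(I,\preceq)$-configuration $(\sigma,\iota,\pi)$ is an $(I,\lesssim)$-configuration (for some such $\lesssim$, in the same category) whose restriction to $\mathcal F_{(I,\preceq)},\mathcal G_{(I,\preceq)},\mathcal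 H_{(I,\preceq)}$ equals $(\sigma,\iota,\pi)$; it is strict if $\lesssim\,\ne\,\preceq$. A configuration is best if it has no strict improvement. *)

theory Defs
  imports "HOL-Algebra.Group"
begin

text \<open>Categories whose hom-sets carry an addition. Composition and addition are total
  functions on the type of arrows; the axioms constrain them only on composable,
  respectively parallel, arrows.\<close>

record ('o, 'm) addcat =
  Obj :: "'o set"
  Arr :: "'m set"
  Dom :: "'m \<Rightarrow> 'o"
  Cod :: "'m \<Rightarrow> 'o"
  Ident :: "'o \<Rightarrow> 'm"
  Comp :: "'m \<Rightarrow> 'm \<Rightarrow> 'm"  (infixl "\<bullet>\<index>" 70)
  Plus :: "'m \<Rightarrow> 'm \<Rightarrow> 'm"
  Zero :: "'o \<Rightarrow> 'o \<Rightarrow> 'm"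

definition Hom :: "('o, 'm) addcat \<Rightarrow> 'o \<Rightarrow> 'o \<Rightarrow> 'm set" where
  "Hom C X Y = {f \<in> Arr C. Dom C f = X \<and> Cod C f = Y}"

definition hom_group :: "('o, 'm) addcat \<Rightarrow> 'o \<Rightarrow> 'o \<Rightarrow> 'm monoid" where
  "hom_group C X Y = \<lparr>carrier = Hom C X Y, mult = Plus C, one = Zero C X Y\<rparr>"

locale category =
  fixes C :: "('o, 'm) addcat" (structure)
  assumes Dom_Obj: "f \<in> Arr C \<Longrightarrow> Dom C f \<in> Obj C"
    and Cod_Obj: "f \<in> Arr C \<Longrightarrow> Cod C f \<in> Obj C"
    and Ident_Hom: "X \<in> Obj C \<Longrightarrow> Ident C X \<in> Hom C X X"
    and Comp_Hom: "f \<in> Hom C X Y \<Longrightarrow> g \<in> Hom C Y Z \<Longrightarrow> g \<bullet> f \<in> Hom C X Z"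
    and Comp_assoc: "f \<in> Hom C W X \<Longrightarrow> g \<in> Hom C X Y \<Longrightarrow> h \<in> Hom C Y Z \<Longrightarrow>
      h \<bullet> (g \<bullet> f) = (h \<bullet> g) \<bullet> f"
    and Comp_Ident: "f \<in> Hom C X Y \<Longrightarrow> f \<bullet> Ident C X = f"
    and Ident_Comp: "f \<in> Hom C X Y \<Longrightarrow> Ident C Y \<bullet> f = f"

locale preadditive_category = category +
  assumes Hom_comm_group: "X \<in> Obj C \<Longrightarrow> Y \<in> Obj C \<Longrightarrow> comm_group (hom_group C X Y)"
    and Comp_Plus: "f \<in> Hom C X Y \<Longrightarrow> g \<in> Hom C X Y \<Longrightarrow> h \<in> Hom C Y Z \<Longrightarrow>
      h \<bullet> Plus C f g = Plus C (h \<bullet> f) (h \<bullet> g)"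
    and Plus_Comp: "f \<in> Hom C W X \<Longrightarrow> g \<in> Hom C X Y \<Longrightarrow> h \<in> Hom C X Y \<Longrightarrow>
      Plus C g h \<bullet> f = Plus C (g \<bullet> f) (h \<bullet> f)"

definition is_zero_object :: "('o, 'm) addcat \<Rightarrow> 'o \<Rightarrow> bool" where
  "is_zero_object C Z \<longleftrightarrow> Z \<in> Obj C \<and>
    (\<forall>X\<in>Obj C. (\<exists>!f. f \<in> Hom C X Z) \<and> (\<exists>!f. f \<in> Hom C Z X))"

definition is_direct_sum ::
    "('o, 'm) addcat \<Rightarrow> 'o \<Rightarrow> 'o \<Rightarrow> 'o \<Rightarrow> 'm \<Rightarrow> 'm \<Rightarrow> 'm \<Rightarrow> 'm \<Rightarrow> bool" where
  "is_direct_sum C X Y S i1 i2 p1 p2 \<longleftrightarrow>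
    i1 \<in> Hom C X S \<and> i2 \<in> Hom C Y S \<and> p1 \<in> Hom C S X \<and> p2 \<in> Hom C S Y \<and>
    p1 \<bullet>\<^bsub>C\<^esub> i1 = Ident C X \<and> p2 \<bullet>\<^bsub>C\<^esub> i2 = Ident C Y \<and>
    p1 \<bullet>\<^bsub>C\<^esub> i2 = Zero C Y X \<and> p2 \<bullet>\<^bsub>C\<^esub> i1 = Zero C X Y \<and>
    Plus C (i1 \<bullet>\<^bsub>C\<^esub> p1) (i2 \<bullet>\<^bsub>C\<^esub> p2) = Ident C S"

locale additive_category = preadditive_category +
  assumes ex_zero_object: "\<exists>Z. is_zero_object C Z"
    and ex_direct_sum: "X \<in> Obj C \<Longrightarrow> Y \<in> Obj C \<Longrightarrow>
      \<exists>S i1 i2 p1 p2. is_direct_sum C X Y S i1 i2 p1 p2"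

definition monic :: "('o, 'm) addcat \<Rightarrow> 'm \<Rightarrow> bool" where
  "monic C f \<longleftrightarrow> f \<in> Arr C \<and>
    (\<forall>W. \<forall>g\<in>Hom C W (Dom C f). \<forall>h\<in>Hom C W (Dom C f).
      f \<bullet>\<^bsub>C\<^esub> g = f \<bullet>\<^bsub>C\<^esub> h \<longrightarrow> g = h)"

definition epic :: "('o, 'm) addcat \<Rightarrow> 'm \<Rightarrow> bool" where
  "epic C f \<longleftrightarrow> f \<in> Arr C \<and>
    (\<forall>W. \<forall>g\<in>Hom C (Cod C f) W. \<forall>h\<in>Hom C (Cod C f) W.
      g \<bullet>\<^bsub>C\<^esub> f = h \<bullet>\<^bsub>C\<^esub> f \<longrightarrow> g = h)"

definition iso_arrow :: "('o, 'm) addcat \<Rightarrow> 'm \<Rightarrow> bool" where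
  "iso_arrow C f \<longleftrightarrow> f \<in> Arr C \<and>
    (\<exists>g\<in>Hom C (Cod C f) (Dom C f).
      g \<bullet>\<^bsub>C\<^esub> f = Ident C (Dom C f) \<and> f \<bullet>\<^bsub>C\<^esub> g = Ident C (Cod C f))"

definition is_kernel :: "('o, 'm) addcat \<Rightarrow> 'm \<Rightarrow> 'm \<Rightarrow> bool" where
  "is_kernel C k f \<longleftrightarrow> f \<in> Arr C \<and> k \<in> Arr C \<and> Cod C k = Dom C f \<and>
    f \<bullet>\<^bsub>C\<^esub> k = Zero C (Dom C k) (Cod C f) \<and>
    (\<forall>W. \<forall>h\<in>Hom C W (Dom C f). f \<bullet>\<^bsub>C\<^esub> h = Zero C W (Cod C f) \<longrightarrow>
      (\<exists>!u. u \<in> Hom C W (Dom C k) \<and> k \<bullet>\<^bsub>C\<^esub> u = h))"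

definition is_cokernel :: "('o, 'm) addcat \<Rightarrow> 'm \<Rightarrow> 'm \<Rightarrow> bool" where
  "is_cokernel C c f \<longleftrightarrow> f \<in> Arr C \<and> c \<in> Arr C \<and> Dom C c = Cod C f \<and>
    c \<bullet>\<^bsub>C\<^esub> f = Zero C (Dom C f) (Cod C c) \<and>
    (\<forall>W. \<forall>h\<in>Hom C (Cod C f) W. h \<bullet>\<^bsub>C\<^esub> f = Zero C (Dom C f) W \<longrightarrow>
      (\<exists>!u. u \<in> Hom C (Cod C c) W \<and> u \<bullet>\<^bsub>C\<^esub> c = h))"

locale abelian_category = additive_category +
  assumes ex_kernel: "f \<in> Arr C \<Longrightarrow> \<exists>k. is_kernel C k f"
    and ex_cokernel: "f \<in> Arr C \<Longrightarrow> \<exists>c. is_cokernel C c f"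
    and monic_normal: "monic C f \<Longrightarrow> \<exists>g. is_kernel C f g"
    and epic_normal: "epic C f \<Longrightarrow> \<exists>g. is_cokernel C f g"

text \<open>Exactness of \<open>0 \<rightarrow> X \<rightarrow> Y \<rightarrow> Z \<rightarrow> 0\<close> in the abelian category \<open>C\<close>, for
  \<open>f : X \<rightarrow> Y\<close> and \<open>g : Y \<rightarrow> Z\<close>.\<close>

definition short_exact :: "('o, 'm) addcat \<Rightarrow> 'm \<Rightarrow> 'm \<Rightarrow> bool" where
  "short_exact C f g \<longleftrightarrow> is_kernel C f g \<and> is_cokernel C g f"

text \<open>Splitting by an isomorphism \<open>\<phi> : X \<oplus> Z \<rightarrow> Y\<close> that carries the inclusion of \<open>X\<close> to \<open>f\<close> and
  the projection onto \<open>Z\<close> to \<open>g\<close>.\<close>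

definition split_sequence :: "('o, 'm) addcat \<Rightarrow> 'm \<Rightarrow> 'm \<Rightarrow> bool" where
  "split_sequence C f g \<longleftrightarrow>
    (\<exists>S i1 i2 p1 p2 \<phi>. is_direct_sum C (Dom C f) (Cod C g) S i1 i2 p1 p2 \<and>
      \<phi> \<in> Hom C S (Cod C f) \<and> iso_arrow C \<phi> \<and> \<phi> \<bullet>\<^bsub>C\<^esub> i1 = f \<and> g \<bullet>\<^bsub>C\<^esub> \<phi> = p2)"

text \<open>An exact category is given by its ambient abelian category \<open>C\<close> and the set \<open>A\<close> of its
  objects; being full, it has the same hom-sets as \<open>C\<close>. Abelian categories are the case
  \<open>A = Obj C\<close>.\<close>

locale exact_category = abelian_category +
  fixes A :: "'o set"
  assumes A_Obj: "A \<subseteq> Obj C"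
    and A_zero: "\<exists>Z\<in>A. is_zero_object C Z"
    and A_direct_sum: "X \<in> A \<Longrightarrow> Y \<in> A \<Longrightarrow>
      \<exists>S\<in>A. \<exists>i1 i2 p1 p2. is_direct_sum C X Y S i1 i2 p1 p2"
    and A_extension: "short_exact C f g \<Longrightarrow> Dom C f \<in> A \<Longrightarrow> Cod C g \<in> A \<Longrightarrow> Cod C f \<in> A"

lemma (in abelian_category) exact_category_Obj: "exact_category C (Obj C)"
proof unfold_locales
  show "Obj C \<subseteq> Obj C" by simp
  show "\<exists>Z\<in>Obj C. is_zero_object C Z"
    using ex_zero_object by (auto simp: is_zero_object_def)
  show "\<exists>S\<in>Obj C. \<exists>i1 i2 p1 p2. is_direct_sum C X Y S i1 i2 p1 p2"
    if XY: "X \<in> Obj C" "Y \<in> Obj C" for X Y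
  proof -
    obtain S i1 i2 p1 p2 where S: "is_direct_sum C X Y S i1 i2 p1 p2"
      using ex_direct_sum [OF XY] by blast
    then have "S \<in> Obj C"
      using Cod_Obj by (auto simp: is_direct_sum_def Hom_def)
    with S show ?thesis by blast
  qed
  show "Cod C f \<in> Obj C" if "short_exact C f g" for f g
    using that by (intro Cod_Obj) (simp add: short_exact_def is_kernel_def)
qed

definition f_sets :: "'i set \<Rightarrow> 'i rel \<Rightarrow> 'i set set" where
  "f_sets I r = {J. J \<subseteq> I \<and> (\<forall>i\<in>I. \<forall>h\<in>J. \<forall>j\<in>J. (h, i) \<in> r \<and> (i, j) \<in> r \<longrightarrow> i \<in> J)}"

definition g_pairs :: "'i set \<Rightarrow> 'i rel \<Rightarrow> ('i set \<times> 'i set) set" where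
  "g_pairs I r = {(J, K). J \<in> f_sets I r \<and> K \<in> f_sets I r \<and> J \<subseteq> K \<and>
    (\<forall>j\<in>J. \<forall>k\<in>K. (k, j) \<in> r \<longrightarrow> k \<in> J)}"

definition h_pairs :: "'i set \<Rightarrow> 'i rel \<Rightarrow> ('i set \<times> 'i set) set" where
  "h_pairs I r = {(J, K). J \<in> f_sets I r \<and> K \<in> f_sets I r \<and> K \<subseteq> J \<and>
    (\<forall>j\<in>J. \<forall>k\<in>K. (k, j) \<in> r \<longrightarrow> j \<in> K)}"

text \<open>Injective and surjective mean monic and epic in the ambient abelian category, which is
  where exactness is tested as well. The values of \<open>\<sigma>\<close>, \<open>\<iota>\<close> and \<open>\<pi>\<close> outside
  \<open>f_sets I r\<close>, \<open>g_pairs I r\<close> and \<open>h_pairs I r\<close> are irrelevant.\<close>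

locale configuration =
  fixes C :: "('o, 'm) addcat" (structure) and A :: "'o set"
    and I :: "'i set" and r :: "'i rel"
    and \<sigma> :: "'i set \<Rightarrow> 'o"
    and \<iota> :: "'i set \<Rightarrow> 'i set \<Rightarrow> 'm"
    and \<pi> :: "'i set \<Rightarrow> 'i set \<Rightarrow> 'm"
  assumes sigma_A: "J \<in> f_sets I r \<Longrightarrow> \<sigma> J \<in> A"
    and sigma_empty: "is_zero_object C (\<sigma> {})"
    and iota_Hom: "(J, K) \<in> g_pairs I r \<Longrightarrow> \<iota> J K \<in> Hom C (\<sigma> J) (\<sigma> K)"
    and iota_monic: "(J, K) \<in> g_pairs I r \<Longrightarrow> monic C (\<iota> J K)"
    and iota_Ident: "J \<in> f_sets I r \<Longrightarrow> \<iota> J J = Ident C (\<sigma> J)"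
    and pi_Hom: "(J, K) \<in> h_pairs I r \<Longrightarrow> \<pi> J K \<in> Hom C (\<sigma> J) (\<sigma> K)"
    and pi_epic: "(J, K) \<in> h_pairs I r \<Longrightarrow> epic C (\<pi> J K)"
    and pi_Ident: "J \<in> f_sets I r \<Longrightarrow> \<pi> J J = Ident C (\<sigma> J)"
    and exact: "(J, K) \<in> g_pairs I r \<Longrightarrow> L = K - J \<Longrightarrow> short_exact C (\<iota> J K) (\<pi> K L)"
    and iota_Comp: "(J, K) \<in> g_pairs I r \<Longrightarrow> (K, L) \<in> g_pairs I r \<Longrightarrow> \<iota> J L = \<iota> K L \<bullet> \<iota> J K"
    and pi_Comp: "(J, K) \<in> h_pairs I r \<Longrightarrow> (K, L) \<in> h_pairs I r \<Longrightarrow> \<pi> J L = \<pi> K L \<bullet> \<pi> J K"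
    and pi_iota: "(J, K) \<in> g_pairs I r \<Longrightarrow> (K, L) \<in> h_pairs I r \<Longrightarrow>
      \<pi> K L \<bullet> \<iota> J K = \<iota> (J \<inter> L) L \<bullet> \<pi> J (J \<inter> L)"

text \<open>The configuration \<open>(\<sigma>', \<iota>', \<pi>')\<close> over \<open>(I, s)\<close> improves the configuration
  \<open>(\<sigma>, \<iota>, \<pi>)\<close> over \<open>(I, r)\<close>.\<close>

definition improvement ::
    "('o, 'm) addcat \<Rightarrow> 'o set \<Rightarrow> 'i set \<Rightarrow> 'i rel \<Rightarrow>
     ('i set \<Rightarrow> 'o) \<Rightarrow> ('i set \<Rightarrow> 'i set \<Rightarrow> 'm) \<Rightarrow> ('i set \<Rightarrow> 'i set \<Rightarrow> 'm) \<Rightarrow> 'i rel \<Rightarrow>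
     ('i set \<Rightarrow> 'o) \<Rightarrow> ('i set \<Rightarrow> 'i set \<Rightarrow> 'm) \<Rightarrow> ('i set \<Rightarrow> 'i set \<Rightarrow> 'm) \<Rightarrow> bool" where
  "improvement C A I r \<sigma> \<iota> \<pi> s \<sigma>' \<iota>' \<pi>' \<longleftrightarrow>
    partial_order_on I s \<and> s \<subseteq> r \<and> configuration C A I s \<sigma>' \<iota>' \<pi>' \<and>
    (\<forall>J \<in> f_sets I r. \<sigma>' J = \<sigma> J) \<and>
    (\<forall>(J, K) \<in> g_pairs I r. \<iota>' J K = \<iota> J K) \<and>
    (\<forall>(J, K) \<in> h_pairs I r. \<pi>' J K = \<pi> J K)"

definition best ::
    "('o, 'm) addcat \<Rightarrow> 'o set \<Rightarrow> 'i set \<Rightarrow> 'i rel \<Rightarrow>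
     ('i set \<Rightarrow> 'o) \<Rightarrow> ('i set \<Rightarrow> 'i set \<Rightarrow> 'm) \<Rightarrow> ('i set \<Rightarrow> 'i set \<Rightarrow> 'm) \<Rightarrow> bool" where
  "best C A I r \<sigma> \<iota> \<pi> \<longleftrightarrow>
    \<not> (\<exists>s \<sigma>' \<iota>' \<pi>'. improvement C A I r \<sigma> \<iota> \<pi> s \<sigma>' \<iota>' \<pi>' \<and> s \<noteq> r)"

end

theory Submission
  imports Defs
begin

text \<open>
  If a strict improvement over an order \<open>s\<close> exists, then some covering pair \<open>(i, j)\<close> of \<open>r\<close> is
  missing from \<open>s\<close> (\<open>ex_cover_outside\<close>). As \<open>i\<close> and \<open>j\<close> are incomparable in \<open>s\<close>, the improvement
  has inclusions of both \<open>\<sigma> {i}\<close> and \<open>\<sigma> {j}\<close> into \<open>\<sigma> {i, j}\<close> and projections onto both, and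
  these make \<open>\<sigma> {i, j}\<close> a direct sum (\<open>incomparable_split\<close>).

  Conversely, suppose that the sequence of a covering pair \<open>(i, j)\<close> splits, with retraction
  \<open>q : \<sigma> {i, j} \<rightarrow> \<sigma> {i}\<close>. Then \<open>s = r - {(i, j)}\<close> is still a partial order, and the
  configuration can be extended to \<open>s\<close>. The construction works with down-sets. A configuration
  embeds the objects \<open>\<sigma> U\<close>, for \<open>U\<close> a down-set, into \<open>\<sigma> I\<close>, compatibly with intersections and
  unions, and \<open>\<sigma> (U - D)\<close> is the quotient \<open>\<sigma> U / \<sigma> D\<close>. The down-sets of \<open>s\<close> that are not
  down-sets of \<open>r\<close> are the \<open>U\<close> that contain \<open>j\<close> but not \<open>i\<close>. For these, \<open>U \<union> {i}\<close> is a down-set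
  of \<open>r\<close> with \<open>{i, j}\<close> on top, and the kernel of \<open>\<sigma> (U \<union> {i}) \<rightarrow> \<sigma> {i, j} \<rightarrow> \<sigma> {i}\<close>, the second
  arrow being \<open>q\<close>, is the subobject to be attached to \<open>U\<close>. The splitting is what makes the
  enlarged family of subobjects compatible with intersections and unions (\<open>intersection_new\<close>,
  \<open>union_new_to_old\<close>, \<open>union_new_to_new\<close>).

  It remains to recover a configuration from such a family of subobjects
  (\<open>induced_configuration\<close>). Compatibility with intersections and unions says that a morphism
  out of the subobject of \<open>U \<union> V\<close> is the same as two morphisms out of those of \<open>U\<close> and \<open>V\<close> that
  agree on the subobject of \<open>U \<inter> V\<close> (\<open>glue_family\<close>). Therefore the subquotient attached to an
  f-set \<open>J = U - D\<close> does not depend on the choice of \<open>U\<close> and \<open>D\<close>, and \<open>\<iota> J K\<close> and \<open>\<pi> J K\<close> are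
  both the morphism that an inclusion of down-sets induces on subquotients. The axioms (B), (C)
  and (D) become instances of the functoriality of induced morphisms, and (A) becomes the third
  isomorphism theorem. One subquotient per f-set may be prescribed; prescribing the given
  \<open>\<pi> U J : \<sigma> U \<rightarrow> \<sigma> J\<close> for the f-sets \<open>J\<close> of \<open>r\<close> makes the new configuration restrict to the old
  one on the nose. Finally, its objects lie in the exact category because they are iterated
  extensions of the \<open>\<sigma> {k}\<close> (\<open>configuration_in_exact\<close>).
\<close>

section \<open>Preadditive categories\<close>

context preadditive_category
begin

lemma Hom_Obj: "f \<in> Hom C X Y \<Longrightarrow> X \<in> Obj C" "f \<in> Hom C X Y \<Longrightarrow> Y \<in> Obj C"
  using Dom_Obj Cod_Obj by (auto simp: Hom_def)

lemma Hom_group: "X \<in> Obj C \<Longrightarrow> Y \<in> Obj C \<Longrightarrow> group (hom_group C X Y)"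
  using Hom_comm_group comm_group.axioms(2) by blast

lemma Zero_Hom: "X \<in> Obj C \<Longrightarrow> Y \<in> Obj C \<Longrightarrow> Zero C X Y \<in> Hom C X Y"
  using monoid.one_closed [OF group.is_monoid [OF Hom_group]] by (simp add: hom_group_def)

lemma Plus_Hom: "f \<in> Hom C X Y \<Longrightarrow> g \<in> Hom C X Y \<Longrightarrow> Plus C f g \<in> Hom C X Y"
  using monoid.m_closed [OF group.is_monoid [OF Hom_group, of X Y], of f g] Hom_Obj
  by (auto simp: hom_group_def)

lemma Plus_Zero: "f \<in> Hom C X Y \<Longrightarrow> Plus C f (Zero C X Y) = f"
  using monoid.r_one [OF group.is_monoid [OF Hom_group, of X Y], of f] Hom_Obj
  by (auto simp: hom_group_def)

lemma Zero_Plus: "f \<in> Hom C X Y \<Longrightarrow> Plus C (Zero C X Y) f = f"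
  using monoid.l_one [OF group.is_monoid [OF Hom_group, of X Y], of f] Hom_Obj
  by (auto simp: hom_group_def)

lemma Plus_eq_right: "f \<in> Hom C X Y \<Longrightarrow> g \<in> Hom C X Y \<Longrightarrow> Plus C f g = g \<Longrightarrow> f = Zero C X Y"
  using group.l_cancel_one [OF Hom_group, of X Y g f] group.r_cancel_one [OF Hom_group, of X Y g f]
    Hom_Obj
  by (auto simp: hom_group_def)

lemma Plus_right_cancel:
  assumes f: "f \<in> Hom C X Y" and g: "g \<in> Hom C X Y" and h: "h \<in> Hom C X Y"
    and eq: "Plus C f h = Plus C g h"
  shows "f = g"
  using group.right_cancel [OF Hom_group, of X Y h f g] Hom_Obj [OF f] f g h eq
  by (simp add: hom_group_def)

lemma ex_difference:
  assumes f: "f \<in> Hom C X Y" and g: "g \<in> Hom C X Y"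
  obtains d where "d \<in> Hom C X Y" "f = Plus C d g"
proof -
  interpret G: group "hom_group C X Y"
    using Hom_group Hom_Obj f by blast
  let ?d = "mult (hom_group C X Y) f (m_inv (hom_group C X Y) g)"
  have "f \<in> carrier (hom_group C X Y)" "g \<in> carrier (hom_group C X Y)"
    using f g by (simp_all add: hom_group_def)
  then have "?d \<in> carrier (hom_group C X Y)" "mult (hom_group C X Y) ?d g = f"
    by (auto simp: G.m_assoc)
  then show thesis using that by (simp add: hom_group_def)
qed

lemma ex_negative:
  assumes f: "f \<in> Hom C X Y"
  obtains n where "n \<in> Hom C X Y" "Plus C n f = Zero C X Y"
  using ex_difference [OF Zero_Hom f] Hom_Obj [OF f] by metis

lemma Comp_Zero:
  assumes h: "h \<in> Hom C Y Z" and X: "X \<in> Obj C"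
  shows "h \<bullet> Zero C X Y = Zero C X Z"
proof -
  have z: "Zero C X Y \<in> Hom C X Y" using X h Hom_Obj Zero_Hom by blast
  have "Plus C (h \<bullet> Zero C X Y) (h \<bullet> Zero C X Y) = h \<bullet> Zero C X Y"
    using Comp_Plus [OF z z h] Plus_Zero [OF z] by simp
  then show ?thesis using Plus_eq_right Comp_Hom [OF z h] by blast
qed

lemma Zero_Comp:
  assumes h: "h \<in> Hom C X Y" and Z: "Z \<in> Obj C"
  shows "Zero C Y Z \<bullet> h = Zero C X Z"
proof -
  have z: "Zero C Y Z \<in> Hom C Y Z" using Z h Hom_Obj Zero_Hom by blast
  have "Plus C (Zero C Y Z \<bullet> h) (Zero C Y Z \<bullet> h) = Zero C Y Z \<bullet> h"
    using Plus_Comp [OF h z z] Plus_Zero [OF z] by simp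
  then show ?thesis using Plus_eq_right Comp_Hom [OF h z] by blast
qed

text \<open>
  Since hom-sets are groups, being monic or epic can be tested against zero.
\<close>

lemma monicI:
  assumes m: "m \<in> Hom C X Y"
    and 0: "\<And>W x. x \<in> Hom C W X \<Longrightarrow> m \<bullet> x = Zero C W Y \<Longrightarrow> x = Zero C W X"
  shows "monic C m"
  unfolding monic_def
proof (intro conjI allI ballI impI)
  show "m \<in> Arr C" using m by (simp add: Hom_def)
  have X: "Dom C m = X" using m by (simp add: Hom_def)
  fix W f g assume "f \<in> Hom C W (Dom C m)" "g \<in> Hom C W (Dom C m)" and eq: "m \<bullet> f = m \<bullet> g"
  then have f: "f \<in> Hom C W X" and g: "g \<in> Hom C W X" using X by auto
  obtain d where d: "d \<in> Hom C W X" "f = Plus C d g" using ex_difference [OF f g] .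
  have "Plus C (m \<bullet> d) (m \<bullet> g) = m \<bullet> g" using Comp_Plus [OF d(1) g m] d(2) eq by simp
  then have "d = Zero C W X"
    using 0 [OF d(1)] Plus_eq_right [OF Comp_Hom [OF d(1) m] Comp_Hom [OF g m]] by blast
  then show "f = g" using d(2) Zero_Plus [OF g] by simp
qed

lemma epicI:
  assumes e: "e \<in> Hom C X Y"
    and 0: "\<And>W x. x \<in> Hom C Y W \<Longrightarrow> x \<bullet> e = Zero C X W \<Longrightarrow> x = Zero C Y W"
  shows "epic C e"
  unfolding epic_def
proof (intro conjI allI ballI impI)
  show "e \<in> Arr C" using e by (simp add: Hom_def)
  have Y: "Cod C e = Y" using e by (simp add: Hom_def)
  fix W f g assume "f \<in> Hom C (Cod C e) W" "g \<in> Hom C (Cod C e) W" and eq: "f \<bullet> e = g \<bullet> e"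
  then have f: "f \<in> Hom C Y W" and g: "g \<in> Hom C Y W" using Y by auto
  obtain d where d: "d \<in> Hom C Y W" "f = Plus C d g" using ex_difference [OF f g] .
  have "Plus C (d \<bullet> e) (g \<bullet> e) = g \<bullet> e" using Plus_Comp [OF e d(1) g] d(2) eq by simp
  then have "d = Zero C Y W"
    using 0 [OF d(1)] Plus_eq_right [OF Comp_Hom [OF e d(1)] Comp_Hom [OF e g]] by blast
  then show "f = g" using d(2) Zero_Plus [OF g] by simp
qed

lemma monicD:
  "monic C m \<Longrightarrow> m \<in> Hom C X Y \<Longrightarrow> f \<in> Hom C W X \<Longrightarrow> g \<in> Hom C W X \<Longrightarrow> m \<bullet> f = m \<bullet> g \<Longrightarrow> f = g"
  by (auto simp: monic_def Hom_def)

lemma epicD: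
  "epic C e \<Longrightarrow> e \<in> Hom C X Y \<Longrightarrow> f \<in> Hom C Y W \<Longrightarrow> g \<in> Hom C Y W \<Longrightarrow> f \<bullet> e = g \<bullet> e \<Longrightarrow> f = g"
  by (auto simp: epic_def Hom_def)

lemma monic_zeroD:
  assumes "monic C m" "m \<in> Hom C X Y" "x \<in> Hom C W X" "m \<bullet> x = Zero C W Y"
  shows "x = Zero C W X"
  using assms monicD [OF assms(1-3), of "Zero C W X"] Comp_Zero Zero_Hom Hom_Obj by metis

lemma epic_zeroD:
  assumes "epic C e" "e \<in> Hom C X Y" "x \<in> Hom C Y W" "x \<bullet> e = Zero C X W"
  shows "x = Zero C Y W"
  using assms epicD [OF assms(1-3), of "Zero C Y W"] Zero_Comp Zero_Hom Hom_Obj by metis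

lemma monic_Ident: "X \<in> Obj C \<Longrightarrow> monic C (Ident C X)"
  by (rule monicI [OF Ident_Hom]) (auto simp: Ident_Comp)

lemma monic_Comp:
  assumes f: "f \<in> Hom C X Y" and g: "g \<in> Hom C Y Z" and m: "monic C f" "monic C g"
  shows "monic C (g \<bullet> f)"
proof (rule monicI [OF Comp_Hom [OF f g]])
  fix W x assume x: "x \<in> Hom C W X" and "(g \<bullet> f) \<bullet> x = Zero C W Z"
  then have "g \<bullet> (f \<bullet> x) = Zero C W Z" using Comp_assoc [OF x f g] by simp
  then show "x = Zero C W X"
    using monic_zeroD [OF m(1) f x] monic_zeroD [OF m(2) g Comp_Hom [OF x f]] by blast
qed

lemma monic_cancel_left:
  assumes f: "f \<in> Hom C X Y" and g: "g \<in> Hom C Y Z" and m: "monic C (g \<bullet> f)"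
  shows "monic C f"
proof (rule monicI [OF f])
  fix W x assume x: "x \<in> Hom C W X" and 0: "f \<bullet> x = Zero C W Y"
  have "(g \<bullet> f) \<bullet> x = Zero C W Z"
    using Comp_assoc [OF x f g] 0 Comp_Zero [OF g] Hom_Obj [OF x] by simp
  then show "x = Zero C W X" using monic_zeroD [OF m Comp_Hom [OF f g] x] by blast
qed

lemma epic_cancel_right:
  assumes f: "f \<in> Hom C X Y" and g: "g \<in> Hom C Y Z" and e: "epic C (g \<bullet> f)"
  shows "epic C g"
proof (rule epicI [OF g])
  fix W x assume x: "x \<in> Hom C Z W" and 0: "x \<bullet> g = Zero C Y W"
  have "x \<bullet> (g \<bullet> f) = Zero C X W"
    using Comp_assoc [OF f g x] 0 Zero_Comp [OF f] Hom_Obj [OF x] by simp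
  then show "x = Zero C Z W" using epic_zeroD [OF e Comp_Hom [OF f g] x] by blast
qed

lemma is_kernelI:
  assumes k: "k \<in> Hom C K X" and f: "f \<in> Hom C X Y" and m: "monic C k"
    and 0: "f \<bullet> k = Zero C K Y"
    and ex: "\<And>W h. h \<in> Hom C W X \<Longrightarrow> f \<bullet> h = Zero C W Y \<Longrightarrow> \<exists>u\<in>Hom C W K. k \<bullet> u = h"
  shows "is_kernel C k f"
proof -
  have [simp]: "Dom C k = K" "Cod C k = X" "Dom C f = X" "Cod C f = Y" "k \<in> Arr C" "f \<in> Arr C"
    using k f by (auto simp: Hom_def)
  show ?thesis
    unfolding is_kernel_def using 0 ex monicD [OF m k] by (auto; metis)
qed

lemma is_cokernelI:
  assumes c: "c \<in> Hom C Y Q" and f: "f \<in> Hom C X Y" and e: "epic C c"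
    and 0: "c \<bullet> f = Zero C X Q"
    and ex: "\<And>W h. h \<in> Hom C Y W \<Longrightarrow> h \<bullet> f = Zero C X W \<Longrightarrow> \<exists>u\<in>Hom C Q W. u \<bullet> c = h"
  shows "is_cokernel C c f"
proof -
  have [simp]: "Dom C c = Y" "Cod C c = Q" "Dom C f = X" "Cod C f = Y" "c \<in> Arr C" "f \<in> Arr C"
    using c f by (auto simp: Hom_def)
  show ?thesis
    unfolding is_cokernel_def using 0 ex epicD [OF e c] by (auto; metis)
qed

lemma kernel_zero:
  "is_kernel C k f \<Longrightarrow> k \<in> Hom C K X \<Longrightarrow> f \<in> Hom C X Y \<Longrightarrow> f \<bullet> k = Zero C K Y"
  by (auto simp: is_kernel_def Hom_def)

lemma kernel_lift:
  assumes "is_kernel C k f" "k \<in> Hom C K X" "f \<in> Hom C X Y" "h \<in> Hom C W X"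
    "f \<bullet> h = Zero C W Y"
  obtains u where "u \<in> Hom C W K" "k \<bullet> u = h"
proof -
  have eqs: "Dom C k = K" "Cod C k = X" "Dom C f = X" "Cod C f = Y"
    using assms(2,3) by (auto simp: Hom_def)
  have "\<exists>u. u \<in> Hom C W K \<and> k \<bullet> u = h"
    using assms(1,4,5) unfolding is_kernel_def eqs by blast
  then show thesis using that by blast
qed

lemma kernel_monic:
  assumes K: "is_kernel C k f" and k: "k \<in> Hom C K X"
  shows "monic C k"
proof (rule monicI [OF k])
  obtain Y where f: "f \<in> Hom C X Y" using K k by (auto simp: is_kernel_def Hom_def)
  have eqs: "Dom C k = K" "Cod C k = X" "Dom C f = X" "Cod C f = Y"
    using k f by (auto simp: Hom_def)
  fix W x assume x: "x \<in> Hom C W K" and 0: "k \<bullet> x = Zero C W X"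
  have obj: "W \<in> Obj C" "X \<in> Obj C" "K \<in> Obj C" using x k Hom_Obj by auto
  have "f \<bullet> Zero C W X = Zero C W Y" using Comp_Zero [OF f] obj by blast
  moreover have "Zero C W X \<in> Hom C W X" using Zero_Hom obj by blast
  ultimately have "\<exists>!u. u \<in> Hom C W K \<and> k \<bullet> u = Zero C W X"
    using K unfolding is_kernel_def eqs by blast
  moreover have "k \<bullet> Zero C W K = Zero C W X" "Zero C W K \<in> Hom C W K"
    using Comp_Zero [OF k] Zero_Hom obj by auto
  ultimately show "x = Zero C W K" using x 0 by blast
qed

lemma cokernel_zero:
  "is_cokernel C c f \<Longrightarrow> c \<in> Hom C Y Q \<Longrightarrow> f \<in> Hom C X Y \<Longrightarrow> c \<bullet> f = Zero C X Q"
  by (auto simp: is_cokernel_def Hom_def)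

lemma cokernel_desc:
  assumes "is_cokernel C c f" "c \<in> Hom C Y Q" "f \<in> Hom C X Y" "h \<in> Hom C Y W"
    "h \<bullet> f = Zero C X W"
  obtains u where "u \<in> Hom C Q W" "u \<bullet> c = h"
proof -
  have eqs: "Dom C c = Y" "Cod C c = Q" "Dom C f = X" "Cod C f = Y"
    using assms(2,3) by (auto simp: Hom_def)
  have "\<exists>u. u \<in> Hom C Q W \<and> u \<bullet> c = h"
    using assms(1,4,5) unfolding is_cokernel_def eqs by blast
  then show thesis using that by blast
qed

lemma cokernel_epic:
  assumes K: "is_cokernel C c f" and c: "c \<in> Hom C Y Q"
  shows "epic C c"
proof (rule epicI [OF c])
  obtain X where f: "f \<in> Hom C X Y" using K c by (auto simp: is_cokernel_def Hom_def)
  have eqs: "Dom C c = Y" "Cod C c = Q" "Dom C f = X" "Cod C f = Y"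
    using c f by (auto simp: Hom_def)
  fix W x assume x: "x \<in> Hom C Q W" and 0: "x \<bullet> c = Zero C Y W"
  have obj: "W \<in> Obj C" "Y \<in> Obj C" "Q \<in> Obj C" using x c Hom_Obj by auto
  have "Zero C Y W \<bullet> f = Zero C X W" using Zero_Comp [OF f] obj by blast
  moreover have "Zero C Y W \<in> Hom C Y W" using Zero_Hom obj by blast
  ultimately have "\<exists>!u. u \<in> Hom C Q W \<and> u \<bullet> c = Zero C Y W"
    using K unfolding is_cokernel_def eqs by blast
  moreover have "Zero C Q W \<bullet> c = Zero C Y W" "Zero C Q W \<in> Hom C Q W"
    using Zero_Comp [OF c] Zero_Hom obj by auto
  ultimately show "x = Zero C Q W" using x 0 by blast
qed

lemma factors_zero_object:
  assumes Z: "is_zero_object C Z" and f: "f \<in> Hom C X Z" and g: "g \<in> Hom C Z Y"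
  shows "g \<bullet> f = Zero C X Y"
proof -
  have Zo: "Z \<in> Obj C" using Z by (simp add: is_zero_object_def)
  have X: "X \<in> Obj C" and Y: "Y \<in> Obj C" using f g Hom_Obj by auto
  have "\<exists>!f. f \<in> Hom C X Z" using Z X by (auto simp: is_zero_object_def)
  then have "f = Zero C X Z" using f Zero_Hom [OF X Zo] by blast
  then show ?thesis using Comp_Zero [OF g X] by simp
qed

end

section \<open>Exactness in abelian categories\<close>

context abelian_category
begin

text \<open>
  An epic \<open>e\<close> is a cokernel of some \<open>g\<close>, and \<open>g\<close> is among the arrows that \<open>e\<close> kills. In terms of
  generalized elements: \<open>h\<close> factors through \<open>e\<close> as soon as it vanishes on the elements on which
  \<open>e\<close> vanishes.
\<close>

lemma epic_desc:
  assumes e: "epic C e" and eh: "e \<in> Hom C X Y" and h: "h \<in> Hom C X W"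
    and kill: "\<And>V x. x \<in> Hom C V X \<Longrightarrow> e \<bullet> x = Zero C V Y \<Longrightarrow> h \<bullet> x = Zero C V W"
  obtains u where "u \<in> Hom C Y W" "u \<bullet> e = h"
proof -
  obtain g where g: "is_cokernel C e g" using epic_normal [OF e] by blast
  then obtain V where gh: "g \<in> Hom C V X" using eh by (auto simp: is_cokernel_def Hom_def)
  have "h \<bullet> g = Zero C V W" using kill [OF gh] cokernel_zero [OF g eh gh] by blast
  then show thesis using cokernel_desc [OF g eh gh h] that by blast
qed

lemma monic_lift:
  assumes m: "monic C m" and mh: "m \<in> Hom C X Y" and h: "h \<in> Hom C W Y"
    and kill: "\<And>V x. x \<in> Hom C Y V \<Longrightarrow> x \<bullet> m = Zero C X V \<Longrightarrow> x \<bullet> h = Zero C W V"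
  obtains u where "u \<in> Hom C W X" "m \<bullet> u = h"
proof -
  obtain g where g: "is_kernel C m g" using monic_normal [OF m] by blast
  then obtain V where gh: "g \<in> Hom C Y V" using mh by (auto simp: is_kernel_def Hom_def)
  have "g \<bullet> h = Zero C W V" using kill [OF gh] kernel_zero [OF g mh gh] by blast
  then show thesis using kernel_lift [OF g mh gh h] that by blast
qed

lemma kernel_of_cokernel:
  assumes m: "monic C m" and c: "is_cokernel C c m"
  shows "is_kernel C m c"
proof -
  obtain X Y where mh: "m \<in> Hom C X Y" using m by (auto simp: monic_def Hom_def)
  obtain Q where ch: "c \<in> Hom C Y Q" using c mh by (auto simp: is_cokernel_def Hom_def)
  show ?thesis
  proof (rule is_kernelI [OF mh ch m cokernel_zero [OF c ch mh]])
    fix W h assume h: "h \<in> Hom C W Y" and 0: "c \<bullet> h = Zero C W Q"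
    have "x \<bullet> h = Zero C W V" if x: "x \<in> Hom C Y V" "x \<bullet> m = Zero C X V" for V x
    proof -
      obtain u where u: "u \<in> Hom C Q V" "u \<bullet> c = x" using cokernel_desc [OF c ch mh x] .
      have "x \<bullet> h = u \<bullet> (c \<bullet> h)" using Comp_assoc [OF h ch u(1)] u(2) by simp
      then show ?thesis using 0 Comp_Zero [OF u(1)] Hom_Obj [OF h] by simp
    qed
    then show "\<exists>u\<in>Hom C W X. m \<bullet> u = h" using monic_lift [OF m mh h] by metis
  qed
qed

lemma cokernel_of_kernel:
  assumes e: "epic C e" and k: "is_kernel C k e"
  shows "is_cokernel C e k"
proof -
  obtain X Y where eh: "e \<in> Hom C X Y" using e by (auto simp: epic_def Hom_def)
  obtain K where kh: "k \<in> Hom C K X" using k eh by (auto simp: is_kernel_def Hom_def)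
  show ?thesis
  proof (rule is_cokernelI [OF eh kh e kernel_zero [OF k kh eh]])
    fix W h assume h: "h \<in> Hom C X W" and 0: "h \<bullet> k = Zero C K W"
    have "h \<bullet> x = Zero C V W" if x: "x \<in> Hom C V X" "e \<bullet> x = Zero C V Y" for V x
    proof -
      obtain u where u: "u \<in> Hom C V K" "k \<bullet> u = x" using kernel_lift [OF k kh eh x] .
      have "h \<bullet> x = (h \<bullet> k) \<bullet> u" using Comp_assoc [OF u(1) kh h] u(2) by simp
      then show ?thesis using 0 Zero_Comp [OF u(1)] Hom_Obj [OF h] by simp
    qed
    then show "\<exists>u\<in>Hom C Y W. u \<bullet> e = h" using epic_desc [OF e eh h] by metis
  qed
qed

text \<open>
  This allows elements to be lifted along an epic arrow \<open>e\<close>, after a further epic arrow. The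
  pullback is the kernel of \<open>(e, - f) : X \<oplus> Y \<rightarrow> Z\<close>. That arrow is epic because \<open>e\<close> is, so it is
  the cokernel of its kernel; hence an arrow that vanishes on the image of the pullback in \<open>Y\<close>
  factors through it, and restricting the factorization to \<open>X\<close> shows that it is zero.
\<close>

lemma pullback_epic:
  assumes e: "epic C e" and eh: "e \<in> Hom C X Z" and f: "f \<in> Hom C Y Z"
  obtains P p x where "p \<in> Hom C P Y" "epic C p" "x \<in> Hom C P X" "e \<bullet> x = f \<bullet> p"
proof -
  obtain n where n: "n \<in> Hom C Y Z" "Plus C n f = Zero C Y Z" using ex_negative [OF f] .
  have obj: "X \<in> Obj C" "Y \<in> Obj C" "Z \<in> Obj C" using eh f Hom_Obj by auto
  obtain S i1 i2 p1 p2 where S: "is_direct_sum C X Y S i1 i2 p1 p2"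
    using ex_direct_sum obj by blast
  have i1: "i1 \<in> Hom C X S" and i2: "i2 \<in> Hom C Y S" and p1: "p1 \<in> Hom C S X"
    and p2: "p2 \<in> Hom C S Y" and pi: "p1 \<bullet> i1 = Ident C X" "p2 \<bullet> i2 = Ident C Y"
      "p1 \<bullet> i2 = Zero C Y X" "p2 \<bullet> i1 = Zero C X Y"
    using S by (auto simp: is_direct_sum_def)
  let ?d = "Plus C (e \<bullet> p1) (n \<bullet> p2)"
  have ep: "e \<bullet> p1 \<in> Hom C S Z" "n \<bullet> p2 \<in> Hom C S Z" using Comp_Hom p1 p2 eh n by blast+
  have d: "?d \<in> Hom C S Z" using Plus_Hom ep .
  have di1: "?d \<bullet> i1 = e"
    using Plus_Comp [OF i1 ep] Comp_assoc [OF i1 p1 eh] Comp_assoc [OF i1 p2 n(1)] pi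
      Comp_Ident [OF eh] Comp_Zero [OF n(1) obj(1)] Plus_Zero [OF eh] by simp
  have dm: "epic C ?d" using epic_cancel_right [OF i1 d] di1 e by simp
  obtain k where k: "is_kernel C k ?d" using ex_kernel d by (auto simp: Hom_def)
  then obtain P where kh: "k \<in> Hom C P S" using d by (auto simp: is_kernel_def Hom_def)
  have P: "P \<in> Obj C" using Hom_Obj kh by blast
  have ck: "is_cokernel C ?d k" using cokernel_of_kernel dm k .
  have p2k: "p2 \<bullet> k \<in> Hom C P Y" and p1k: "p1 \<bullet> k \<in> Hom C P X" using Comp_Hom kh p1 p2 by blast+
  have epi: "epic C (p2 \<bullet> k)"
  proof (rule epicI [OF p2k])
    fix W h assume h: "h \<in> Hom C Y W" and 0: "h \<bullet> (p2 \<bullet> k) = Zero C P W"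
    have hp: "h \<bullet> p2 \<in> Hom C S W" using Comp_Hom p2 h .
    have "(h \<bullet> p2) \<bullet> k = Zero C P W" using Comp_assoc [OF kh p2 h] 0 by simp
    then obtain t where t: "t \<in> Hom C Z W" "t \<bullet> ?d = h \<bullet> p2"
      using cokernel_desc [OF ck d kh hp] by blast
    have "t \<bullet> e = (h \<bullet> p2) \<bullet> i1" using Comp_assoc [OF i1 d t(1)] t(2) di1 by simp
    also have "\<dots> = Zero C X W" using Comp_assoc [OF i1 p2 h] pi Comp_Zero [OF h obj(1)] by simp
    finally have "t = Zero C Z W" using epic_zeroD [OF e eh t(1)] by blast
    then have "h \<bullet> p2 = Zero C S W" using t(2) Zero_Comp [OF d] Hom_Obj [OF h] by simp
    then have "h \<bullet> (p2 \<bullet> i2) = Zero C Y W"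
      using Comp_assoc [OF i2 p2 h] Zero_Comp [OF i2] Hom_Obj [OF h] by simp
    then show "h = Zero C Y W" using pi Comp_Ident [OF h] by simp
  qed
  have "Zero C P Z = ?d \<bullet> k" using kernel_zero [OF k kh d] by simp
  also have "\<dots> = Plus C (e \<bullet> (p1 \<bullet> k)) (n \<bullet> (p2 \<bullet> k))"
    using Plus_Comp [OF kh ep] Comp_assoc [OF kh p1 eh] Comp_assoc [OF kh p2 n(1)] by simp
  finally have 1: "Plus C (e \<bullet> (p1 \<bullet> k)) (n \<bullet> (p2 \<bullet> k)) = Zero C P Z" by simp
  have 2: "Plus C (f \<bullet> (p2 \<bullet> k)) (n \<bullet> (p2 \<bullet> k)) = Zero C P Z"
  proof -
    have "Plus C f n = Zero C Y Z"
      using comm_group.axioms(1) [OF Hom_comm_group [OF obj(2,3)]] n f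
        comm_monoid.m_comm [of "hom_group C Y Z" f n]
      by (simp add: hom_group_def)
    then show ?thesis using Plus_Comp [OF p2k f n(1)] Zero_Comp [OF p2k obj(3)] by simp
  qed
  have "e \<bullet> (p1 \<bullet> k) = f \<bullet> (p2 \<bullet> k)"
    using Plus_right_cancel [OF Comp_Hom [OF p1k eh] Comp_Hom [OF p2k f] Comp_Hom [OF p2k n(1)]]
      1 2 by simp
  then show thesis using that [OF p2k epi p1k] by blast
qed

lemma short_exactI:
  assumes m: "monic C f" and c: "is_cokernel C g f"
  shows "short_exact C f g"
  unfolding short_exact_def using kernel_of_cokernel [OF m c] c by blast

text \<open>
  The exact sequence \<open>0 \<rightarrow> Y / X \<rightarrow> Z / X \<rightarrow> Z / Y \<rightarrow> 0\<close> for \<open>X \<le> Y \<le> Z\<close>. Everything but the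
  injectivity of \<open>i\<close> follows formally from universal properties. For injectivity, an element of
  \<open>Y / X\<close> that dies in \<open>Z / X\<close> is lifted to \<open>Y\<close>, where it must lie in \<open>X\<close>.
\<close>

lemma third_isomorphism:
  assumes a: "a \<in> Hom C X Y" and b: "b \<in> Hom C Y Z" and mb: "monic C b"
    and ma: "monic C a"
    and p: "p \<in> Hom C Y P" "is_cokernel C p a"
    and q: "q \<in> Hom C Z Q" "is_cokernel C q (b \<bullet> a)"
    and t: "t \<in> Hom C Z R" "is_cokernel C t b"
    and i: "i \<in> Hom C P Q" "i \<bullet> p = q \<bullet> b"
    and j: "j \<in> Hom C Q R" "j \<bullet> q = t"
  shows "short_exact C i j"
proof (rule short_exactI)
  have ba: "b \<bullet> a \<in> Hom C X Z" using Comp_Hom a b .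
  have ker: "is_kernel C (b \<bullet> a) q" using kernel_of_cokernel monic_Comp [OF a b ma mb] q(2) by blast
  show "monic C i"
  proof (rule monicI [OF i(1)])
    fix W x assume x: "x \<in> Hom C W P" and 0: "i \<bullet> x = Zero C W Q"
    obtain V e y where y: "e \<in> Hom C V W" "epic C e" "y \<in> Hom C V Y" "p \<bullet> y = x \<bullet> e"
      using pullback_epic [OF cokernel_epic [OF p(2,1)] p(1) x] .
    have V: "V \<in> Obj C" and R: "R \<in> Obj C" and Q: "Q \<in> Obj C" using Hom_Obj y(1) t(1) q(1) by auto
    have by': "b \<bullet> y \<in> Hom C V Z" using Comp_Hom y(3) b .
    have "q \<bullet> (b \<bullet> y) = i \<bullet> (p \<bullet> y)"
      using Comp_assoc [OF y(3) b q(1)] Comp_assoc [OF y(3) p(1) i(1)] i(2) by simp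
    also have "\<dots> = Zero C V Q"
      using y(4) Comp_assoc [OF y(1) x i(1)] 0 Zero_Comp [OF y(1) Q] by simp
    finally obtain u where u: "u \<in> Hom C V X" "(b \<bullet> a) \<bullet> u = b \<bullet> y"
      using kernel_lift [OF ker ba q(1) by'] by blast
    have "a \<bullet> u = y"
      using monicD [OF mb b Comp_Hom [OF u(1) a] y(3)] u(2) Comp_assoc [OF u(1) a b] by simp
    then have "x \<bullet> e = Zero C V P"
      using y(4) Comp_assoc [OF u(1) a p(1)] cokernel_zero [OF p(2,1) a] Zero_Comp [OF u(1)]
        Hom_Obj [OF p(1)] by simp
    then show "x = Zero C W P" using epic_zeroD [OF y(2,1) x] by blast
  qed
  have epj: "epic C j"
    using epic_cancel_right [OF q(1) j(1)] j(2) cokernel_epic [OF t(2,1)] by simp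
  have ep: "epic C p" using cokernel_epic [OF p(2,1)] .
  have ji: "j \<bullet> i = Zero C P R"
  proof (rule epic_zeroD [OF ep p(1) Comp_Hom [OF i(1) j(1)]])
    show "(j \<bullet> i) \<bullet> p = Zero C Y R"
      using Comp_assoc [OF p(1) i(1) j(1)] i(2) Comp_assoc [OF b q(1) j(1)] j(2)
        cokernel_zero [OF t(2,1) b] by simp
  qed
  show "is_cokernel C j i"
  proof (rule is_cokernelI [OF j(1) i(1) epj ji])
    fix W h assume h: "h \<in> Hom C Q W" and 0: "h \<bullet> i = Zero C P W"
    have hq: "h \<bullet> q \<in> Hom C Z W" using Comp_Hom q(1) h .
    have "(h \<bullet> q) \<bullet> b = (h \<bullet> i) \<bullet> p"
      using Comp_assoc [OF b q(1) h] Comp_assoc [OF p(1) i(1) h] i(2) by simp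
    also have "\<dots> = Zero C Y W" using 0 Zero_Comp [OF p(1)] Hom_Obj [OF h] by simp
    finally obtain u where u: "u \<in> Hom C R W" "u \<bullet> t = h \<bullet> q"
      using cokernel_desc [OF t(2,1) b hq] by blast
    have "(u \<bullet> j) \<bullet> q = h \<bullet> q" using Comp_assoc [OF q(1) j(1) u(1)] j(2) u(2) by simp
    then have "u \<bullet> j = h"
      using epicD [OF cokernel_epic [OF q(2,1)] q(1) Comp_Hom [OF j(1) u(1)] h] by blast
    then show "\<exists>u\<in>Hom C R W. u \<bullet> j = h" using u(1) by blast
  qed
qed

text \<open>
  If \<open>S1\<close> and \<open>S2\<close> together generate \<open>S\<close> and meet in \<open>S0\<close>, then \<open>S\<close> is their pushout over \<open>S0\<close>.
  Indeed \<open>(f1, f2) : S1 \<oplus> S2 \<rightarrow> S\<close> is epic, its elements of value zero are the pairs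
  \<open>(g1 z, - g2 z)\<close>, and \<open>(a, b)\<close> vanishes on those.
\<close>

lemma glue:
  assumes f1: "f1 \<in> Hom C S1 S" and f2: "f2 \<in> Hom C S2 S"
    and g1: "g1 \<in> Hom C S0 S1" and g2: "g2 \<in> Hom C S0 S2"
    and int: "\<And>W x y. x \<in> Hom C W S1 \<Longrightarrow> y \<in> Hom C W S2 \<Longrightarrow> f1 \<bullet> x = f2 \<bullet> y \<Longrightarrow>
      \<exists>z\<in>Hom C W S0. g1 \<bullet> z = x \<and> g2 \<bullet> z = y"
    and sum: "\<And>W h. h \<in> Hom C S W \<Longrightarrow> h \<bullet> f1 = Zero C S1 W \<Longrightarrow> h \<bullet> f2 = Zero C S2 W \<Longrightarrow>
      h = Zero C S W"
    and a: "a \<in> Hom C S1 T" and b: "b \<in> Hom C S2 T" and ab: "a \<bullet> g1 = b \<bullet> g2"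
  obtains c where "c \<in> Hom C S T" "c \<bullet> f1 = a" "c \<bullet> f2 = b"
proof -
  have obj: "S1 \<in> Obj C" "S2 \<in> Obj C" "S \<in> Obj C" "T \<in> Obj C" using f1 f2 a Hom_Obj by auto
  obtain D i1 i2 p1 p2 where D: "is_direct_sum C S1 S2 D i1 i2 p1 p2"
    using ex_direct_sum obj by blast
  have i1: "i1 \<in> Hom C S1 D" and i2: "i2 \<in> Hom C S2 D" and p1: "p1 \<in> Hom C D S1"
    and p2: "p2 \<in> Hom C D S2" and pi: "p1 \<bullet> i1 = Ident C S1" "p2 \<bullet> i2 = Ident C S2"
      "p1 \<bullet> i2 = Zero C S2 S1" "p2 \<bullet> i1 = Zero C S1 S2"
    using D by (auto simp: is_direct_sum_def)
  have plus1: "Plus C (h1 \<bullet> p1) (h2 \<bullet> p2) \<bullet> i1 = h1"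
    and plus2: "Plus C (h1 \<bullet> p1) (h2 \<bullet> p2) \<bullet> i2 = h2"
    and plusH: "Plus C (h1 \<bullet> p1) (h2 \<bullet> p2) \<in> Hom C D W"
    if h1: "h1 \<in> Hom C S1 W" and h2: "h2 \<in> Hom C S2 W" for h1 h2 W
  proof -
    have hp: "h1 \<bullet> p1 \<in> Hom C D W" "h2 \<bullet> p2 \<in> Hom C D W" using Comp_Hom p1 p2 h1 h2 by blast+
    show "Plus C (h1 \<bullet> p1) (h2 \<bullet> p2) \<bullet> i1 = h1"
      using Plus_Comp [OF i1 hp] Comp_assoc [OF i1 p1 h1] Comp_assoc [OF i1 p2 h2] pi
        Comp_Ident [OF h1] Comp_Zero [OF h2 obj(1)] Plus_Zero [OF h1] by simp
    show "Plus C (h1 \<bullet> p1) (h2 \<bullet> p2) \<bullet> i2 = h2"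
      using Plus_Comp [OF i2 hp] Comp_assoc [OF i2 p1 h1] Comp_assoc [OF i2 p2 h2] pi
        Comp_Ident [OF h2] Comp_Zero [OF h1 obj(2)] Zero_Plus [OF h2] by simp
    show "Plus C (h1 \<bullet> p1) (h2 \<bullet> p2) \<in> Hom C D W" using Plus_Hom hp .
  qed
  let ?d = "Plus C (f1 \<bullet> p1) (f2 \<bullet> p2)" and ?h = "Plus C (a \<bullet> p1) (b \<bullet> p2)"
  have d: "?d \<in> Hom C D S" and h: "?h \<in> Hom C D T" using plusH f1 f2 a b by blast+
  have "epic C ?d"
  proof (rule epicI [OF d])
    fix W x assume x: "x \<in> Hom C S W" and 0: "x \<bullet> ?d = Zero C D W"
    have W: "W \<in> Obj C" using x Hom_Obj by blast
    have "x \<bullet> f1 = (x \<bullet> ?d) \<bullet> i1" using Comp_assoc [OF i1 d x] plus1 [OF f1 f2] by simp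
    moreover have "x \<bullet> f2 = (x \<bullet> ?d) \<bullet> i2" using Comp_assoc [OF i2 d x] plus2 [OF f1 f2] by simp
    ultimately show "x = Zero C S W" using sum [OF x] 0 Zero_Comp i1 i2 W by simp
  qed
  moreover have "?h \<bullet> x = Zero C V T" if x: "x \<in> Hom C V D" and 0: "?d \<bullet> x = Zero C V S" for V x
  proof -
    have V: "V \<in> Obj C" using x Hom_Obj by blast
    have x1: "p1 \<bullet> x \<in> Hom C V S1" and x2: "p2 \<bullet> x \<in> Hom C V S2" using Comp_Hom x p1 p2 by blast+
    have exp: "Plus C (h1 \<bullet> p1) (h2 \<bullet> p2) \<bullet> x = Plus C (h1 \<bullet> (p1 \<bullet> x)) (h2 \<bullet> (p2 \<bullet> x))"
      if h1: "h1 \<in> Hom C S1 W" and h2: "h2 \<in> Hom C S2 W" for h1 h2 W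
      using Plus_Comp [OF x Comp_Hom [OF p1 h1] Comp_Hom [OF p2 h2]]
        Comp_assoc [OF x p1 h1] Comp_assoc [OF x p2 h2] by simp
    obtain n where n: "n \<in> Hom C V S2" "Plus C n (p2 \<bullet> x) = Zero C V S2"
      using ex_negative [OF x2] .
    have "Plus C (f1 \<bullet> (p1 \<bullet> x)) (f2 \<bullet> (p2 \<bullet> x)) = Plus C (f2 \<bullet> n) (f2 \<bullet> (p2 \<bullet> x))"
      using exp [OF f1 f2] 0 Comp_Plus [OF n(1) x2 f2] n(2) Comp_Zero [OF f2 V] by simp
    then have "f1 \<bullet> (p1 \<bullet> x) = f2 \<bullet> n"
      using Plus_right_cancel [OF Comp_Hom [OF x1 f1] Comp_Hom [OF n(1) f2] Comp_Hom [OF x2 f2]]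
      by simp
    then obtain z where z: "z \<in> Hom C V S0" "g1 \<bullet> z = p1 \<bullet> x" "g2 \<bullet> z = n"
      using int [OF x1 n(1)] by blast
    have "a \<bullet> (p1 \<bullet> x) = b \<bullet> n"
      using Comp_assoc [OF z(1) g1 a] Comp_assoc [OF z(1) g2 b] z(2,3) ab by simp
    then have "?h \<bullet> x = b \<bullet> Plus C n (p2 \<bullet> x)"
      using exp [OF a b] Comp_Plus [OF n(1) x2 b] by simp
    then show ?thesis using n(2) Comp_Zero [OF b V] by simp
  qed
  ultimately obtain c where c: "c \<in> Hom C S T" "c \<bullet> ?d = ?h" using epic_desc [OF _ d h] by blast
  have "c \<bullet> f1 = a" using Comp_assoc [OF i1 d c(1)] c(2) plus1 [OF f1 f2] plus1 [OF a b] by simp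
  moreover have "c \<bullet> f2 = b"
    using Comp_assoc [OF i2 d c(1)] c(2) plus2 [OF f1 f2] plus2 [OF a b] by simp
  ultimately show thesis using that c(1) by blast
qed

end

section \<open>Down-sets\<close>

definition down_sets :: "'i set \<Rightarrow> 'i rel \<Rightarrow> 'i set set" where
  "down_sets I r = {U. U \<subseteq> I \<and> (\<forall>u\<in>U. \<forall>x. (x, u) \<in> r \<longrightarrow> x \<in> U)}"

definition down_closure :: "'i rel \<Rightarrow> 'i set \<Rightarrow> 'i set" where
  "down_closure r J = {x. \<exists>y\<in>J. (x, y) \<in> r}"

text \<open>
  The f-sets are the differences \<open>U - D\<close> of down-sets \<open>D \<subseteq> U\<close>. Such a presentation of \<open>J\<close> is
  recorded by \<open>U\<close> alone, as \<open>D = U - J\<close>.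
\<close>

definition upper_part :: "'i set \<Rightarrow> 'i rel \<Rightarrow> 'i set \<Rightarrow> 'i set \<Rightarrow> bool" where
  "upper_part I r U J \<longleftrightarrow> U \<in> down_sets I r \<and> J \<subseteq> U \<and> U - J \<in> down_sets I r"

text \<open>
  The last condition says \<open>U - J \<subseteq> V - K\<close>, so that the inclusion of \<open>U\<close> in \<open>V\<close> induces a
  morphism from the subquotient of \<open>J\<close> to that of \<open>K\<close>. The pairs in \<open>g_pairs\<close> and those in
  \<open>h_pairs\<close> can both be presented in this way.
\<close>

definition linked :: "'i set \<Rightarrow> 'i rel \<Rightarrow> 'i set \<Rightarrow> 'i set \<Rightarrow> 'i set \<Rightarrow> 'i set \<Rightarrow> bool" where
  "linked I r U V J K \<longleftrightarrow> upper_part I r U J \<and> upper_part I r V K \<and> U \<subseteq> V \<and> U \<inter> K \<subseteq> J"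

lemma down_sets_Int: "U \<in> down_sets I r \<Longrightarrow> V \<in> down_sets I r \<Longrightarrow> U \<inter> V \<in> down_sets I r"
  by (auto simp: down_sets_def)

lemma down_sets_Un: "U \<in> down_sets I r \<Longrightarrow> V \<in> down_sets I r \<Longrightarrow> U \<union> V \<in> down_sets I r"
  by (auto simp: down_sets_def)

lemma down_sets_f_sets: "U \<in> down_sets I r \<Longrightarrow> U \<in> f_sets I r"
  by (auto simp: down_sets_def f_sets_def)

lemma down_sets_g_pairs:
  "U \<in> down_sets I r \<Longrightarrow> V \<in> down_sets I r \<Longrightarrow> U \<subseteq> V \<Longrightarrow> (U, V) \<in> g_pairs I r"
  unfolding g_pairs_def using down_sets_f_sets [of U I r] down_sets_f_sets [of V I r]
  by (simp add: down_sets_def)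

lemma upper_part_Int:
  assumes "upper_part I r U J" "upper_part I r V J"
  shows "upper_part I r (U \<inter> V) J"
proof -
  have "U \<inter> V - J = (U - J) \<inter> (V - J)" by blast
  then show ?thesis
    using assms down_sets_Int [of U I r V] down_sets_Int [of "U - J" I r "V - J"]
    by (simp add: upper_part_def)
qed

lemma upper_part_h_pairs:
  assumes "upper_part I r U J"
  shows "(U, J) \<in> h_pairs I r"
proof -
  have U: "U \<in> down_sets I r" "J \<subseteq> U" "U - J \<in> down_sets I r"
    using assms by (auto simp: upper_part_def)
  have up: "j \<in> J" if "j \<in> U" "k \<in> J" "(k, j) \<in> r" for j k
    using U(3) that unfolding down_sets_def by blast
  have down: "x \<in> U" if "u \<in> U" "(x, u) \<in> r" for u x
    using U(1) that unfolding down_sets_def by blast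
  have "J \<subseteq> I" using U(1,2) unfolding down_sets_def by blast
  moreover have "i \<in> J" if "h \<in> J" "j \<in> J" "(h, i) \<in> r" "(i, j) \<in> r" for h i j
    using up [OF down [of j i] that(1,3)] that U(2) by blast
  ultimately have "J \<in> f_sets I r" unfolding f_sets_def by blast
  then show ?thesis using down_sets_f_sets [OF U(1)] U(2) up unfolding h_pairs_def by blast
qed

lemma upper_part_f_sets: "upper_part I r U J \<Longrightarrow> J \<in> f_sets I r"
  using upper_part_h_pairs by (auto simp: h_pairs_def)

lemma linked_trans:
  "linked I r U V J K \<Longrightarrow> linked I r V W K L \<Longrightarrow> linked I r U W J L"
  by (auto simp: linked_def)

lemma linked_refl: "upper_part I r U J \<Longrightarrow> linked I r U U J J"
  by (auto simp: linked_def)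

lemma f_sets_sub: "J \<in> f_sets I r \<Longrightarrow> J \<subseteq> I"
  by (simp add: f_sets_def)

lemma g_pairsD: "(J, K) \<in> g_pairs I r \<Longrightarrow> j \<in> J \<Longrightarrow> k \<in> K \<Longrightarrow> (k, j) \<in> r \<Longrightarrow> k \<in> J"
  and g_pairs_f: "(J, K) \<in> g_pairs I r \<Longrightarrow> J \<in> f_sets I r \<and> K \<in> f_sets I r \<and> J \<subseteq> K"
  by (auto simp: g_pairs_def)

lemma h_pairsD: "(J, K) \<in> h_pairs I r \<Longrightarrow> j \<in> J \<Longrightarrow> k \<in> K \<Longrightarrow> (k, j) \<in> r \<Longrightarrow> j \<in> K"
  and h_pairs_f: "(J, K) \<in> h_pairs I r \<Longrightarrow> J \<in> f_sets I r \<and> K \<in> f_sets I r \<and> K \<subseteq> J"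
  by (auto simp: h_pairs_def)

lemma h_pair_Int:
  assumes J: "(J, K) \<in> g_pairs I r" and L: "(K, L) \<in> h_pairs I r"
  shows "(J, J \<inter> L) \<in> h_pairs I r"
proof -
  have f: "J \<in> f_sets I r" "L \<in> f_sets I r" "J \<subseteq> K"
    using g_pairs_f [OF J] h_pairs_f [OF L] by auto
  then have "J \<inter> L \<in> f_sets I r" unfolding f_sets_def by blast
  moreover have "j \<in> L" if "j \<in> J" "k \<in> J \<inter> L" "(k, j) \<in> r" for j k
    using h_pairsD [OF L, of j k] that f(3) by blast
  ultimately show ?thesis using f by (auto simp: h_pairs_def)
qed

lemma h_pairs_trans:
  assumes K: "(J, K) \<in> h_pairs I r" and L: "(K, L) \<in> h_pairs I r"
  shows "(J, L) \<in> h_pairs I r"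
proof -
  have f: "J \<in> f_sets I r" "L \<in> f_sets I r" "K \<subseteq> J" "L \<subseteq> K"
    using h_pairs_f [OF K] h_pairs_f [OF L] by auto
  moreover have "j \<in> L" if "j \<in> J" "k \<in> L" "(k, j) \<in> r" for j k
    using h_pairsD [OF L _ that(2,3)] h_pairsD [OF K that(1) _ that(3)] that f(4) by blast
  ultimately show ?thesis unfolding h_pairs_def by blast
qed

lemma f_sets_empty: "{} \<in> f_sets I r"
  by (simp add: f_sets_def)

context
  fixes I :: "'i set" and r :: "'i rel"
  assumes order: "partial_order_on I r"
begin

lemma order_in: "(x, y) \<in> r \<Longrightarrow> x \<in> I \<and> y \<in> I"
  and order_refl: "x \<in> I \<Longrightarrow> (x, x) \<in> r"
  and order_trans: "(x, y) \<in> r \<Longrightarrow> (y, z) \<in> r \<Longrightarrow> (x, z) \<in> r"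
  and order_antisym: "(x, y) \<in> r \<Longrightarrow> (y, x) \<in> r \<Longrightarrow> x = y"
  using order unfolding partial_order_on_def preorder_on_def refl_on_def
  by (blast, blast, blast dest: transD, blast dest: antisymD)

lemma down_closure: "J \<subseteq> I \<Longrightarrow> down_closure r J \<in> down_sets I r"
  unfolding down_closure_def down_sets_def using order_in order_trans by blast

lemma down_closure_superset: "J \<subseteq> I \<Longrightarrow> J \<subseteq> down_closure r J"
  using order_refl by (auto simp: down_closure_def)

lemma f_sets_singleton: "i \<in> I \<Longrightarrow> {i} \<in> f_sets I r"
  using order_antisym by (auto simp: f_sets_def)

lemma f_setsD: "J \<in> f_sets I r \<Longrightarrow> h \<in> J \<Longrightarrow> j \<in> J \<Longrightarrow> (h, i) \<in> r \<Longrightarrow> (i, j) \<in> r \<Longrightarrow> i \<in> J"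
  using order_in by (auto simp: f_sets_def)

lemma cover_pairs:
  assumes ij: "(i, j) \<in> r" "i \<noteq> j"
    and cover: "\<not> (\<exists>k\<in>I. i \<noteq> k \<and> k \<noteq> j \<and> (i, k) \<in> r \<and> (k, j) \<in> r)"
  shows "{i} \<in> f_sets I r" and "{j} \<in> f_sets I r" and "{i, j} \<in> f_sets I r"
    and "({i}, {i, j}) \<in> g_pairs I r" and "({i, j}, {j}) \<in> h_pairs I r"
proof -
  show i: "{i} \<in> f_sets I r" and j: "{j} \<in> f_sets I r"
    using f_sets_singleton order_in [OF ij(1)] by auto
  have "k \<in> {i, j}" if k: "h \<in> {i, j}" "l \<in> {i, j}" "(h, k) \<in> r" "(k, l) \<in> r" for h k l
  proof -
    have "(i, k) \<in> r" using k order_trans [OF ij(1)] by auto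
    moreover have "(k, j) \<in> r" using k order_trans [OF _ ij(1)] by auto
    moreover have "k \<in> I" using order_in [OF k(3)] by blast
    ultimately show ?thesis using cover by auto
  qed
  then show ij': "{i, j} \<in> f_sets I r" using order_in [OF ij(1)] unfolding f_sets_def by blast
  have "(j, i) \<notin> r" using order_antisym [OF ij(1)] ij(2) by blast
  then show "({i}, {i, j}) \<in> g_pairs I r" "({i, j}, {j}) \<in> h_pairs I r"
    using i j ij' by (auto simp: g_pairs_def h_pairs_def)
qed

lemma upper_part_h_pair:
  assumes "(J, K) \<in> h_pairs I r"
  shows "upper_part I r (down_closure r J) K"
proof -
  have J: "J \<in> f_sets I r" "K \<subseteq> J" "J \<subseteq> I" using h_pairs_f [OF assms] f_sets_sub by auto
  have U: "down_closure r J \<in> down_sets I r" using down_closure J by blast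
  have "y \<in> down_closure r J - K" if x: "x \<in> down_closure r J - K" "(y, x) \<in> r" for x y
  proof -
    obtain j where j: "j \<in> J" "(x, j) \<in> r" using x by (auto simp: down_closure_def)
    have "y \<notin> K"
    proof
      assume "y \<in> K"
      then have "x \<in> J" using f_setsD [OF J(1) _ j(1) x(2) j(2)] J by blast
      then show False using h_pairsD [OF assms _ \<open>y \<in> K\<close> x(2)] x(1) by blast
    qed
    then show ?thesis using U x unfolding down_sets_def by blast
  qed
  moreover have "down_closure r J - K \<subseteq> I" using U unfolding down_sets_def by blast
  ultimately have "down_closure r J - K \<in> down_sets I r" unfolding down_sets_def by blast
  then show ?thesis
    using U down_closure_superset [OF J(3)] J(2) by (simp add: upper_part_def)
qed

lemma upper_part_down_closure:
  assumes "J \<in> f_sets I r"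
  shows "upper_part I r (down_closure r J) J"
  using upper_part_h_pair [of J J] assms by (simp add: h_pairs_def)

lemma linked_g_pair:
  assumes "(J, K) \<in> g_pairs I r"
  shows "linked I r (down_closure r J) (down_closure r K) J K"
proof -
  have JK: "J \<in> f_sets I r" "K \<in> f_sets I r" "J \<subseteq> K" using g_pairs_f [OF assms] by auto
  have "down_closure r J \<inter> K \<subseteq> J"
    unfolding down_closure_def using g_pairsD [OF assms] by blast
  moreover have "down_closure r J \<subseteq> down_closure r K"
    using JK(3) by (auto simp: down_closure_def)
  ultimately show ?thesis
    using upper_part_down_closure [OF JK(1)] upper_part_down_closure [OF JK(2)]
    by (simp add: linked_def)
qed

lemma linked_h_pair:
  assumes "(J, K) \<in> h_pairs I r"
  shows "linked I r (down_closure r J) (down_closure r J) J K"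
proof -
  have JK: "J \<in> f_sets I r" "K \<subseteq> J" using h_pairs_f [OF assms] by auto
  then show ?thesis
    using upper_part_down_closure [OF JK(1)] upper_part_h_pair [OF assms] by (auto simp: linked_def)
qed

lemma h_pair_complement:
  assumes L: "(K, L) \<in> h_pairs I r"
  shows "(K - L, K) \<in> g_pairs I r"
proof -
  have f: "K \<in> f_sets I r" "L \<subseteq> K" using h_pairs_f [OF L] by auto
  have down: "k \<in> K - L" if "j \<in> K - L" "k \<in> K" "(k, j) \<in> r" for j k
    using h_pairsD [OF L, of j k] that by blast
  have "i \<in> K - L" if "h \<in> K - L" "j \<in> K - L" "(h, i) \<in> r" "(i, j) \<in> r" for h i j
    using down [OF that(2) f_setsD [OF f(1) _ _ that(3,4)] that(4)] that(1,2) by blast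
  then have "K - L \<in> f_sets I r" using f_sets_sub [OF f(1)] unfolding f_sets_def by blast
  then show ?thesis using f down unfolding g_pairs_def by blast
qed

lemma linked_Int:
  assumes J: "(J, K) \<in> g_pairs I r" and L: "(K, L) \<in> h_pairs I r"
  shows "linked I r (down_closure r J) (down_closure r K) (J \<inter> L) L"
proof -
  have "L \<subseteq> K" using h_pairs_f [OF L] by blast
  then show ?thesis
    using upper_part_h_pair [OF h_pair_Int [OF J L]] upper_part_h_pair [OF L] linked_g_pair [OF J]
    by (auto simp: linked_def)
qed

lemma upper_part_g_pair:
  assumes "(J, K) \<in> g_pairs I r"
  shows "upper_part I r (down_closure r K - (K - J)) J"
    and "upper_part I r (down_closure r K) (K - J)"
proof -
  let ?V = "down_closure r K"
  have JK: "J \<in> f_sets I r" "K \<in> f_sets I r" "J \<subseteq> K" using g_pairs_f [OF assms] by auto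
  have V: "?V \<in> down_sets I r" "?V - K \<in> down_sets I r" "K \<subseteq> ?V"
    using upper_part_down_closure [OF JK(2)] by (auto simp: upper_part_def)
  have "y \<in> ?V - (K - J)" if x: "x \<in> ?V - (K - J)" "(y, x) \<in> r" for x y
  proof -
    have "y \<in> ?V" using V(1) x unfolding down_sets_def by blast
    moreover have "y \<in> J" if "y \<in> K"
    proof -
      have "x \<in> K" using V(2) x that unfolding down_sets_def by blast
      then show ?thesis using g_pairsD [OF assms _ that x(2)] x(1) by blast
    qed
    ultimately show ?thesis by blast
  qed
  moreover have "?V - (K - J) \<subseteq> I" using V(1) unfolding down_sets_def by blast
  ultimately have U: "?V - (K - J) \<in> down_sets I r" unfolding down_sets_def by blast
  have "?V - (K - J) - J = ?V - K" using JK(3) by blast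
  then show "upper_part I r (down_closure r K - (K - J)) J"
    "upper_part I r (down_closure r K) (K - J)"
    using U V JK by (auto simp: upper_part_def)
qed

end

section \<open>Configurations from lattices of subobjects\<close>

locale subobject_family = abelian_category C
  for C :: "('o, 'm) addcat" (structure) +
  fixes I :: "'i set" and s :: "'i rel" and S :: "'i set \<Rightarrow> 'o" and m :: "'i set \<Rightarrow> 'm"
    and X :: 'o
  assumes partial_order: "partial_order_on I s"
    and m_Hom: "U \<in> down_sets I s \<Longrightarrow> m U \<in> Hom C (S U) X"
    and m_monic: "U \<in> down_sets I s \<Longrightarrow> monic C (m U)"
    and m_mono: "U \<in> down_sets I s \<Longrightarrow> V \<in> down_sets I s \<Longrightarrow> U \<subseteq> V \<Longrightarrow>
      \<exists>f\<in>Hom C (S U) (S V). m V \<bullet> f = m U"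
begin

definition inc :: "'i set \<Rightarrow> 'i set \<Rightarrow> 'm" where
  "inc U V = (THE f. f \<in> Hom C (S U) (S V) \<and> m V \<bullet> f = m U)"

lemma inc_eqI:
  assumes V: "V \<in> down_sets I s" and f: "f \<in> Hom C (S U) (S V)" "m V \<bullet> f = m U"
  shows "inc U V = f"
  unfolding inc_def using f monicD [OF m_monic [OF V] m_Hom [OF V]] by (intro the_equality) auto

lemma inc:
  assumes "U \<in> down_sets I s" "V \<in> down_sets I s" "U \<subseteq> V"
  shows inc_Hom: "inc U V \<in> Hom C (S U) (S V)" and m_inc: "m V \<bullet> inc U V = m U"
  using m_mono [OF assms] inc_eqI [OF assms(2)] by auto

lemma S_Obj: "U \<in> down_sets I s \<Longrightarrow> S U \<in> Obj C"
  using m_Hom Hom_Obj by blast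

lemma inc_refl: "U \<in> down_sets I s \<Longrightarrow> inc U U = Ident C (S U)"
  by (rule inc_eqI) (auto simp: Ident_Hom S_Obj intro: Comp_Ident m_Hom)

lemma inc_trans:
  assumes "U \<in> down_sets I s" "V \<in> down_sets I s" "W \<in> down_sets I s" "U \<subseteq> V" "V \<subseteq> W"
  shows "inc V W \<bullet> inc U V = inc U W"
proof (rule inc_eqI [symmetric])
  have UV: "inc U V \<in> Hom C (S U) (S V)" and VW: "inc V W \<in> Hom C (S V) (S W)"
    using inc_Hom assms by auto
  show "inc V W \<bullet> inc U V \<in> Hom C (S U) (S W)" using Comp_Hom UV VW .
  show "m W \<bullet> (inc V W \<bullet> inc U V) = m U"
    using Comp_assoc [OF UV VW m_Hom] m_inc assms by simp
qed (use assms in auto)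

lemma inc_monic:
  assumes "U \<in> down_sets I s" "V \<in> down_sets I s" "U \<subseteq> V"
  shows "monic C (inc U V)"
  using monic_cancel_left [OF inc_Hom [OF assms] m_Hom] m_inc [OF assms] m_monic assms by simp

lemma Comp_inc_trans:
  assumes "U \<in> down_sets I s" "V \<in> down_sets I s" "W \<in> down_sets I s" "U \<subseteq> V" "V \<subseteq> W"
    and h: "h \<in> Hom C (S W) T"
  shows "(h \<bullet> inc V W) \<bullet> inc U V = h \<bullet> inc U W"
  using Comp_assoc [OF inc_Hom inc_Hom h, of U V] inc_trans assms by simp

lemma kills_mono:
  assumes "U \<in> down_sets I s" "V \<in> down_sets I s" "W \<in> down_sets I s" "U \<subseteq> V" "V \<subseteq> W"
    and h: "h \<in> Hom C (S W) T" "h \<bullet> inc V W = Zero C (S V) T"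
  shows "h \<bullet> inc U W = Zero C (S U) T"
  using Comp_inc_trans [OF assms(1-6)] h(2) Zero_Comp [OF inc_Hom] assms(1-4) Hom_Obj [OF h(1)]
  by simp

end

text \<open>
  Compatibility with intersections is expressed by generalized elements of both subobjects;
  compatibility with unions says that the subobjects of \<open>U\<close> and \<open>V\<close> are jointly epic in that of
  \<open>U \<union> V\<close>.
\<close>

locale distributive_family = subobject_family +
  assumes intersection: "U \<in> down_sets I s \<Longrightarrow> V \<in> down_sets I s \<Longrightarrow>
      x \<in> Hom C W (S U) \<Longrightarrow> y \<in> Hom C W (S V) \<Longrightarrow> m U \<bullet> x = m V \<bullet> y \<Longrightarrow>
      \<exists>z\<in>Hom C W (S (U \<inter> V)). m (U \<inter> V) \<bullet> z = m U \<bullet> x"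
    and union: "U \<in> down_sets I s \<Longrightarrow> V \<in> down_sets I s \<Longrightarrow> h \<in> Hom C (S (U \<union> V)) T \<Longrightarrow>
      h \<bullet> inc U (U \<union> V) = Zero C (S U) T \<Longrightarrow> h \<bullet> inc V (U \<union> V) = Zero C (S V) T \<Longrightarrow>
      h = Zero C (S (U \<union> V)) T"
begin

lemma glue_family:
  assumes U: "U \<in> down_sets I s" and V: "V \<in> down_sets I s"
    and a: "a \<in> Hom C (S U) T" and b: "b \<in> Hom C (S V) T"
    and ab: "a \<bullet> inc (U \<inter> V) U = b \<bullet> inc (U \<inter> V) V"
  obtains c where "c \<in> Hom C (S (U \<union> V)) T" "c \<bullet> inc U (U \<union> V) = a" "c \<bullet> inc V (U \<union> V) = b"
proof -
  have D: "U \<union> V \<in> down_sets I s" "U \<inter> V \<in> down_sets I s"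
    using U V down_sets_Un down_sets_Int by auto
  have i: "inc U (U \<union> V) \<in> Hom C (S U) (S (U \<union> V))" "inc V (U \<union> V) \<in> Hom C (S V) (S (U \<union> V))"
    "inc (U \<inter> V) U \<in> Hom C (S (U \<inter> V)) (S U)" "inc (U \<inter> V) V \<in> Hom C (S (U \<inter> V)) (S V)"
    using inc_Hom U V D by auto
  have "\<exists>z\<in>Hom C W (S (U \<inter> V)). inc (U \<inter> V) U \<bullet> z = x \<and> inc (U \<inter> V) V \<bullet> z = y"
    if x: "x \<in> Hom C W (S U)" and y: "y \<in> Hom C W (S V)"
      and xy: "inc U (U \<union> V) \<bullet> x = inc V (U \<union> V) \<bullet> y" for W x y
  proof -
    have mxy: "m U \<bullet> x = m V \<bullet> y"
      using Comp_assoc [OF x i(1) m_Hom [OF D(1)]] Comp_assoc [OF y i(2) m_Hom [OF D(1)]] xy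
        m_inc [OF U D(1)] m_inc [OF V D(1)] by simp
    then obtain z where z: "z \<in> Hom C W (S (U \<inter> V))" "m (U \<inter> V) \<bullet> z = m U \<bullet> x"
      using intersection [OF U V x y] by blast
    have "inc (U \<inter> V) U \<bullet> z = x"
      using monicD [OF m_monic [OF U] m_Hom [OF U] Comp_Hom [OF z(1) i(3)] x]
        Comp_assoc [OF z(1) i(3) m_Hom [OF U]] m_inc [OF D(2) U] z(2) by simp
    moreover have "inc (U \<inter> V) V \<bullet> z = y"
      using monicD [OF m_monic [OF V] m_Hom [OF V] Comp_Hom [OF z(1) i(4)] y]
        Comp_assoc [OF z(1) i(4) m_Hom [OF V]] m_inc [OF D(2) V] z(2) mxy by simp
    ultimately show ?thesis using z(1) by blast
  qed
  then show thesis using glue [OF i _ union [OF U V] a b ab] that by blast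
qed

lemma eq_on_union:
  assumes U: "U \<in> down_sets I s" and V: "V \<in> down_sets I s" and W: "W = U \<union> V"
    and c: "c \<in> Hom C (S W) T" and d: "d \<in> Hom C (S W) T"
    and eqU: "c \<bullet> inc U W = d \<bullet> inc U W" and eqV: "c \<bullet> inc V W = d \<bullet> inc V W"
  shows "c = d"
proof -
  have D: "W \<in> down_sets I s" using U V W down_sets_Un by auto
  obtain e where e: "e \<in> Hom C (S W) T" "c = Plus C e d" using ex_difference [OF c d] .
  have "e \<bullet> inc U' W = Zero C (S U') T"
    if U': "U' \<in> down_sets I s" "U' \<subseteq> W" "c \<bullet> inc U' W = d \<bullet> inc U' W" for U'
  proof -
    have i: "inc U' W \<in> Hom C (S U') (S W)" using inc_Hom U' D by blast
    show ?thesis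
      using Plus_eq_right [OF Comp_Hom [OF i e(1)] Comp_Hom [OF i d]]
        Plus_Comp [OF i e(1) d] e(2) U'(3) by simp
  qed
  then have "e = Zero C (S W) T" using union [OF U V, of e T] e U V W eqU eqV by auto
  then show ?thesis using e(2) Zero_Plus [OF d] by simp
qed

end

text \<open>
  For each f-set \<open>J\<close> a cokernel \<open>\<sigma> J\<close> is given for one presentation \<open>J = hull J - (hull J - J)\<close>
  only. Leaving both the presentation and the cokernel open makes it possible to use objects and
  projections that are already there.
\<close>

locale presented_family = distributive_family C I s S m X
  for C :: "('o, 'm) addcat" (structure) and I :: "'i set" and s :: "'i rel" and S m X +
  fixes \<sigma> :: "'i set \<Rightarrow> 'o" and hull :: "'i set \<Rightarrow> 'i set" and quot :: "'i set \<Rightarrow> 'm"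
  assumes hull: "J \<in> f_sets I s \<Longrightarrow> upper_part I s (hull J) J"
    and quot_Hom: "J \<in> f_sets I s \<Longrightarrow> quot J \<in> Hom C (S (hull J)) (\<sigma> J)"
    and quot_cokernel: "J \<in> f_sets I s \<Longrightarrow> is_cokernel C (quot J) (inc (hull J - J) (hull J))"
begin

lemma hull_down: "J \<in> f_sets I s \<Longrightarrow> hull J \<in> down_sets I s"
    "J \<in> f_sets I s \<Longrightarrow> hull J - J \<in> down_sets I s" "J \<in> f_sets I s \<Longrightarrow> J \<subseteq> hull J"
  using hull by (auto simp: upper_part_def)

lemma quot_zero:
  assumes J: "J \<in> f_sets I s" and U: "U \<in> down_sets I s" "U \<subseteq> hull J - J"
  shows "quot J \<bullet> inc U (hull J) = Zero C (S U) (\<sigma> J)"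
  using kills_mono [OF U(1) hull_down(2,1) [OF J] U(2) _ quot_Hom [OF J]]
    cokernel_zero [OF quot_cokernel quot_Hom inc_Hom] J hull_down
  by blast

text \<open>
  The prescribed quotient is transported from \<open>hull J\<close> to another presentation \<open>U\<close> of \<open>J\<close>: it is
  kept on \<open>U \<inter> hull J\<close>, which contains \<open>J\<close>, and is zero on the rest \<open>U - J\<close>. As these two
  down-sets cover \<open>U\<close>, at most one morphism does this; gluing shows that there is one.
\<close>

definition is_proj :: "'i set \<Rightarrow> 'i set \<Rightarrow> 'm \<Rightarrow> bool" where
  "is_proj U J p \<longleftrightarrow> p \<in> Hom C (S U) (\<sigma> J) \<and>
    p \<bullet> inc (U \<inter> hull J) U = quot J \<bullet> inc (U \<inter> hull J) (hull J) \<and>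
    p \<bullet> inc (U - J) U = Zero C (S (U - J)) (\<sigma> J)"

definition proj :: "'i set \<Rightarrow> 'i set \<Rightarrow> 'm" where
  "proj U J = (THE p. is_proj U J p)"

context
  fixes U J :: "'i set"
  assumes U: "upper_part I s U J"
begin

lemma upper_f: "J \<in> f_sets I s"
  using upper_part_f_sets U by blast

lemma upper_down:
  "U \<in> down_sets I s" "U - J \<in> down_sets I s" "J \<subseteq> U" "U \<inter> hull J \<in> down_sets I s"
  "U = (U \<inter> hull J) \<union> (U - J)"
  using U hull_down [OF upper_f] down_sets_Int [of U I s "hull J"] by (auto simp: upper_part_def)

lemma proj_eqI: "is_proj U J p \<Longrightarrow> proj U J = p"
  unfolding proj_def
proof (rule the_equality)
  fix q assume "is_proj U J p" "is_proj U J q"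
  then show "q = p"
    using eq_on_union [OF upper_down(4,2,5), of q "\<sigma> J" p] by (simp add: is_proj_def)
qed

lemma is_proj: "is_proj U J (proj U J)"
proof -
  note H = hull_down [OF upper_f]
  have a: "quot J \<bullet> inc (U \<inter> hull J) (hull J) \<in> Hom C (S (U \<inter> hull J)) (\<sigma> J)"
    using Comp_Hom inc_Hom quot_Hom upper_f upper_down(4) H(1) by (metis Int_lower2)
  have z: "Zero C (S (U - J)) (\<sigma> J) \<in> Hom C (S (U - J)) (\<sigma> J)"
    using Zero_Hom S_Obj upper_down(2) Hom_Obj quot_Hom [OF upper_f] by blast
  let ?M = "U \<inter> hull J \<inter> (U - J)"
  have M: "?M \<in> down_sets I s" using down_sets_Int upper_down by blast
  \<comment> \<open>On the overlap both pieces vanish, since the overlap lies in \<open>hull J - J\<close>.\<close>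
  have "(quot J \<bullet> inc (U \<inter> hull J) (hull J)) \<bullet> inc ?M (U \<inter> hull J) = quot J \<bullet> inc ?M (hull J)"
    using Comp_inc_trans [OF M upper_down(4) H(1) _ _ quot_Hom [OF upper_f]] by blast
  also have "\<dots> = Zero C (S ?M) (\<sigma> J)" using quot_zero [OF upper_f M] by blast
  also have "\<dots> = Zero C (S (U - J)) (\<sigma> J) \<bullet> inc ?M (U - J)"
    using Zero_Comp [OF inc_Hom [OF M upper_down(2)]] Hom_Obj [OF quot_Hom [OF upper_f]] by auto
  finally obtain c where "c \<in> Hom C (S ((U \<inter> hull J) \<union> (U - J))) (\<sigma> J)"
    "c \<bullet> inc (U \<inter> hull J) ((U \<inter> hull J) \<union> (U - J)) = quot J \<bullet> inc (U \<inter> hull J) (hull J)"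
    "c \<bullet> inc (U - J) ((U \<inter> hull J) \<union> (U - J)) = Zero C (S (U - J)) (\<sigma> J)"
    using glue_family [OF upper_down(4,2) a z] by blast
  then have "is_proj U J c"
    using upper_down(5) by (simp add: is_proj_def)
  then show ?thesis using proj_eqI by simp
qed

lemma proj_Hom: "proj U J \<in> Hom C (S U) (\<sigma> J)"
  and proj_inc_hull: "proj U J \<bullet> inc (U \<inter> hull J) U = quot J \<bullet> inc (U \<inter> hull J) (hull J)"
  and proj_inc_Diff: "proj U J \<bullet> inc (U - J) U = Zero C (S (U - J)) (\<sigma> J)"
  using is_proj by (auto simp: is_proj_def)

lemma proj_inc_zero:
  "V \<in> down_sets I s \<Longrightarrow> V \<subseteq> U - J \<Longrightarrow> proj U J \<bullet> inc V U = Zero C (S V) (\<sigma> J)"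
  using kills_mono [OF _ upper_down(2,1) _ _ proj_Hom proj_inc_Diff] by blast

lemma proj_epic: "epic C (proj U J)"
proof (rule epicI [OF proj_Hom])
  note H = hull_down [OF upper_f]
  fix W h assume h: "h \<in> Hom C (\<sigma> J) W" and 0: "h \<bullet> proj U J = Zero C (S U) W"
  have hq: "h \<bullet> quot J \<in> Hom C (S (hull J)) W" using Comp_Hom quot_Hom [OF upper_f] h .
  have W: "W \<in> Obj C" using h Hom_Obj by blast
  have i: "inc (U \<inter> hull J) (hull J) \<in> Hom C (S (U \<inter> hull J)) (S (hull J))"
    "inc (U \<inter> hull J) U \<in> Hom C (S (U \<inter> hull J)) (S U)"
    using inc_Hom upper_down H by auto
  have "(h \<bullet> quot J) \<bullet> inc (U \<inter> hull J) (hull J) = (h \<bullet> proj U J) \<bullet> inc (U \<inter> hull J) U"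
    using Comp_assoc [OF i(1) quot_Hom [OF upper_f] h] Comp_assoc [OF i(2) proj_Hom h]
      proj_inc_hull by simp
  then have 1: "(h \<bullet> quot J) \<bullet> inc (U \<inter> hull J) (hull J) = Zero C (S (U \<inter> hull J)) W"
    using 0 Zero_Comp [OF i(2) W] by simp
  have 2: "(h \<bullet> quot J) \<bullet> inc (hull J - J) (hull J) = Zero C (S (hull J - J)) W"
    using Comp_assoc [OF inc_Hom quot_Hom [OF upper_f] h, of "hull J - J"] quot_zero
      [OF upper_f H(2)]
      Comp_Zero [OF h S_Obj] H by auto
  have e: "hull J = (U \<inter> hull J) \<union> (hull J - J)" using upper_down(3) H(3) by blast
  have "h \<bullet> quot J = Zero C (S (hull J)) W"
    using union [OF upper_down(4) H(2), of "h \<bullet> quot J" W] hq 1 2 e by simp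
  then show "h = Zero C (\<sigma> J) W"
    using epic_zeroD [OF cokernel_epic [OF quot_cokernel quot_Hom] quot_Hom h] upper_f by blast
qed

text \<open>
  The universal property is transported from \<open>hull J\<close> to \<open>U\<close> by the gluing that defines \<open>proj\<close>,
  with the roles of \<open>U\<close> and \<open>hull J\<close> exchanged: a morphism \<open>h\<close> that vanishes on \<open>U - J\<close> is
  restricted to \<open>U \<inter> hull J\<close> and extended by zero to \<open>hull J\<close>.
\<close>

lemma proj_cokernel: "is_cokernel C (proj U J) (inc (U - J) U)"
proof (rule is_cokernelI [OF proj_Hom _ proj_epic proj_inc_Diff])
  note H = hull_down [OF upper_f]
  show "inc (U - J) U \<in> Hom C (S (U - J)) (S U)" using inc_Hom upper_down by auto
  fix W h assume h: "h \<in> Hom C (S U) W" and 0: "h \<bullet> inc (U - J) U = Zero C (S (U - J)) W"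
  have W: "W \<in> Obj C" using h Hom_Obj by blast
  have i: "inc (U \<inter> hull J) U \<in> Hom C (S (U \<inter> hull J)) (S U)"
    "inc (U \<inter> hull J) (hull J) \<in> Hom C (S (U \<inter> hull J)) (S (hull J))"
    using inc_Hom upper_down H by auto
  have a: "h \<bullet> inc (U \<inter> hull J) U \<in> Hom C (S (U \<inter> hull J)) W" using Comp_Hom i h by blast
  have z: "Zero C (S (hull J - J)) W \<in> Hom C (S (hull J - J)) W"
    using Zero_Hom S_Obj [OF H(2)] W .
  let ?M = "U \<inter> hull J \<inter> (hull J - J)"
  have M: "?M \<in> down_sets I s" using down_sets_Int upper_down(4) H(2) by blast
  have "(h \<bullet> inc (U \<inter> hull J) U) \<bullet> inc ?M (U \<inter> hull J) = h \<bullet> inc ?M U"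
    using Comp_inc_trans [OF M upper_down(4,1) _ _ h] by blast
  also have "\<dots> = Zero C (S ?M) W" by (rule kills_mono [OF M upper_down(2,1) _ _ h 0]) auto
  also have "\<dots> = Zero C (S (hull J - J)) W \<bullet> inc ?M (hull J - J)"
    using Zero_Comp [OF inc_Hom [OF M H(2)] W] by auto
  finally obtain c where c: "c \<in> Hom C (S ((U \<inter> hull J) \<union> (hull J - J))) W"
    "c \<bullet> inc (U \<inter> hull J) ((U \<inter> hull J) \<union> (hull J - J)) = h \<bullet> inc (U \<inter> hull J) U"
    "c \<bullet> inc (hull J - J) ((U \<inter> hull J) \<union> (hull J - J)) = Zero C (S (hull J - J)) W"
    using glue_family [OF upper_down(4) H(2) a z] by blast
  have e: "(U \<inter> hull J) \<union> (hull J - J) = hull J" using upper_down(3) H(3) by blast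
  note c = c [unfolded e]
  obtain g where g: "g \<in> Hom C (\<sigma> J) W" "g \<bullet> quot J = c"
    using cokernel_desc
      [OF quot_cokernel [OF upper_f] quot_Hom [OF upper_f] inc_Hom [OF H(2,1)] c(1,3)]
    by auto
  have "g \<bullet> proj U J = h"
  proof (rule eq_on_union [OF upper_down(4,2,5) Comp_Hom [OF proj_Hom g(1)] h])
    show "(g \<bullet> proj U J) \<bullet> inc (U \<inter> hull J) U = h \<bullet> inc (U \<inter> hull J) U"
      using Comp_assoc [OF i(1) proj_Hom g(1)] proj_inc_hull
        Comp_assoc [OF i(2) quot_Hom [OF upper_f] g(1)] g(2) c(2) by simp
    show "(g \<bullet> proj U J) \<bullet> inc (U - J) U = h \<bullet> inc (U - J) U"
      using Comp_assoc [OF inc_Hom proj_Hom g(1), of "U - J"] proj_inc_Diff upper_down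
        Comp_Zero [OF g(1) S_Obj] 0 by auto
  qed
  then show "\<exists>u\<in>Hom C (\<sigma> J) W. u \<bullet> proj U J = h" using g(1) by blast
qed

end

lemma proj_inc:
  assumes U: "upper_part I s U J" and V: "upper_part I s V J" and UV: "U \<subseteq> V"
  shows "proj V J \<bullet> inc U V = proj U J"
proof (rule proj_eqI [OF U, symmetric])
  note J = upper_f [OF U] and uU = upper_down [OF U] and uV = upper_down [OF V]
  note H = hull_down [OF J]
  have pV: "proj V J \<in> Hom C (S V) (\<sigma> J)" by (rule proj_Hom [OF V])
  have sub: "U \<inter> hull J \<subseteq> V \<inter> hull J" "V \<inter> hull J \<subseteq> V" "V \<inter> hull J \<subseteq> hull J"
    "U - J \<subseteq> V - J"
    using UV by auto
  have "(proj V J \<bullet> inc U V) \<bullet> inc (U \<inter> hull J) U = proj V J \<bullet> inc (U \<inter> hull J) V"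
    using Comp_inc_trans [OF uU(4,1) uV(1) _ UV pV] by blast
  also have "\<dots> = (proj V J \<bullet> inc (V \<inter> hull J) V) \<bullet> inc (U \<inter> hull J) (V \<inter> hull J)"
    using Comp_inc_trans [OF uU(4) uV(4,1) sub(1,2) pV] by simp
  also have "\<dots> = quot J \<bullet> inc (U \<inter> hull J) (hull J)"
    using Comp_inc_trans [OF uU(4) uV(4) H(1) sub(1,3) quot_Hom [OF J]] proj_inc_hull [OF V] by simp
  finally have 1: "(proj V J \<bullet> inc U V) \<bullet> inc (U \<inter> hull J) U = quot J \<bullet> inc (U \<inter> hull J) (hull J)" .
  have 2: "(proj V J \<bullet> inc U V) \<bullet> inc (U - J) U = Zero C (S (U - J)) (\<sigma> J)"
    using Comp_inc_trans [OF uU(2,1) uV(1) _ UV pV] proj_inc_zero [OF V uU(2) sub(4)] by auto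
  show "is_proj U J (proj V J \<bullet> inc U V)"
    using 1 2 Comp_Hom [OF inc_Hom [OF uU(1) uV(1) UV] pV] by (simp add: is_proj_def)
qed

text \<open>
  The induced morphism does not depend on the presentations. Both sides vanish on \<open>U' - J\<close>, so
  it suffices to compare them on \<open>U' \<inter> U\<close>. Both presentations of \<open>J\<close> restrict to this down-set,
  and both presentations of \<open>K\<close> restrict to \<open>V' \<inter> V\<close>.
\<close>

lemma linked_invariant:
  assumes UV: "linked I s U V J K" and UV': "linked I s U' V' J K"
    and f: "f \<in> Hom C (\<sigma> J) (\<sigma> K)" "f \<bullet> proj U J = proj V K \<bullet> inc U V"
  shows "f \<bullet> proj U' J = proj V' K \<bullet> inc U' V'"
proof -
  have up: "upper_part I s U J" "upper_part I s V K" "upper_part I s U' J" "upper_part I s V' K"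
    "U \<subseteq> V" "U' \<subseteq> V'" "U' \<inter> K \<subseteq> J"
    using UV UV' by (auto simp: linked_def)
  let ?W = "U' \<inter> U" and ?V = "V' \<inter> V"
  have upW: "upper_part I s ?W J" "upper_part I s ?V K"
    using upper_part_Int [OF up(3,1)] upper_part_Int [OF up(4,2)] .
  note D = upper_down(1) [OF up(1)] upper_down(1) [OF up(2)] upper_down(1) [OF up(3)]
    upper_down(1) [OF up(4)] upper_down(1) [OF upW(1)] upper_down(1) [OF upW(2)]
    upper_down(2) [OF up(3)]
  have WV: "?W \<subseteq> ?V" using up(5,6) by blast
  have W_eq: "proj V'' K \<bullet> inc ?W V'' = proj ?V K \<bullet> inc ?W ?V"
    if "upper_part I s V'' K" "?V \<subseteq> V''" for V''
    using Comp_inc_trans [OF D(5,6) upper_down(1) [OF that(1)] WV that(2) proj_Hom [OF that(1)]]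
      proj_inc [OF upW(2) that] by simp
  have 1: "f \<bullet> proj ?W J = proj V' K \<bullet> inc ?W V'"
  proof -
    have i: "inc ?W U \<in> Hom C (S ?W) (S U)" using inc_Hom D by auto
    have "f \<bullet> proj ?W J = (f \<bullet> proj U J) \<bullet> inc ?W U"
      using proj_inc [OF upW(1) up(1)] Comp_assoc [OF i proj_Hom [OF up(1)] f(1)] by simp
    also have "\<dots> = proj V K \<bullet> inc ?W V"
      using Comp_inc_trans [OF D(5,1,2) _ up(5) proj_Hom [OF up(2)]] f(2) by simp
    also have "\<dots> = proj V' K \<bullet> inc ?W V'" using W_eq up by auto
    finally show ?thesis .
  qed
  have h: "f \<bullet> proj U' J \<in> Hom C (S U') (\<sigma> K)" using Comp_Hom proj_Hom [OF up(3)] f(1) .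
  have i': "inc U' V' \<in> Hom C (S U') (S V')" using inc_Hom D up by blast
  have h': "proj V' K \<bullet> inc U' V' \<in> Hom C (S U') (\<sigma> K)" using Comp_Hom i' proj_Hom [OF up(4)] .
  have U'_eq: "U' = ?W \<union> (U' - J)" using upper_down(3) [OF up(1)] by blast
  show ?thesis
  proof (rule eq_on_union [OF D(5,7) U'_eq h h'])
    have i: "inc ?W U' \<in> Hom C (S ?W) (S U')" using inc_Hom D by auto
    have "(f \<bullet> proj U' J) \<bullet> inc ?W U' = f \<bullet> proj ?W J"
      using Comp_assoc [OF i proj_Hom [OF up(3)] f(1)] proj_inc [OF upW(1) up(3)] by simp
    then show "(f \<bullet> proj U' J) \<bullet> inc ?W U' = (proj V' K \<bullet> inc U' V') \<bullet> inc ?W U'"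
      using Comp_inc_trans [OF D(5,3,4) _ up(6) proj_Hom [OF up(4)]] 1 by simp
    have j: "inc (U' - J) U' \<in> Hom C (S (U' - J)) (S U')" using inc_Hom D by auto
    have "(f \<bullet> proj U' J) \<bullet> inc (U' - J) U' = Zero C (S (U' - J)) (\<sigma> K)"
      using Comp_assoc [OF j proj_Hom [OF up(3)] f(1)] proj_inc_Diff [OF up(3)]
        Comp_Zero [OF f(1) S_Obj] D by simp
    moreover have "(proj V' K \<bullet> inc U' V') \<bullet> inc (U' - J) U' = Zero C (S (U' - J)) (\<sigma> K)"
      using Comp_inc_trans [OF D(7,3,4) _ up(6) proj_Hom [OF up(4)]]
        proj_inc_zero [OF up(4) D(7)] up(6,7) by auto
    ultimately show "(f \<bullet> proj U' J) \<bullet> inc (U' - J) U' = (proj V' K \<bullet> inc U' V') \<bullet> inc (U' - J) U'"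
      by simp
  qed
qed

text \<open>
  This one formula serves as both \<open>\<iota> J K\<close> and \<open>\<pi> J K\<close>.
\<close>

definition induced :: "'i set \<Rightarrow> 'i set \<Rightarrow> 'm" where
  "induced J K = (THE f. f \<in> Hom C (\<sigma> J) (\<sigma> K) \<and>
    (\<exists>U V. linked I s U V J K \<and> f \<bullet> proj U J = proj V K \<bullet> inc U V))"

lemma induced_eqI:
  assumes UV: "linked I s U V J K"
    and f: "f \<in> Hom C (\<sigma> J) (\<sigma> K)" "f \<bullet> proj U J = proj V K \<bullet> inc U V"
  shows "induced J K = f"
  unfolding induced_def
proof (rule the_equality)
  show "f \<in> Hom C (\<sigma> J) (\<sigma> K) \<and> (\<exists>U V. linked I s U V J K \<and> f \<bullet> proj U J = proj V K \<bullet> inc U V)"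
    using assms by blast
  fix g assume "g \<in> Hom C (\<sigma> J) (\<sigma> K) \<and>
    (\<exists>U V. linked I s U V J K \<and> g \<bullet> proj U J = proj V K \<bullet> inc U V)"
  then have g: "g \<in> Hom C (\<sigma> J) (\<sigma> K)" "g \<bullet> proj U J = proj V K \<bullet> inc U V"
    using linked_invariant [OF _ UV] by auto
  have U: "upper_part I s U J" using UV by (simp add: linked_def)
  show "g = f" using epicD [OF proj_epic [OF U] proj_Hom [OF U] g(1) f(1)] g(2) f(2) by simp
qed

lemma induced:
  assumes UV: "linked I s U V J K"
  shows induced_Hom: "induced J K \<in> Hom C (\<sigma> J) (\<sigma> K)"
    and induced_proj: "induced J K \<bullet> proj U J = proj V K \<bullet> inc U V"
proof -
  have up: "upper_part I s U J" "upper_part I s V K" "U \<subseteq> V" "U \<inter> K \<subseteq> J"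
    using UV by (auto simp: linked_def)
  note D = upper_down(1,2) [OF up(1)] upper_down(1,2) [OF up(2)]
  have i: "inc U V \<in> Hom C (S U) (S V)" using inc_Hom D up by blast
  have h: "proj V K \<bullet> inc U V \<in> Hom C (S U) (\<sigma> K)" using Comp_Hom i proj_Hom [OF up(2)] .
  have "(proj V K \<bullet> inc U V) \<bullet> inc (U - J) U = Zero C (S (U - J)) (\<sigma> K)"
    using Comp_inc_trans [OF D(2,1,3) _ up(3) proj_Hom [OF up(2)]]
      proj_inc_zero [OF up(2) D(2)] up(3,4) by auto
  then obtain f where f: "f \<in> Hom C (\<sigma> J) (\<sigma> K)" "f \<bullet> proj U J = proj V K \<bullet> inc U V"
    using cokernel_desc [OF proj_cokernel [OF up(1)] proj_Hom [OF up(1)] inc_Hom [OF D(2,1)] h]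
    by auto
  then show "induced J K \<in> Hom C (\<sigma> J) (\<sigma> K)" "induced J K \<bullet> proj U J = proj V K \<bullet> inc U V"
    using induced_eqI [OF UV f] by auto
qed

lemma induced_Comp:
  assumes UV: "linked I s U V J K" and VW: "linked I s V W K L"
  shows "induced K L \<bullet> induced J K = induced J L"
proof (rule induced_eqI [OF linked_trans [OF UV VW], symmetric])
  have up: "upper_part I s U J" "upper_part I s V K" "upper_part I s W L" "U \<subseteq> V" "V \<subseteq> W"
    using UV VW by (auto simp: linked_def)
  note D = upper_down(1) [OF up(1)] upper_down(1) [OF up(2)] upper_down(1) [OF up(3)]
  note JK = induced [OF UV] and KL = induced [OF VW]
  show "induced K L \<bullet> induced J K \<in> Hom C (\<sigma> J) (\<sigma> L)" using Comp_Hom JK(1) KL(1) .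
  have i: "inc U V \<in> Hom C (S U) (S V)" using inc_Hom D up by blast
  have "(induced K L \<bullet> induced J K) \<bullet> proj U J = induced K L \<bullet> (proj V K \<bullet> inc U V)"
    using Comp_assoc [OF proj_Hom [OF up(1)] JK(1) KL(1)] JK(2) by simp
  also have "\<dots> = (proj W L \<bullet> inc V W) \<bullet> inc U V"
    using Comp_assoc [OF i proj_Hom [OF up(2)] KL(1)] KL(2) by simp
  also have "\<dots> = proj W L \<bullet> inc U W"
    using Comp_inc_trans [OF D up(4,5) proj_Hom [OF up(3)]] .
  finally show "(induced K L \<bullet> induced J K) \<bullet> proj U J = proj W L \<bullet> inc U W" .
qed

lemma induced_refl:
  assumes J: "J \<in> f_sets I s"
  shows "induced J J = Ident C (\<sigma> J)"
proof (rule induced_eqI [OF linked_refl [OF hull [OF J]]])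
  have p: "proj (hull J) J \<in> Hom C (S (hull J)) (\<sigma> J)" using proj_Hom hull J by blast
  show "Ident C (\<sigma> J) \<in> Hom C (\<sigma> J) (\<sigma> J)" using Ident_Hom Hom_Obj p by blast
  show "Ident C (\<sigma> J) \<bullet> proj (hull J) J = proj (hull J) J \<bullet> inc (hull J) (hull J)"
    using Ident_Comp [OF p] Comp_Ident [OF p] inc_refl [OF hull_down(1) [OF J]] by simp
qed

text \<open>
  The third isomorphism theorem for the chain of down-sets \<open>V - K \<subseteq> V - (K - J) \<subseteq> V\<close>, where \<open>V\<close>
  is the down-closure of \<open>K\<close>: the successive differences are \<open>J\<close> and \<open>K - J\<close>.
\<close>

lemma induced_exact:
  assumes JK: "(J, K) \<in> g_pairs I s"
  shows "short_exact C (induced J K) (induced K (K - J))"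
proof -
  let ?V = "down_closure s K" and ?L = "K - J"
  let ?U = "?V - ?L"
  note order = partial_order
  have J: "J \<subseteq> K" "K \<in> f_sets I s" using g_pairs_f [OF JK] by auto
  have up: "upper_part I s ?U J" "upper_part I s ?V K" "upper_part I s ?V ?L"
    using upper_part_g_pair [OF order JK] upper_part_down_closure [OF order J(2)] by auto
  have l1: "linked I s ?U ?V J K" and l2: "linked I s ?V ?V K ?L"
    using up by (auto simp: linked_def)
  have UJ: "?U - J = ?V - K" using J(1) by blast
  note D = upper_down(1,2) [OF up(1)] upper_down(1) [OF up(2)]
  have b: "inc ?U ?V \<in> Hom C (S ?U) (S ?V)" "monic C (inc ?U ?V)"
    using inc_Hom inc_monic D by auto
  have a: "inc (?V - K) ?U \<in> Hom C (S (?V - K)) (S ?U)" "monic C (inc (?V - K) ?U)"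
    using inc_Hom [of "?U - J" ?U] inc_monic [of "?U - J" ?U] D unfolding UJ by auto
  have ba: "inc ?U ?V \<bullet> inc (?V - K) ?U = inc (?V - K) ?V"
    using inc_trans [of "?U - J" ?U ?V] D unfolding UJ by auto
  have ck: "is_cokernel C (proj ?U J) (inc (?V - K) ?U)"
    "is_cokernel C (proj ?V K) (inc ?U ?V \<bullet> inc (?V - K) ?U)"
    "is_cokernel C (proj ?V ?L) (inc ?U ?V)"
    using proj_cokernel [OF up(1)] proj_cokernel [OF up(2)] proj_cokernel [OF up(3)]
    unfolding UJ ba by auto
  have "induced K ?L \<bullet> proj ?V K = proj ?V ?L"
    using induced_proj [OF l2] inc_refl [OF D(3)] Comp_Ident [OF proj_Hom [OF up(3)]] by simp
  then show ?thesis
    using third_isomorphism [OF a(1) b a(2) proj_Hom [OF up(1)] ck(1) proj_Hom [OF up(2)] ck(2)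
        proj_Hom [OF up(3)] ck(3) induced [OF l1] induced_Hom [OF l2]] by blast
qed

theorem induced_configuration:
  assumes empty: "is_zero_object C (\<sigma> {})"
  shows "configuration C (Obj C) I s \<sigma> induced induced"
proof
  note order = partial_order
  show "is_zero_object C (\<sigma> {})" by (rule empty)
  show "\<sigma> J \<in> Obj C" if "J \<in> f_sets I s" for J
    using quot_Hom [OF that] Hom_Obj by blast
  show "induced J J = Ident C (\<sigma> J)" if "J \<in> f_sets I s" for J
    using induced_refl that by auto
  show "short_exact C (induced J K) (induced K L)" if "(J, K) \<in> g_pairs I s" "L = K - J" for J K L
    using induced_exact that by blast
  show g: "induced J K \<in> Hom C (\<sigma> J) (\<sigma> K)" if "(J, K) \<in> g_pairs I s" for J K
    using induced_Hom [OF linked_g_pair [OF order that]] .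
  show h: "induced J K \<in> Hom C (\<sigma> J) (\<sigma> K)" if "(J, K) \<in> h_pairs I s" for J K
    using induced_Hom [OF linked_h_pair [OF order that]] .
  show "monic C (induced J K)" if "(J, K) \<in> g_pairs I s" for J K
    using induced_exact [OF that] kernel_monic g [OF that] by (auto simp: short_exact_def)
  show "epic C (induced J K)" if JK: "(J, K) \<in> h_pairs I s" for J K
  proof -
    have "J - (J - K) = K" using h_pairs_f [OF JK] by blast
    then show ?thesis
      using induced_exact [OF h_pair_complement [OF order JK]] cokernel_epic h [OF JK]
      by (auto simp: short_exact_def)
  qed
  show "induced J L = induced K L \<bullet> induced J K"
    if JK: "(J, K) \<in> g_pairs I s" and KL: "(K, L) \<in> g_pairs I s" for J K L
    using induced_Comp [OF linked_g_pair [OF order JK] linked_g_pair [OF order KL]] by simp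
  show "induced J L = induced K L \<bullet> induced J K"
    if JK: "(J, K) \<in> h_pairs I s" and KL: "(K, L) \<in> h_pairs I s" for J K L
  proof -
    have "upper_part I s (down_closure s J) L"
      using upper_part_h_pair [OF order h_pairs_trans [OF JK KL]] .
    then have "linked I s (down_closure s J) (down_closure s J) K L"
      using h_pairs_f [OF KL] upper_part_h_pair [OF order JK] by (auto simp: linked_def)
    then show ?thesis using induced_Comp [OF linked_h_pair [OF order JK]] by simp
  qed
  \<comment> \<open>Both sides are the morphism from \<open>J\<close> to \<open>L\<close> induced by the inclusion of down-closures.\<close>
  show "induced K L \<bullet> induced J K = induced (J \<inter> L) L \<bullet> induced J (J \<inter> L)"
    if JK: "(J, K) \<in> g_pairs I s" and KL: "(K, L) \<in> h_pairs I s" for J K L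
  proof -
    have "induced K L \<bullet> induced J K = induced J L"
      using induced_Comp [OF linked_g_pair [OF order JK] linked_h_pair [OF order KL]] .
    also have "\<dots> = induced (J \<inter> L) L \<bullet> induced J (J \<inter> L)"
      using induced_Comp
        [OF linked_h_pair [OF order h_pair_Int [OF JK KL]] linked_Int [OF order JK KL]]
      by simp
    finally show ?thesis .
  qed
qed

end

section \<open>Objects of an exact category\<close>

lemma configuration_objects:
  "configuration C B I r \<sigma> \<iota> \<pi> \<Longrightarrow> (\<And>J. J \<in> f_sets I r \<Longrightarrow> \<sigma> J \<in> A) \<Longrightarrow> configuration C A I r \<sigma> \<iota> \<pi>"
  by (simp add: configuration_def)

text \<open>
  If \<open>x\<close> is minimal in \<open>J\<close>, then \<open>\<sigma> J\<close> is an extension of \<open>\<sigma> (J - {x})\<close> by \<open>\<sigma> {x}\<close>; so closure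
  under extensions carries membership in \<open>A\<close> from the singletons to all f-sets.
\<close>

lemma (in exact_category) configuration_in_exact:
  assumes cfg: "configuration C (Obj C) I r \<sigma> \<iota> \<pi>"
    and order: "partial_order_on I r" and fin: "finite I"
    and empty: "\<sigma> {} \<in> A" and single: "\<And>i. i \<in> I \<Longrightarrow> \<sigma> {i} \<in> A"
  shows "configuration C A I r \<sigma> \<iota> \<pi>"
proof (rule configuration_objects [OF cfg])
  interpret configuration C "Obj C" I r \<sigma> \<iota> \<pi> by (rule cfg)
  have finite_f: "finite J" if "J \<in> f_sets I r" for J
    by (rule finite_subset [OF f_sets_sub [OF that] fin])
  fix J assume "J \<in> f_sets I r"
  then show "\<sigma> J \<in> A"
  proof (induction "card J" arbitrary: J)
    case 0
    then show ?case using empty finite_f [OF 0(2)] by simp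
  next
    case (Suc n)
    have J: "J \<subseteq> I" "finite J" using f_sets_sub [OF Suc.prems] finite_f [OF Suc.prems] by auto
    have "J \<noteq> {}" using Suc.hyps(2) by auto
    have "\<exists>x\<in>J. \<forall>y\<in>J. (y, x) \<in> r \<longrightarrow> y = x"
      using J(2) \<open>J \<noteq> {}\<close> J(1)
    proof (induction J rule: finite_ne_induct)
      case (singleton x)
      then show ?case by blast
    next
      case (insert x F)
      then obtain m where m: "m \<in> F" "\<forall>y\<in>F. (y, m) \<in> r \<longrightarrow> y = m" by auto
      show ?case
      proof (cases "(x, m) \<in> r")
        case True
        have "y = x" if "y \<in> F" "(y, x) \<in> r" for y
          using m(2) that True order_trans [OF order that(2) True] order_antisym [OF order that(2)]
          by blast
        then show ?thesis by blast
      qed (use m in blast)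
    qed
    then obtain x where x: "x \<in> J" "\<forall>y\<in>J. (y, x) \<in> r \<longrightarrow> y = x" by blast
    have sx: "{x} \<in> f_sets I r" using f_sets_singleton [OF order] x(1) J(1) by blast
    then have g: "({x}, J) \<in> g_pairs I r" using x Suc.prems by (auto simp: g_pairs_def)
    have "J - {x} \<in> f_sets I r"
      using upper_part_f_sets [OF upper_part_g_pair(2) [OF order g]] .
    moreover have "n = card (J - {x})" using Suc.hyps(2) x(1) J(2) by simp
    ultimately have A: "\<sigma> (J - {x}) \<in> A" using Suc.hyps(1) by blast
    have "(J, J - {x}) \<in> h_pairs I r"
      using \<open>J - {x} \<in> f_sets I r\<close> Suc.prems g_pairsD [OF g] by (auto simp: h_pairs_def)
    then have "\<pi> J (J - {x}) \<in> Hom C (\<sigma> J) (\<sigma> (J - {x}))" by (rule pi_Hom)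
    then show ?case
      using A_extension [OF exact [OF g refl]] iota_Hom [OF g] single A x(1) J(1)
      by (auto simp: Hom_def)
  qed
qed

section \<open>Down-sets of a configuration\<close>

locale poset_configuration = exact_category C A + configuration C A I r \<sigma> \<iota> \<pi>
  for C :: "('o, 'm) addcat" (structure) and A I and r :: "'i rel" and \<sigma> \<iota> \<pi> +
  assumes finite: "finite I" and order: "partial_order_on I r"
begin

lemma I_down: "I \<in> down_sets I r"
  using order_in [OF order] by (auto simp: down_sets_def)

lemma down_sub: "U \<in> down_sets I r \<Longrightarrow> U \<subseteq> I"
  by (simp add: down_sets_def)

lemma sigma_Obj: "J \<in> f_sets I r \<Longrightarrow> \<sigma> J \<in> Obj C"
  using sigma_A A_Obj by blast

lemma iota_down:
  assumes "U \<in> down_sets I r" "V \<in> down_sets I r" "U \<subseteq> V"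
  shows iota_down_Hom: "\<iota> U V \<in> Hom C (\<sigma> U) (\<sigma> V)" and iota_down_monic: "monic C (\<iota> U V)"
  using iota_Hom iota_monic down_sets_g_pairs [OF assms] by auto

lemma iota_down_Comp:
  assumes "U \<in> down_sets I r" "V \<in> down_sets I r" "W \<in> down_sets I r" "U \<subseteq> V" "V \<subseteq> W"
  shows "\<iota> V W \<bullet> \<iota> U V = \<iota> U W"
  using iota_Comp down_sets_g_pairs assms by metis

lemma Comp_iota_down:
  assumes "U \<in> down_sets I r" "V \<in> down_sets I r" "W \<in> down_sets I r" "U \<subseteq> V" "V \<subseteq> W"
    and x: "x \<in> Hom C Z (\<sigma> U)"
  shows "\<iota> V W \<bullet> (\<iota> U V \<bullet> x) = \<iota> U W \<bullet> x"
  using Comp_assoc [OF x iota_down_Hom iota_down_Hom, of V W] iota_down_Comp assms by simp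

lemma iota_down_Comp':
  assumes "U \<in> down_sets I r" "V \<in> down_sets I r" "W \<in> down_sets I r" "U \<subseteq> V" "V \<subseteq> W"
    and h: "h \<in> Hom C (\<sigma> W) T"
  shows "(h \<bullet> \<iota> V W) \<bullet> \<iota> U V = h \<bullet> \<iota> U W"
  using Comp_assoc [OF iota_down_Hom iota_down_Hom h, of U V] iota_down_Comp assms by simp

lemma pi_upper:
  assumes U: "upper_part I r U J"
  shows pi_upper_Hom: "\<pi> U J \<in> Hom C (\<sigma> U) (\<sigma> J)"
    and pi_upper_epic: "epic C (\<pi> U J)"
    and pi_upper_kernel: "is_kernel C (\<iota> (U - J) U) (\<pi> U J)"
    and pi_upper_cokernel: "is_cokernel C (\<pi> U J) (\<iota> (U - J) U)"
proof -
  show "\<pi> U J \<in> Hom C (\<sigma> U) (\<sigma> J)" "epic C (\<pi> U J)"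
    using pi_Hom pi_epic upper_part_h_pairs [OF U] by auto
  have "(U - J, U) \<in> g_pairs I r" "J = U - (U - J)"
    using down_sets_g_pairs U by (auto simp: upper_part_def)
  then have "short_exact C (\<iota> (U - J) U) (\<pi> U J)" using exact by blast
  then show "is_kernel C (\<iota> (U - J) U) (\<pi> U J)" "is_cokernel C (\<pi> U J) (\<iota> (U - J) U)"
    by (auto simp: short_exact_def)
qed

lemma pi_iota_down:
  assumes V: "upper_part I r V J" and U: "U \<in> down_sets I r" "U \<subseteq> V"
  shows "\<pi> V J \<bullet> \<iota> U V = \<iota> (U \<inter> J) J \<bullet> \<pi> U (U \<inter> J)"
  using pi_iota [OF down_sets_g_pairs upper_part_h_pairs [OF V]] U V by (auto simp: upper_part_def)

lemma upper_part_Int_down: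
  assumes V: "upper_part I r V J" and U: "U \<in> down_sets I r" "U \<subseteq> V"
  shows "upper_part I r U (U \<inter> J)"
proof -
  have "U - U \<inter> J = U \<inter> (V - J)" using U(2) by blast
  then show ?thesis using V U down_sets_Int [of U I r "V - J"] by (simp add: upper_part_def)
qed

lemma pi_iota_restrict:
  assumes V: "upper_part I r V J" and U: "U \<in> down_sets I r" "U \<subseteq> V" and J: "J \<subseteq> U"
  shows "\<pi> V J \<bullet> \<iota> U V = \<pi> U J"
proof -
  have "U \<inter> J = J" using J by blast
  then show ?thesis
    using pi_iota_down [OF V U] upper_part_Int_down [OF V U] iota_Ident
      [OF upper_part_f_sets [OF V]]
      Ident_Comp [OF pi_upper_Hom [of U J]] by simp
qed

lemma pi_iota_disjoint:
  assumes V: "upper_part I r V J" and U: "U \<in> down_sets I r" "U \<subseteq> V" and J: "U \<inter> J = {}"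
  shows "\<pi> V J \<bullet> \<iota> U V = Zero C (\<sigma> U) (\<sigma> J)"
proof -
  have g: "({}, J) \<in> g_pairs I r"
    using upper_part_f_sets [OF V] f_sets_empty by (auto simp: g_pairs_def)
  have "upper_part I r U {}" using upper_part_Int_down [OF V U] J by simp
  then show ?thesis
    using pi_iota_down [OF V U] J factors_zero_object [OF sigma_empty pi_upper_Hom iota_Hom [OF g]]
    by simp
qed

text \<open>
  An element of \<open>\<sigma> U\<close> that also lies in \<open>\<sigma> V\<close> has zero image in \<open>\<sigma> (I - V)\<close>. By axiom (D) this
  image is the image of its class in \<open>\<sigma> (U - V)\<close>, which embeds in \<open>\<sigma> (I - V)\<close>. So the class is
  zero, that is, the element lies in \<open>\<sigma> (U \<inter> V)\<close>.
\<close>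

lemma iota_intersection:
  assumes U: "U \<in> down_sets I r" and V: "V \<in> down_sets I r"
    and x: "x \<in> Hom C W (\<sigma> U)" and y: "y \<in> Hom C W (\<sigma> V)" and xy: "\<iota> U I \<bullet> x = \<iota> V I \<bullet> y"
  obtains z where "z \<in> Hom C W (\<sigma> (U \<inter> V))" "\<iota> (U \<inter> V) U \<bullet> z = x"
proof -
  have UI: "U \<subseteq> I" and VI: "V \<subseteq> I" using U V down_sub by auto
  have "I - (I - V) = V" using VI by blast
  then have upI: "upper_part I r I (I - V)" using I_down V by (simp add: upper_part_def)
  have eq: "U \<inter> (I - V) = U - V" "U - (U - V) = U \<inter> V" using UI by auto
  have upU: "upper_part I r U (U - V)" using upper_part_Int_down [OF upI U UI] eq by simp
  have g: "(U - V, I - V) \<in> g_pairs I r"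
  proof -
    have f: "U - V \<in> f_sets I r" "I - V \<in> f_sets I r"
      using upper_part_f_sets upU upI by auto
    moreover have "k \<in> U - V" if "u \<in> U - V" "k \<in> I - V" "(k, u) \<in> r" for u k
      using that U unfolding down_sets_def by blast
    ultimately show ?thesis using UI by (auto simp: g_pairs_def)
  qed
  have iU: "\<iota> U I \<in> Hom C (\<sigma> U) (\<sigma> I)" and iV: "\<iota> V I \<in> Hom C (\<sigma> V) (\<sigma> I)"
    using iota_down_Hom I_down U V UI VI by auto
  have pU: "\<pi> U (U - V) \<bullet> x \<in> Hom C W (\<sigma> (U - V))" using Comp_Hom x pi_upper_Hom [OF upU] .
  have "\<iota> (U - V) (I - V) \<bullet> (\<pi> U (U - V) \<bullet> x) = \<pi> I (I - V) \<bullet> (\<iota> U I \<bullet> x)"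
    using Comp_assoc [OF x pi_upper_Hom [OF upU] iota_Hom [OF g]]
      Comp_assoc [OF x iU pi_upper_Hom [OF upI]] pi_iota_down [OF upI U UI] eq by simp
  also have "\<dots> = (\<pi> I (I - V) \<bullet> \<iota> V I) \<bullet> y"
    using xy Comp_assoc [OF y iV pi_upper_Hom [OF upI]] by simp
  also have "\<dots> = Zero C W (\<sigma> (I - V))"
    using pi_iota_disjoint [OF upI V VI] Zero_Comp [OF y sigma_Obj [OF upper_part_f_sets [OF upI]]]
    by auto
  finally have "\<pi> U (U - V) \<bullet> x = Zero C W (\<sigma> (U - V))"
    using monic_zeroD [OF iota_monic [OF g] iota_Hom [OF g] pU] by blast
  then show thesis
    using kernel_lift [OF pi_upper_kernel [OF upU] iota_down_Hom pi_upper_Hom [OF upU] x] that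
      down_sets_Int [OF U V] U unfolding eq by blast
qed

text \<open>
  A morphism that vanishes on \<open>\<sigma> V\<close> factors through \<open>\<sigma> (U \<union> V) \<rightarrow> \<sigma> (U - V)\<close>, and \<open>\<sigma> U\<close> already
  maps onto \<open>\<sigma> (U - V)\<close>.
\<close>

lemma iota_union:
  assumes U: "U \<in> down_sets I r" and V: "V \<in> down_sets I r" and h: "h \<in> Hom C (\<sigma> (U \<union> V)) T"
    and hU: "h \<bullet> \<iota> U (U \<union> V) = Zero C (\<sigma> U) T" and hV: "h \<bullet> \<iota> V (U \<union> V) = Zero C (\<sigma> V) T"
  shows "h = Zero C (\<sigma> (U \<union> V)) T"
proof -
  let ?W = "U \<union> V"
  have W: "?W \<in> down_sets I r" using down_sets_Un U V .
  have "?W - (U - V) = V" by blast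
  then have up: "upper_part I r ?W (U - V)" using W V by (auto simp: upper_part_def)
  note p = pi_upper_Hom [OF up]
  have iU: "\<iota> U ?W \<in> Hom C (\<sigma> U) (\<sigma> ?W)" and iV: "\<iota> V ?W \<in> Hom C (\<sigma> V) (\<sigma> ?W)"
    using iota_down_Hom U V W by auto
  have T: "T \<in> Obj C" using h Hom_Obj by blast
  obtain g where g: "g \<in> Hom C (\<sigma> (U - V)) T" "g \<bullet> \<pi> ?W (U - V) = h"
    using cokernel_desc [OF pi_upper_cokernel [OF up] p _ h]
      iV hV unfolding \<open>?W - (U - V) = V\<close> by blast
  have e: "\<pi> ?W (U - V) \<bullet> \<iota> U ?W = \<pi> U (U - V)"
    using pi_iota_restrict [OF up U] by blast
  have upU: "upper_part I r U (U - V)"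
    using upper_part_Int_down [OF up U] by (simp add: Int_absorb1)
  have "g \<bullet> \<pi> U (U - V) = Zero C (\<sigma> U) T"
    using Comp_assoc [OF iU p g(1)] g(2) e hU by simp
  then have "g = Zero C (\<sigma> (U - V)) T"
    using epic_zeroD [OF pi_upper_epic [OF upU] pi_upper_Hom [OF upU] g(1)] by blast
  then show ?thesis using g(2) Zero_Comp [OF p T] by simp
qed

end

section \<open>Removing a split cover\<close>

text \<open>
  Transitivity survives because a covering relation is not a composite of two others.
\<close>

lemma partial_order_remove_cover:
  assumes order: "partial_order_on I r" and ij: "i \<noteq> j"
    and cover: "\<not> (\<exists>k\<in>I. i \<noteq> k \<and> k \<noteq> j \<and> (i, k) \<in> r \<and> (k, j) \<in> r)"
  shows "partial_order_on I (r - {(i, j)})"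
  unfolding partial_order_on_def preorder_on_def
proof (intro conjI)
  show "r - {(i, j)} \<subseteq> I \<times> I" using order_in [OF order] by auto
  show "refl_on I (r - {(i, j)})" using order_refl [OF order] ij by (auto simp: refl_on_def)
  show "antisym (r - {(i, j)})" using order_antisym [OF order] by (auto simp: antisym_def)
  show "trans (r - {(i, j)})"
  proof (rule transI)
    fix a b c assume ab: "(a, b) \<in> r - {(i, j)}" and bc: "(b, c) \<in> r - {(i, j)}"
    then have "(a, c) \<in> r" using order_trans [OF order] by blast
    moreover have "(a, c) \<noteq> (i, j)"
    proof
      assume "(a, c) = (i, j)"
      then show False using ab bc cover order_in [OF order] by auto
    qed
    ultimately show "(a, c) \<in> r - {(i, j)}" by blast
  qed
qed

text \<open>
  A splitting of the sequence of the covering pair \<open>(i, j)\<close> is given by a retraction \<open>q\<close> of the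
  inclusion of \<open>\<sigma> {i}\<close> and a section \<open>e\<close> of the projection to \<open>\<sigma> {j}\<close>. The last assumption says
  that \<open>q\<close> and the projection are jointly monic.
\<close>

locale split_cover = poset_configuration C A I r \<sigma> \<iota> \<pi>
  for C :: "('o, 'm) addcat" (structure) and A I and r :: "'i rel" and \<sigma> \<iota> \<pi> +
  fixes i j :: 'i and q e :: 'm
  assumes ij: "(i, j) \<in> r" "i \<noteq> j"
    and cover: "\<not> (\<exists>k\<in>I. i \<noteq> k \<and> k \<noteq> j \<and> (i, k) \<in> r \<and> (k, j) \<in> r)"
    and q_Hom: "q \<in> Hom C (\<sigma> {i, j}) (\<sigma> {i})" and e_Hom: "e \<in> Hom C (\<sigma> {j}) (\<sigma> {i, j})"
    and q_iota: "q \<bullet> \<iota> {i} {i, j} = Ident C (\<sigma> {i})"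
    and pi_e: "\<pi> {i, j} {j} \<bullet> e = Ident C (\<sigma> {j})"
    and q_e: "q \<bullet> e = Zero C (\<sigma> {j}) (\<sigma> {i})"
    and joint: "x \<in> Hom C W (\<sigma> {i, j}) \<Longrightarrow> q \<bullet> x = Zero C W (\<sigma> {i}) \<Longrightarrow>
      \<pi> {i, j} {j} \<bullet> x = Zero C W (\<sigma> {j}) \<Longrightarrow> x = Zero C W (\<sigma> {i, j})"
begin

abbreviation s :: "'i rel" where "s \<equiv> r - {(i, j)}"

lemma order_s: "partial_order_on I s"
  by (rule partial_order_remove_cover [OF order ij(2) cover])

lemma in_I: "i \<in> I" "j \<in> I"
  using order_in [OF order ij(1)] by auto

lemma down_r_s: "U \<in> down_sets I r \<Longrightarrow> U \<in> down_sets I s"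
  unfolding down_sets_def by blast

text \<open>
  Among the down-sets of \<open>s\<close>, these are the ones that are not down-sets of \<open>r\<close>. Adding \<open>i\<close> to
  one of them gives a down-set of \<open>r\<close>, and so does removing \<open>j\<close>.
\<close>

definition new :: "'i set \<Rightarrow> bool" where
  "new U \<longleftrightarrow> j \<in> U \<and> i \<notin> U"

definition saturate :: "'i set \<Rightarrow> 'i set" where
  "saturate U = (if new U then insert i U else U)"

lemma saturate_simps [simp]: "new U \<Longrightarrow> saturate U = insert i U" "\<not> new U \<Longrightarrow> saturate U = U"
  by (auto simp: saturate_def)

lemma down_r_not_new: "U \<in> down_sets I r \<Longrightarrow> \<not> new U"
  using ij(1) unfolding down_sets_def new_def by blast

lemma down_s_old:
  assumes "U \<in> down_sets I s" "\<not> new U"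
  shows "U \<in> down_sets I r"
proof -
  have "x \<in> U" if "u \<in> U" "(x, u) \<in> r" for u x
    using assms that unfolding down_sets_def new_def by (cases "(x, u) = (i, j)") auto
  then show ?thesis using assms(1) unfolding down_sets_def by blast
qed

lemma down_s_new:
  assumes U: "U \<in> down_sets I s" and n: "new U"
  shows insert_down: "insert i U \<in> down_sets I r"
    and remove_down: "U - {j} \<in> down_sets I r"
    and insert_remove_down: "insert i (U - {j}) \<in> down_sets I r"
proof -
  have jU: "j \<in> U" "i \<notin> U" using n by (auto simp: new_def)
  have sub: "U \<subseteq> I" using U by (simp add: down_sets_def)
  have down: "x \<in> U" if "u \<in> U" "(x, u) \<in> r" "(x, u) \<noteq> (i, j)" for u x
    using U that unfolding down_sets_def by blast
  have below_i: "x \<in> insert i (U - {j})" if xi: "(x, i) \<in> r" for x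
  proof (cases "x = i")
    case False
    have "(x, j) \<in> r" using order_trans [OF order xi ij(1)] .
    then have "x \<in> U" using down [OF jU(1)] False by blast
    moreover have "x \<noteq> j" using order_antisym [OF order xi] ij by blast
    ultimately show ?thesis by blast
  qed simp
  have below_U: "x \<in> U - {j}" if u: "u \<in> U - {j}" and x: "(x, u) \<in> r" for u x
  proof -
    have "x \<noteq> j"
    proof
      assume "x = j"
      then have "(i, u) \<in> r" using order_trans [OF order ij(1)] x by blast
      then show False using down [of u i] u jU by blast
    qed
    then show ?thesis using down [of u x] u x by blast
  qed
  show "U - {j} \<in> down_sets I r" using below_U sub unfolding down_sets_def by blast
  show "insert i (U - {j}) \<in> down_sets I r"
    using below_U below_i sub in_I unfolding down_sets_def by blast
  have "x \<in> insert i U" if "u \<in> insert i U" "(x, u) \<in> r" for u x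
    using that below_i [of x] down [of u x] by blast
  then show "insert i U \<in> down_sets I r" using sub in_I unfolding down_sets_def by blast
qed

lemma down_s_new_upper:
  assumes U: "U \<in> down_sets I s" and n: "new U"
  shows insert_upper_pair: "upper_part I r (insert i U) {i, j}"
    and insert_upper_j: "upper_part I r (insert i U) {j}"
    and insert_remove_upper: "upper_part I r (insert i (U - {j})) {i}"
proof -
  have jU: "j \<in> U" "i \<notin> U" using n by (auto simp: new_def)
  have "insert i U - {i, j} = U - {j}" "insert i U - {j} = insert i (U - {j})"
    "insert i (U - {j}) - {i} = U - {j}"
    using jU ij(2) by auto
  then show "upper_part I r (insert i U) {i, j}" "upper_part I r (insert i U) {j}"
    "upper_part I r (insert i (U - {j})) {i}"
    using down_s_new [OF U n] jU by (auto simp: upper_part_def)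
qed

lemma saturate_down: "U \<in> down_sets I s \<Longrightarrow> saturate U \<in> down_sets I r"
  using insert_down down_s_old by (cases "new U") auto

lemma saturate_mono:
  assumes "U \<in> down_sets I s" "V \<in> down_sets I s" "U \<subseteq> V"
  shows "saturate U \<subseteq> saturate V"
  using assms by (auto simp: saturate_def new_def)

lemmas i_f = cover_pairs(1) [OF order ij cover]
  and j_f = cover_pairs(2) [OF order ij cover]
  and i_ij = cover_pairs(4) [OF order ij cover]
  and ij_j = cover_pairs(5) [OF order ij cover]

text \<open>
  The subobject attached to a new \<open>U\<close> is the kernel of this morphism; it is the preimage in
  \<open>\<sigma> (U \<union> {i})\<close> of the copy of \<open>\<sigma> {j}\<close> in \<open>\<sigma> {i, j}\<close> that the splitting selects.
\<close>

definition ret :: "'i set \<Rightarrow> 'm" where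
  "ret U = q \<bullet> \<pi> (insert i U) {i, j}"

text \<open>
  The identity is chosen on the down-sets of \<open>r\<close>, so that \<open>subobj U\<close> is \<open>\<sigma> U\<close> itself there.
\<close>

definition emb :: "'i set \<Rightarrow> 'm" where
  "emb U = (if new U then SOME k. is_kernel C k (ret U) else Ident C (\<sigma> U))"

definition subobj :: "'i set \<Rightarrow> 'o" where
  "subobj U = Dom C (emb U)"

definition incl :: "'i set \<Rightarrow> 'm" where
  "incl U = \<iota> (saturate U) I \<bullet> emb U"

lemma emb_old:
  assumes U: "U \<in> down_sets I r"
  shows "emb U = Ident C (\<sigma> U)" "subobj U = \<sigma> U"
  using down_r_not_new [OF U] Ident_Hom [OF sigma_Obj [OF down_sets_f_sets [OF U]]]
  by (auto simp: emb_def subobj_def Hom_def)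

lemma ret_Hom: "U \<in> down_sets I s \<Longrightarrow> new U \<Longrightarrow> ret U \<in> Hom C (\<sigma> (insert i U)) (\<sigma> {i})"
  unfolding ret_def by (rule Comp_Hom [OF pi_upper_Hom [OF insert_upper_pair] q_Hom])

lemma emb_new:
  assumes U: "U \<in> down_sets I s" and n: "new U"
  shows emb_kernel: "is_kernel C (emb U) (ret U)"
    and emb_new_Hom: "emb U \<in> Hom C (subobj U) (\<sigma> (insert i U))"
proof -
  have "\<exists>k. is_kernel C k (ret U)" using ex_kernel ret_Hom [OF U n] by (auto simp: Hom_def)
  then have "is_kernel C (SOME k. is_kernel C k (ret U)) (ret U)" by (rule someI_ex)
  then show k: "is_kernel C (emb U) (ret U)" using n by (simp add: emb_def)
  then show "emb U \<in> Hom C (subobj U) (\<sigma> (insert i U))"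
    using ret_Hom [OF U n] by (auto simp: is_kernel_def Hom_def subobj_def)
qed

lemma emb:
  assumes U: "U \<in> down_sets I s"
  shows emb_Hom: "emb U \<in> Hom C (subobj U) (\<sigma> (saturate U))" and emb_monic: "monic C (emb U)"
proof -
  show h: "emb U \<in> Hom C (subobj U) (\<sigma> (saturate U))"
    using emb_new_Hom [OF U] emb_old [OF down_s_old [OF U]]
      Ident_Hom [OF sigma_Obj [OF down_sets_f_sets [OF down_s_old [OF U]]]]
    by (cases "new U") auto
  show "monic C (emb U)"
    using kernel_monic [OF emb_kernel [OF U] emb_new_Hom [OF U]] emb_old [OF down_s_old [OF U]]
      monic_Ident [OF sigma_Obj [OF down_sets_f_sets [OF down_s_old [OF U]]]]
    by (cases "new U") auto
qed

lemma ret_emb: "U \<in> down_sets I s \<Longrightarrow> new U \<Longrightarrow> ret U \<bullet> emb U = Zero C (subobj U) (\<sigma> {i})"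
  using kernel_zero [OF emb_kernel emb_new_Hom ret_Hom] .

lemma ret_epic:
  assumes U: "U \<in> down_sets I s" and n: "new U"
  shows "epic C (ret U)"
proof (rule epicI [OF ret_Hom [OF U n]])
  note p = insert_upper_pair [OF U n]
  fix W x assume x: "x \<in> Hom C (\<sigma> {i}) W" and 0: "x \<bullet> ret U = Zero C (\<sigma> (insert i U)) W"
  have "(x \<bullet> q) \<bullet> \<pi> (insert i U) {i, j} = Zero C (\<sigma> (insert i U)) W"
    using Comp_assoc [OF pi_upper_Hom [OF p] q_Hom x] 0 by (simp add: ret_def)
  then have "x \<bullet> q = Zero C (\<sigma> {i, j}) W"
    using epic_zeroD [OF pi_upper_epic [OF p] pi_upper_Hom [OF p] Comp_Hom [OF q_Hom x]] by blast
  then have "x \<bullet> (q \<bullet> \<iota> {i} {i, j}) = Zero C (\<sigma> {i}) W"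
    using Comp_assoc [OF iota_Hom [OF i_ij] q_Hom x] Zero_Comp [OF iota_Hom [OF i_ij]] Hom_Obj
      [OF x]
    by simp
  then show "x = Zero C (\<sigma> {i}) W" using q_iota Comp_Ident [OF x] by simp
qed

text \<open>
  What remains of \<open>ret V\<close> on a down-set \<open>U\<close> of \<open>r\<close> depends only on which of \<open>i\<close> and \<open>j\<close> lie in
  \<open>U\<close>.
\<close>

lemma ret_iota:
  assumes V: "V \<in> down_sets I s" "new V" and U: "U \<in> down_sets I r" "U \<subseteq> insert i V"
  shows ret_iota_new: "\<lbrakk>i \<in> U; j \<in> U\<rbrakk> \<Longrightarrow> ret V \<bullet> \<iota> U (insert i V) = q \<bullet> \<pi> U {i, j}"
    and ret_iota_i: "\<lbrakk>i \<in> U; j \<notin> U\<rbrakk> \<Longrightarrow> ret V \<bullet> \<iota> U (insert i V) = \<pi> U {i}"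
    and ret_iota_zero: "i \<notin> U \<Longrightarrow> ret V \<bullet> \<iota> U (insert i V) = Zero C (\<sigma> U) (\<sigma> {i})"
proof -
  note p = insert_upper_pair [OF V]
  have io: "\<iota> U (insert i V) \<in> Hom C (\<sigma> U) (\<sigma> (insert i V))"
    using iota_down_Hom U insert_down [OF V] by blast
  have eq: "ret V \<bullet> \<iota> U (insert i V) = q \<bullet> (\<pi> (insert i V) {i, j} \<bullet> \<iota> U (insert i V))"
    using Comp_assoc [OF io pi_upper_Hom [OF p] q_Hom] by (simp add: ret_def)
  show "ret V \<bullet> \<iota> U (insert i V) = q \<bullet> \<pi> U {i, j}" if "i \<in> U" "j \<in> U"
    using eq pi_iota_restrict [OF p U] that by simp
  show "ret V \<bullet> \<iota> U (insert i V) = Zero C (\<sigma> U) (\<sigma> {i})" if "i \<notin> U"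
  proof -
    have "j \<notin> U" using that U(1) ij(1) unfolding down_sets_def by blast
    then show ?thesis
      using eq pi_iota_disjoint [OF p U] that Comp_Zero [OF q_Hom] sigma_Obj
        [OF down_sets_f_sets [OF U(1)]]
      by simp
  qed
  show "ret V \<bullet> \<iota> U (insert i V) = \<pi> U {i}" if i: "i \<in> U" "j \<notin> U"
  proof -
    have "U \<inter> {i, j} = {i}" using i by blast
    then have "upper_part I r U {i}" using upper_part_Int_down [OF p U] by simp
    note p' = pi_upper_Hom [OF this]
    show ?thesis
      using eq pi_iota_down [OF p U] \<open>U \<inter> {i, j} = {i}\<close>
        Comp_assoc [OF p' iota_Hom [OF i_ij] q_Hom] q_iota Ident_Comp [OF p'] by simp
  qed
qed

lemma emb_mono:
  assumes U: "U \<in> down_sets I s" and V: "V \<in> down_sets I s" and UV: "U \<subseteq> V"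
  obtains f where "f \<in> Hom C (subobj U) (subobj V)" "emb V \<bullet> f = \<iota> (saturate U) (saturate V) \<bullet> emb U"
proof -
  note D = saturate_down [OF U] saturate_down [OF V] saturate_mono [OF U V UV]
  note io = iota_down_Hom [OF D]
  have h: "\<iota> (saturate U) (saturate V) \<bullet> emb U \<in> Hom C (subobj U) (\<sigma> (saturate V))"
    using Comp_Hom [OF emb_Hom [OF U] io] .
  show thesis
  proof (cases "new V")
    case False
    note e = emb_old [OF down_s_old [OF V False]]
    show thesis
      using that [of "\<iota> (saturate U) (saturate V) \<bullet> emb U"] h e False Ident_Comp [OF h] by simp
  next
    case True
    have "ret V \<bullet> (\<iota> (saturate U) (saturate V) \<bullet> emb U) = (ret V \<bullet> \<iota> (saturate U) (saturate V)) \<bullet> emb U"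
      using Comp_assoc [OF emb_Hom [OF U] io, of "ret V"] ret_Hom [OF V True] True by simp
    also have "\<dots> = Zero C (subobj U) (\<sigma> {i})"
    proof (cases "new U")
      case nU: True
      then show ?thesis
        using ret_iota_new [OF V True, of "insert i U"] D True ret_emb [OF U nU]
        by (simp add: ret_def new_def)
    next
      case False
      have "i \<notin> U" using True UV by (auto simp: new_def)
      then show ?thesis
        using ret_iota_zero [OF V True D(1)] D(3) True False
          Zero_Comp [OF emb_Hom [OF U] sigma_Obj [OF i_f]] by simp
    qed
    finally show thesis
      using kernel_lift
        [OF emb_kernel [OF V True] emb_new_Hom [OF V True] ret_Hom [OF V True], of _ "subobj U"]
        h True that by auto
  qed
qed

lemma saturate_I: "U \<in> down_sets I s \<Longrightarrow> saturate U \<subseteq> I"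
  using down_sub [OF saturate_down] .

lemma incl_Comp:
  assumes U: "U \<in> down_sets I s" and V: "V \<in> down_sets I s" and UV: "U \<subseteq> V"
    and f: "f \<in> Hom C (subobj U) (subobj V)" "emb V \<bullet> f = \<iota> (saturate U) (saturate V) \<bullet> emb U"
  shows "incl V \<bullet> f = incl U"
proof -
  note VI = iota_down_Hom [OF saturate_down [OF V] I_down saturate_I [OF V]]
  have "incl V \<bullet> f = \<iota> (saturate V) I \<bullet> (\<iota> (saturate U) (saturate V) \<bullet> emb U)"
    unfolding incl_def
    using Comp_assoc [OF f(1) emb_Hom [OF V] VI] f(2) by simp
  also have "\<dots> = incl U"
    unfolding incl_def
    using Comp_iota_down
      [OF saturate_down [OF U] saturate_down [OF V] I_down saturate_mono [OF U V UV]
        saturate_I [OF V] emb_Hom [OF U]] .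
  finally show ?thesis .
qed

sublocale family: subobject_family C I s subobj incl "\<sigma> I"
proof
  show "partial_order_on I s" by (rule order_s)
  fix U assume U: "U \<in> down_sets I s"
  note io = iota_down [OF saturate_down [OF U] I_down saturate_I [OF U]]
  show "incl U \<in> Hom C (subobj U) (\<sigma> I)"
    unfolding incl_def by (rule Comp_Hom [OF emb_Hom [OF U] io(1)])
  show "monic C (incl U)"
    unfolding incl_def by (rule monic_Comp [OF emb_Hom [OF U] io(1) emb_monic [OF U] io(2)])
  fix V assume V: "V \<in> down_sets I s" and UV: "U \<subseteq> V"
  obtain f where f: "f \<in> Hom C (subobj U) (subobj V)" "emb V \<bullet> f = \<iota> (saturate U) (saturate V) \<bullet> emb U"
    using emb_mono [OF U V UV] .
  then show "\<exists>f\<in>Hom C (subobj U) (subobj V). incl V \<bullet> f = incl U"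
    using incl_Comp [OF U V UV] by blast
qed

lemma incl_old: "U \<in> down_sets I r \<Longrightarrow> incl U = \<iota> U I"
  using emb_old down_r_not_new Comp_Ident [OF iota_down_Hom [OF _ I_down down_sub]]
  by (simp add: incl_def)

lemma emb_inc:
  assumes U: "U \<in> down_sets I s" and V: "V \<in> down_sets I s" and UV: "U \<subseteq> V"
  shows "emb V \<bullet> family.inc U V = \<iota> (saturate U) (saturate V) \<bullet> emb U"
proof -
  obtain f where f: "f \<in> Hom C (subobj U) (subobj V)" "emb V \<bullet> f = \<iota> (saturate U) (saturate V) \<bullet> emb U"
    using emb_mono [OF U V UV] .
  then show ?thesis using family.inc_eqI [OF V f(1) incl_Comp [OF U V UV f]] by simp
qed

lemma inc_to_old:
  assumes U: "U \<in> down_sets I s" and V: "V \<in> down_sets I r" and UV: "U \<subseteq> V"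
  shows "family.inc U V = \<iota> (saturate U) V \<bullet> emb U"
  using emb_inc [OF U down_r_s [OF V] UV] emb_old [OF V] down_r_not_new [OF V]
    Ident_Comp [OF family.inc_Hom [OF U down_r_s [OF V] UV]] by simp

lemma inc_old:
  assumes U: "U \<in> down_sets I r" and V: "V \<in> down_sets I r" and UV: "U \<subseteq> V"
  shows "family.inc U V = \<iota> U V"
  using inc_to_old [OF down_r_s [OF U] V UV] emb_old [OF U] down_r_not_new [OF U]
    Comp_Ident [OF iota_down_Hom [OF U V UV]] by simp

lemma emb_inc_remove:
  assumes U: "U \<in> down_sets I s" and n: "new U"
  shows "emb U \<bullet> family.inc (U - {j}) U = \<iota> (U - {j}) (insert i U)"
proof -
  note R = remove_down [OF U n]
  have "U - {j} \<subseteq> insert i U" by blast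
  then show ?thesis
    using emb_inc [OF down_r_s [OF R] U] n emb_old [OF R] down_r_not_new [OF R]
      Comp_Ident [OF iota_down_Hom [OF R insert_down [OF U n]]] by simp
qed

text \<open>
  An element of both subobjects comes from an element \<open>w\<close> of \<open>\<sigma> P\<close>, where
  \<open>P = (U \<union> {i}) \<inter> saturate V\<close>, and \<open>ret U\<close> kills it. There are three cases. If \<open>j \<in> V\<close>, then
  \<open>U \<inter> V\<close> is new and \<open>P = (U \<inter> V) \<union> {i}\<close>, so \<open>w\<close> lies in the kernel attached to \<open>U \<inter> V\<close>. If
  neither \<open>i\<close> nor \<open>j\<close> is in \<open>V\<close>, then \<open>P = U \<inter> V\<close>. If only \<open>i\<close> is, then \<open>P = (U \<inter> V) \<union> {i}\<close> and
  \<open>ret U\<close> restricts to the projection of \<open>\<sigma> P\<close> to \<open>\<sigma> {i}\<close>, whose kernel is \<open>\<sigma> (U \<inter> V)\<close>.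
\<close>

lemma intersection_new:
  assumes U: "U \<in> down_sets I s" and n: "new U" and V: "V \<in> down_sets I s"
    and x: "x \<in> Hom C W (subobj U)" and y: "y \<in> Hom C W (subobj V)" and xy: "incl U \<bullet> x = incl V \<bullet> y"
  shows "\<exists>z\<in>Hom C W (subobj (U \<inter> V)). incl (U \<inter> V) \<bullet> z = incl U \<bullet> x"
proof -
  let ?P = "insert i U \<inter> saturate V"
  have jU: "j \<in> U" "i \<notin> U" using n by (auto simp: new_def)
  note Ui = insert_down [OF U n] and Vp = saturate_down [OF V]
  note eU = emb_new_Hom [OF U n] and eV = emb_Hom [OF V]
  have P: "?P \<in> down_sets I r" using down_sets_Int Ui Vp .
  have UV: "U \<inter> V \<in> down_sets I s" using down_sets_Int U V .
  have ex: "emb U \<bullet> x \<in> Hom C W (\<sigma> (insert i U))" and ey: "emb V \<bullet> y \<in> Hom C W (\<sigma> (saturate V))"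
    using Comp_Hom x y eU eV by blast+
  have mx: "incl U \<bullet> x = \<iota> (insert i U) I \<bullet> (emb U \<bullet> x)"
    unfolding incl_def using Comp_assoc [OF x eU iota_down_Hom [OF Ui I_down]] down_sub [OF Ui] n by simp
  have my: "incl V \<bullet> y = \<iota> (saturate V) I \<bullet> (emb V \<bullet> y)"
    unfolding incl_def using Comp_assoc [OF y eV iota_down_Hom [OF Vp I_down]] down_sub [OF Vp] by simp
  obtain w where w: "w \<in> Hom C W (\<sigma> ?P)" "\<iota> ?P (insert i U) \<bullet> w = emb U \<bullet> x"
    using iota_intersection [OF Ui Vp ex ey] xy mx my by auto
  have mw: "incl U \<bullet> x = \<iota> ?P I \<bullet> w"
    using mx w Comp_iota_down [OF P Ui I_down _ down_sub [OF Ui] w(1)] by auto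
  have io: "\<iota> ?P (insert i U) \<in> Hom C (\<sigma> ?P) (\<sigma> (insert i U))" using iota_down_Hom P Ui by blast
  have W: "W \<in> Obj C" and i: "\<sigma> {i} \<in> Obj C" using x Hom_Obj sigma_Obj i_f by auto
  have rw: "(ret U \<bullet> \<iota> ?P (insert i U)) \<bullet> w = Zero C W (\<sigma> {i})"
    using Comp_assoc [OF w(1) io ret_Hom [OF U n]] w(2) Comp_assoc [OF x eU ret_Hom [OF U n]]
      ret_emb [OF U n] Zero_Comp [OF x i] by simp
  show ?thesis
  proof (cases "j \<in> V")
    case True
    have nUV: "new (U \<inter> V)" using True jU by (simp add: new_def)
    have P_eq: "?P = insert i (U \<inter> V)" using True by (auto simp: saturate_def new_def)
    have "ret (U \<inter> V) \<bullet> w = Zero C W (\<sigma> {i})"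
      using rw ret_iota_new [OF U n P Int_lower1] True jU by (simp add: P_eq ret_def)
    then obtain z where z: "z \<in> Hom C W (subobj (U \<inter> V))" "emb (U \<inter> V) \<bullet> z = w"
      using kernel_lift [OF emb_kernel [OF UV nUV] emb_new_Hom [OF UV nUV] ret_Hom [OF UV nUV]] w(1)
      unfolding P_eq by blast
    have "incl (U \<inter> V) \<bullet> z = \<iota> ?P I \<bullet> w"
      unfolding incl_def
      using Comp_assoc
        [OF z(1) emb_new_Hom [OF UV nUV] iota_down_Hom [OF insert_down [OF UV nUV] I_down]]
        down_sub [OF P] z(2) nUV by (simp add: P_eq)
    then show ?thesis using z(1) mw by auto
  next
    case False
    then have V_old: "saturate V = V" "V \<in> down_sets I r"
      using down_s_old [OF V] by (auto simp: new_def)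
    have "\<not> new (U \<inter> V)" using False by (simp add: new_def)
    then have UVr: "U \<inter> V \<in> down_sets I r" using down_s_old [OF UV] by blast
    have "\<exists>z\<in>Hom C W (\<sigma> (U \<inter> V)). \<iota> (U \<inter> V) I \<bullet> z = incl U \<bullet> x"
    proof (cases "i \<in> V")
      case False
      then have "?P = U \<inter> V" using V_old by auto
      then show ?thesis using w(1) mw by auto
    next
      case True
      have iP: "i \<in> ?P" "j \<notin> ?P" "?P - {i} = U \<inter> V" using True False V_old jU by auto
      then have up: "upper_part I r ?P {i}" using P UVr by (auto simp: upper_part_def)
      have "\<pi> ?P {i} \<bullet> w = Zero C W (\<sigma> {i})"
        using rw ret_iota_i [OF U n P _ iP(1,2)] by auto
      moreover have "\<iota> (U \<inter> V) ?P \<in> Hom C (\<sigma> (U \<inter> V)) (\<sigma> ?P)"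
        using iota_down_Hom [OF UVr P] V_old by auto
      ultimately obtain z where z: "z \<in> Hom C W (\<sigma> (U \<inter> V))" "\<iota> (U \<inter> V) ?P \<bullet> z = w"
        using kernel_lift [OF pi_upper_kernel [OF up] _ pi_upper_Hom [OF up] w(1)]
        unfolding iP(3) by blast
      have "\<iota> (U \<inter> V) I \<bullet> z = \<iota> ?P I \<bullet> w"
        using Comp_iota_down [OF UVr P I_down _ down_sub [OF P] z(1)] z(2) iP(3) by fastforce
      then show ?thesis using z(1) mw by auto
    qed
    then show ?thesis using emb_old [OF UVr] incl_old [OF UVr] by simp
  qed
qed

text \<open>
  The subobject attached to a new \<open>U\<close> is an extension of \<open>\<sigma> {j}\<close> by \<open>\<sigma> (U - {j})\<close>, as it has to
  be. It maps onto \<open>\<sigma> {j}\<close> because of the section \<open>e\<close>. The kernel is \<open>\<sigma> (U - {j})\<close> because an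
  element whose image in \<open>\<sigma> {i, j}\<close> is killed by \<open>q\<close> and by the projection to \<open>\<sigma> {j}\<close> vanishes
  in \<open>\<sigma> {i, j}\<close>.
\<close>

lemma quotient_new:
  assumes U: "U \<in> down_sets I s" and n: "new U"
  shows quotient_new_Hom: "\<pi> (insert i U) {j} \<bullet> emb U \<in> Hom C (subobj U) (\<sigma> {j})"
    and quotient_new_epic: "epic C (\<pi> (insert i U) {j} \<bullet> emb U)"
    and quotient_new_kernel: "x \<in> Hom C W (subobj U) \<Longrightarrow>
      (\<pi> (insert i U) {j} \<bullet> emb U) \<bullet> x = Zero C W (\<sigma> {j}) \<Longrightarrow>
      \<exists>z\<in>Hom C W (\<sigma> (U - {j})). family.inc (U - {j}) U \<bullet> z = x"
proof -
  let ?V = "insert i U"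
  have jU: "j \<in> U" "i \<notin> U" using n by (auto simp: new_def)
  note eU = emb_new_Hom [OF U n] and V = insert_down [OF U n] and R = remove_down [OF U n]
  note p = insert_upper_pair [OF U n] and pj = insert_upper_j [OF U n]
  note pH = pi_upper_Hom [OF p] and pjH = pi_upper_Hom [OF pj] and ijH = pi_Hom [OF ij_j]
  have pp: "\<pi> ?V {j} = \<pi> {i, j} {j} \<bullet> \<pi> ?V {i, j}"
    using pi_Comp [OF upper_part_h_pairs [OF p] ij_j] .
  show vH: "\<pi> ?V {j} \<bullet> emb U \<in> Hom C (subobj U) (\<sigma> {j})" using Comp_Hom eU pjH .
  show "epic C (\<pi> ?V {j} \<bullet> emb U)"
  proof (rule epicI [OF vH])
    fix T h assume h: "h \<in> Hom C (\<sigma> {j}) T" and 0: "h \<bullet> (\<pi> ?V {j} \<bullet> emb U) = Zero C (subobj U) T"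
    have T: "T \<in> Obj C" using h Hom_Obj by blast
    have hp: "h \<bullet> \<pi> {i, j} {j} \<in> Hom C (\<sigma> {i, j}) T" using Comp_Hom ijH h .
    have hV: "h \<bullet> \<pi> ?V {j} \<in> Hom C (\<sigma> ?V) T" using Comp_Hom pjH h .
    have "(h \<bullet> \<pi> ?V {j}) \<bullet> emb U = Zero C (subobj U) T" using Comp_assoc [OF eU pjH h] 0 by simp
    then obtain g where g: "g \<in> Hom C (\<sigma> {i}) T" "g \<bullet> ret U = h \<bullet> \<pi> ?V {j}"
      using cokernel_desc [OF cokernel_of_kernel [OF ret_epic [OF U n] emb_kernel [OF U n]]
          ret_Hom [OF U n] eU hV] by blast
    have "(g \<bullet> q) \<bullet> \<pi> ?V {i, j} = (h \<bullet> \<pi> {i, j} {j}) \<bullet> \<pi> ?V {i, j}"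
      using Comp_assoc [OF pH q_Hom g(1)] Comp_assoc [OF pH ijH h] g(2) pp by (simp add: ret_def)
    then have eq: "g \<bullet> q = h \<bullet> \<pi> {i, j} {j}"
      using epicD [OF pi_upper_epic [OF p] pH Comp_Hom [OF q_Hom g(1)] hp] by blast
    have "h = (h \<bullet> \<pi> {i, j} {j}) \<bullet> e"
      using Comp_assoc [OF e_Hom ijH h] pi_e Comp_Ident [OF h] by simp
    also have "\<dots> = g \<bullet> (q \<bullet> e)" using eq Comp_assoc [OF e_Hom q_Hom g(1)] by simp
    also have "\<dots> = Zero C (\<sigma> {j}) T" using q_e Comp_Zero [OF g(1) sigma_Obj [OF j_f]] by simp
    finally show "h = Zero C (\<sigma> {j}) T" .
  qed
  assume x: "x \<in> Hom C W (subobj U)" and 0: "(\<pi> ?V {j} \<bullet> emb U) \<bullet> x = Zero C W (\<sigma> {j})"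
  have ex: "emb U \<bullet> x \<in> Hom C W (\<sigma> ?V)" using Comp_Hom x eU .
  have "q \<bullet> (\<pi> ?V {i, j} \<bullet> (emb U \<bullet> x)) = (ret U \<bullet> emb U) \<bullet> x"
    unfolding ret_def
    using Comp_assoc [OF ex pH q_Hom] Comp_assoc [OF x eU ret_Hom [OF U n]] by (simp add: ret_def)
  also have "\<dots> = Zero C W (\<sigma> {i})"
    using ret_emb [OF U n] Zero_Comp [OF x sigma_Obj [OF i_f]] by simp
  finally have 1: "q \<bullet> (\<pi> ?V {i, j} \<bullet> (emb U \<bullet> x)) = Zero C W (\<sigma> {i})" .
  have 2: "\<pi> {i, j} {j} \<bullet> (\<pi> ?V {i, j} \<bullet> (emb U \<bullet> x)) = Zero C W (\<sigma> {j})"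
    using Comp_assoc [OF ex pH ijH] pp Comp_assoc [OF x eU pjH] 0 by simp
  have 3: "\<pi> ?V {i, j} \<bullet> (emb U \<bullet> x) = Zero C W (\<sigma> {i, j})"
    using joint [OF Comp_Hom [OF ex pH] 1 2] .
  have V_eq: "?V - {i, j} = U - {j}" using jU by blast
  have ioR: "\<iota> (U - {j}) ?V \<in> Hom C (\<sigma> (U - {j})) (\<sigma> ?V)" using iota_down_Hom [OF R V] by blast
  obtain z where z: "z \<in> Hom C W (\<sigma> (U - {j}))" "\<iota> (U - {j}) ?V \<bullet> z = emb U \<bullet> x"
    using kernel_lift [OF pi_upper_kernel [OF p] _ pH ex 3] ioR unfolding V_eq by blast
  have inc: "family.inc (U - {j}) U \<in> Hom C (\<sigma> (U - {j})) (subobj U)"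
    using family.inc_Hom [OF down_r_s [OF R] U] emb_old [OF R] by auto
  have "emb U \<bullet> (family.inc (U - {j}) U \<bullet> z) = emb U \<bullet> x"
    using Comp_assoc [OF z(1) inc eU] emb_inc_remove [OF U n] z(2) by simp
  then have "family.inc (U - {j}) U \<bullet> z = x"
    using monicD [OF emb_monic [OF U] eU Comp_Hom [OF z(1) inc] x] by blast
  then show "\<exists>z\<in>Hom C W (\<sigma> (U - {j})). family.inc (U - {j}) U \<bullet> z = x" using z(1) by blast
qed

text \<open>
  For new \<open>U \<subseteq> V\<close> the subobject of \<open>V\<close> is generated by those of \<open>U\<close> and \<open>V - {j}\<close>, since the
  quotient by the latter is \<open>\<sigma> {j}\<close> and the subobject of \<open>U\<close> already maps onto it.
\<close>

lemma union_into_new: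
  assumes U: "U \<in> down_sets I s" and nU: "new U" and V: "V \<in> down_sets I s" and nV: "new V"
    and UV: "U \<subseteq> V" and h: "h \<in> Hom C (subobj V) T"
    and hU: "h \<bullet> family.inc U V = Zero C (subobj U) T"
    and hV: "h \<bullet> family.inc (V - {j}) V = Zero C (\<sigma> (V - {j})) T"
  shows "h = Zero C (subobj V) T"
proof -
  let ?v = "\<pi> (insert i V) {j} \<bullet> emb V" and ?u = "\<pi> (insert i U) {j} \<bullet> emb U"
  note vH = quotient_new_Hom [OF V nV] and uH = quotient_new_Hom [OF U nU]
  note R = remove_down [OF V nV]
  have inc: "family.inc (V - {j}) V \<in> Hom C (\<sigma> (V - {j})) (subobj V)"
    using family.inc_Hom [OF down_r_s [OF R] V] emb_old [OF R] by auto
  note incU = family.inc_Hom [OF U V UV]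
  have T: "T \<in> Obj C" using h Hom_Obj by blast
  have "h \<bullet> x = Zero C W T" if x: "x \<in> Hom C W (subobj V)" "?v \<bullet> x = Zero C W (\<sigma> {j})" for W x
  proof -
    obtain z where z: "z \<in> Hom C W (\<sigma> (V - {j}))" "family.inc (V - {j}) V \<bullet> z = x"
      using quotient_new_kernel [OF V nV x] by blast
    then show ?thesis using Comp_assoc [OF z(1) inc h] hV Zero_Comp [OF z(1) T] by simp
  qed
  then obtain g where g: "g \<in> Hom C (\<sigma> {j}) T" "g \<bullet> ?v = h"
    using epic_desc [OF quotient_new_epic [OF V nV] vH h] by blast
  have io: "\<iota> (insert i U) (insert i V) \<in> Hom C (\<sigma> (insert i U)) (\<sigma> (insert i V))"
    using iota_down_Hom [OF insert_down [OF U nU] insert_down [OF V nV]] UV by blast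
  note pV = insert_upper_j [OF V nV]
  have "?v \<bullet> family.inc U V = (\<pi> (insert i V) {j} \<bullet> \<iota> (insert i U) (insert i V)) \<bullet> emb U"
    using Comp_assoc [OF incU emb_new_Hom [OF V nV] pi_upper_Hom [OF pV]] emb_inc [OF U V UV] nU nV
      Comp_assoc [OF emb_new_Hom [OF U nU] io pi_upper_Hom [OF pV]] by simp
  also have "\<dots> = ?u"
    using pi_iota_restrict [OF pV insert_down [OF U nU] insert_mono [OF UV]] nU
    by (simp add: new_def)
  finally have "g \<bullet> ?u = Zero C (subobj U) T"
    using Comp_assoc [OF incU vH g(1)] g(2) hU by simp
  then have "g = Zero C (\<sigma> {j}) T"
    using epic_zeroD [OF quotient_new_epic [OF U nU] uH g(1)] by blast
  then show ?thesis using g(2) Zero_Comp [OF vH T] by simp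
qed

text \<open>
  Modulo the subobject attached to \<open>U\<close>, the object \<open>\<sigma> (U \<union> {i})\<close> becomes \<open>\<sigma> {i}\<close>, and
  \<open>\<sigma> ((U - {j}) \<union> {i})\<close> already maps onto that.
\<close>

lemma union_in_insert:
  assumes U: "U \<in> down_sets I s" and n: "new U" and h: "h \<in> Hom C (\<sigma> (insert i U)) T"
    and 1: "h \<bullet> emb U = Zero C (subobj U) T"
    and 2: "h \<bullet> \<iota> (insert i (U - {j})) (insert i U) = Zero C (\<sigma> (insert i (U - {j}))) T"
  shows "h = Zero C (\<sigma> (insert i U)) T"
proof -
  let ?R = "insert i (U - {j})"
  note R = insert_remove_down [OF U n] and rH = ret_Hom [OF U n]
  have sub: "?R \<subseteq> insert i U" "i \<in> ?R" "j \<notin> ?R" using ij(2) by auto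
  have io: "\<iota> ?R (insert i U) \<in> Hom C (\<sigma> ?R) (\<sigma> (insert i U))"
    using iota_down_Hom [OF R insert_down [OF U n] sub(1)] .
  have T: "T \<in> Obj C" using h Hom_Obj by blast
  obtain g where g: "g \<in> Hom C (\<sigma> {i}) T" "g \<bullet> ret U = h"
    using cokernel_desc [OF cokernel_of_kernel [OF ret_epic [OF U n] emb_kernel [OF U n]]
        rH emb_new_Hom [OF U n] h 1] .
  have "g \<bullet> \<pi> ?R {i} = Zero C (\<sigma> ?R) T"
    using Comp_assoc [OF io rH g(1)] g(2) ret_iota_i [OF U n R sub] 2 by simp
  then have "g = Zero C (\<sigma> {i}) T"
    using epic_zeroD [OF pi_upper_epic pi_upper_Hom g(1)] insert_remove_upper [OF U n] by blast
  then show ?thesis using g(2) Zero_Comp [OF rH T] by simp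
qed

lemma union_old:
  assumes U: "U \<in> down_sets I r" and V: "V \<in> down_sets I r" and h: "h \<in> Hom C (subobj (U \<union> V)) T"
    and hU: "h \<bullet> family.inc U (U \<union> V) = Zero C (subobj U) T"
    and hV: "h \<bullet> family.inc V (U \<union> V) = Zero C (subobj V) T"
  shows "h = Zero C (subobj (U \<union> V)) T"
  using iota_union [OF U V] h hU hV emb_old(2) inc_old U V down_sets_Un [OF U V] by simp

text \<open>
  As \<open>U \<union> V\<close> is a down-set of \<open>r\<close> that contains \<open>j\<close>, it contains \<open>i\<close>, so \<open>i \<in> V\<close>. The union for
  \<open>r\<close> gives vanishing on \<open>(U - {j}) \<union> V\<close>, which contains \<open>(U - {j}) \<union> {i}\<close>. Together with \<open>U\<close>
  this gives vanishing on \<open>U \<union> {i}\<close>, and together with \<open>V\<close> on \<open>U \<union> V\<close>.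
\<close>

lemma union_new_to_old:
  assumes U: "U \<in> down_sets I s" and n: "new U" and V: "V \<in> down_sets I s"
    and o: "\<not> new (U \<union> V)" and h: "h \<in> Hom C (subobj (U \<union> V)) T"
    and hU: "h \<bullet> family.inc U (U \<union> V) = Zero C (subobj U) T"
    and hV: "h \<bullet> family.inc V (U \<union> V) = Zero C (subobj V) T"
  shows "h = Zero C (subobj (U \<union> V)) T"
proof -
  let ?W = "U \<union> V" and ?R = "U - {j}" and ?V = "(U - {j}) \<union> V"
  have jU: "j \<in> U" "i \<notin> U" "i \<in> V" using n o by (auto simp: new_def)
  have Vr: "V \<in> down_sets I r" using down_s_old [OF V] jU by (auto simp: new_def)
  have Wr: "?W \<in> down_sets I r" using down_s_old [OF down_sets_Un [OF U V] o] .
  note Ui = insert_down [OF U n] and R = remove_down [OF U n] and Ri = insert_remove_down [OF U n]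
  have V'r: "?V \<in> down_sets I r" using down_sets_Un R Vr .
  note W = down_r_s [OF Wr] and V' = down_r_s [OF V'r] and Rs = down_r_s [OF R]
  have incV': "family.inc ?V ?W \<in> Hom C (subobj ?V) (subobj ?W)"
    using family.inc_Hom [OF V' W] by blast
  have hV'H: "h \<bullet> family.inc ?V ?W \<in> Hom C (subobj ?V) T" using Comp_Hom incV' h .
  have hV': "h \<bullet> family.inc ?V ?W = Zero C (subobj ?V) T"
  proof (rule union_old [OF R Vr hV'H])
    show "(h \<bullet> family.inc ?V ?W) \<bullet> family.inc ?R ?V = Zero C (subobj ?R) T"
      using family.Comp_inc_trans [OF Rs V' W _ _ h] family.kills_mono [OF Rs U W _ _ h hU] by auto
    show "(h \<bullet> family.inc ?V ?W) \<bullet> family.inc V ?V = Zero C (subobj V) T"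
      using family.Comp_inc_trans [OF V V' W _ _ h] hV by auto
  qed
  have hR: "h \<bullet> \<iota> (insert i ?R) ?W = Zero C (\<sigma> (insert i ?R)) T"
  proof -
    have "insert i ?R \<subseteq> ?V" using jU by blast
    then have "h \<bullet> family.inc (insert i ?R) ?W = Zero C (subobj (insert i ?R)) T"
      using family.kills_mono [OF down_r_s [OF Ri] V' W _ _ h hV'] by blast
    moreover have "insert i ?R \<subseteq> ?W" using jU by blast
    ultimately show ?thesis using inc_old [OF Ri Wr] emb_old [OF Ri] by simp
  qed
  have hW: "h \<in> Hom C (\<sigma> ?W) T" using h emb_old [OF Wr] by simp
  have sub: "insert i U \<subseteq> ?W" using jU by blast
  have io: "\<iota> (insert i U) ?W \<in> Hom C (\<sigma> (insert i U)) (\<sigma> ?W)" using iota_down_Hom [OF Ui Wr sub] .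
  have "h \<bullet> \<iota> (insert i U) ?W = Zero C (\<sigma> (insert i U)) T"
  proof (rule union_in_insert [OF U n Comp_Hom [OF io hW]])
    show "(h \<bullet> \<iota> (insert i U) ?W) \<bullet> emb U = Zero C (subobj U) T"
      using Comp_assoc [OF emb_new_Hom [OF U n] io hW] hU inc_to_old [OF U Wr] n by simp
    show "(h \<bullet> \<iota> (insert i U) ?W) \<bullet> \<iota> (insert i ?R) (insert i U) = Zero C (\<sigma> (insert i ?R)) T"
      using iota_down_Comp' [OF Ri Ui Wr _ sub hW] hR by auto
  qed
  moreover have "h \<bullet> \<iota> V ?W = Zero C (\<sigma> V) T" using hV inc_old [OF Vr Wr] emb_old [OF Vr] by auto
  moreover have "insert i U \<union> V = ?W" using jU by blast
  ultimately show ?thesis using iota_union [OF Ui Vr, of h T] hW emb_old [OF Wr] by simp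
qed

text \<open>
  Here \<open>(U \<union> V) - {j}\<close> is the union of two down-sets of \<open>r\<close>, and \<open>union_into_new\<close> adds \<open>j\<close>.
\<close>

lemma union_new_to_new:
  assumes U: "U \<in> down_sets I s" and j: "j \<in> U" and V: "V \<in> down_sets I s"
    and n: "new (U \<union> V)" and h: "h \<in> Hom C (subobj (U \<union> V)) T"
    and hU: "h \<bullet> family.inc U (U \<union> V) = Zero C (subobj U) T"
    and hV: "h \<bullet> family.inc V (U \<union> V) = Zero C (subobj V) T"
  shows "h = Zero C (subobj (U \<union> V)) T"
proof -
  let ?W = "U \<union> V"
  have nU: "new U" and iV: "i \<notin> V" using n j by (auto simp: new_def)
  have W: "?W \<in> down_sets I s" using down_sets_Un U V .
  note R = remove_down [OF U nU] and RW = remove_down [OF W n]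
  have RV: "V - {j} \<in> down_sets I r"
  proof (cases "j \<in> V")
    case True
    then show ?thesis using remove_down [OF V] iV by (simp add: new_def)
  next
    case False
    then show ?thesis using down_s_old [OF V] by (simp add: new_def)
  qed
  have eq: "?W - {j} = (U - {j}) \<union> (V - {j})" by blast
  note Rs = down_r_s [OF R] and RWs = down_r_s [OF RW] and RVs = down_r_s [OF RV]
  have inc: "family.inc (?W - {j}) ?W \<in> Hom C (subobj (?W - {j})) (subobj ?W)"
    using family.inc_Hom [OF RWs W] by blast
  have "h \<bullet> family.inc (?W - {j}) ?W = Zero C (subobj (?W - {j})) T"
  proof (rule union_old [OF R RV, folded eq, OF Comp_Hom [OF inc h]])
    show "(h \<bullet> family.inc (?W - {j}) ?W) \<bullet> family.inc (U - {j}) (?W - {j}) = Zero C (subobj (U - {j})) T"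
      using family.Comp_inc_trans [OF Rs RWs W _ _ h] family.kills_mono [OF Rs U W _ _ h hU] by auto
    show "(h \<bullet> family.inc (?W - {j}) ?W) \<bullet> family.inc (V - {j}) (?W - {j}) = Zero C (subobj (V - {j})) T"
      using family.Comp_inc_trans [OF RVs RWs W _ _ h] family.kills_mono [OF RVs V W _ _ h hV]
      by auto
  qed
  then show ?thesis
    using union_into_new [OF U nU W n _ h hU] emb_old [OF RW] by simp
qed

sublocale family: distributive_family C I s subobj incl "\<sigma> I"
proof
  fix U V assume U: "U \<in> down_sets I s" and V: "V \<in> down_sets I s"
  show "\<exists>z\<in>Hom C W (subobj (U \<inter> V)). incl (U \<inter> V) \<bullet> z = incl U \<bullet> x"
    if x: "x \<in> Hom C W (subobj U)" and y: "y \<in> Hom C W (subobj V)" and xy: "incl U \<bullet> x = incl V \<bullet> y"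
    for W x y
  proof -
    consider "new U" | "new V" | "\<not> new U" "\<not> new V" by blast
    then show ?thesis
    proof cases
      case 1
      then show ?thesis using intersection_new [OF U _ V x y xy] by blast
    next
      case 2
      then show ?thesis using intersection_new [OF V _ U y x] xy by (simp add: Int_commute)
    next
      case 3
      then have r: "U \<in> down_sets I r" "V \<in> down_sets I r" using down_s_old U V by auto
      note UV = down_sets_Int [OF r]
      note e = emb_old(2) [OF r(1)] emb_old(2) [OF r(2)] emb_old(2) [OF UV]
        incl_old [OF r(1)] incl_old [OF r(2)] incl_old [OF UV]
      obtain z where z: "z \<in> Hom C W (\<sigma> (U \<inter> V))" "\<iota> (U \<inter> V) U \<bullet> z = x"
        using iota_intersection [OF r] x y xy unfolding e by blast
      then have "\<iota> (U \<inter> V) I \<bullet> z = \<iota> U I \<bullet> x"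
        using Comp_iota_down [OF UV r(1) I_down _ down_sub [OF r(1)] z(1)] by simp
      then show ?thesis using z(1) unfolding e by blast
    qed
  qed
  show "h = Zero C (subobj (U \<union> V)) T"
    if h: "h \<in> Hom C (subobj (U \<union> V)) T"
      and hU: "h \<bullet> family.inc U (U \<union> V) = Zero C (subobj U) T"
      and hV: "h \<bullet> family.inc V (U \<union> V) = Zero C (subobj V) T" for h T
  proof -
    have V': "h = Zero C (subobj (U \<union> V)) T" if "new V" "\<not> new (U \<union> V)"
      using union_new_to_old [OF V that(1) U] that(2) h hU hV by (simp add: Un_commute)
    have V'': "h = Zero C (subobj (U \<union> V)) T" if "j \<in> V" "new (U \<union> V)"
      using union_new_to_new [OF V that(1) U] that(2) h hU hV by (simp add: Un_commute)
    show ?thesis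
    proof (cases "new (U \<union> V)")
      case True
      then have "j \<in> U \<or> j \<in> V" by (auto simp: new_def)
      then show ?thesis using union_new_to_new [OF U _ V True h hU hV] V'' True by blast
    next
      case False
      then show ?thesis
        using union_new_to_old [OF U _ V False h hU hV] V' union_old [OF _ _ h hU hV]
          down_s_old [OF U] down_s_old [OF V] by blast
    qed
  qed
qed

text \<open>
  On the f-sets of \<open>r\<close> the given projections are the prescribed quotients; elsewhere any
  cokernel will do.
\<close>

definition hull :: "'i set \<Rightarrow> 'i set" where
  "hull J = down_closure (if J \<in> f_sets I r then r else s) J"

definition quot :: "'i set \<Rightarrow> 'm" where
  "quot J = (if J \<in> f_sets I r then \<pi> (hull J) J
    else SOME c. is_cokernel C c (family.inc (hull J - J) (hull J)))"

definition obj :: "'i set \<Rightarrow> 'o" where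
  "obj J = Cod C (quot J)"

lemma upper_r_s: "upper_part I r U J \<Longrightarrow> upper_part I s U J"
  using down_r_s by (simp add: upper_part_def)

lemma old_hull:
  assumes "J \<in> f_sets I r"
  shows "upper_part I r (hull J) J" "quot J = \<pi> (hull J) J" "obj J = \<sigma> J"
proof -
  show up: "upper_part I r (hull J) J"
    using upper_part_down_closure [OF order assms] assms by (simp add: hull_def)
  show "quot J = \<pi> (hull J) J" using assms by (simp add: quot_def)
  then show "obj J = \<sigma> J" using pi_upper_Hom [OF up] by (simp add: obj_def Hom_def)
qed

sublocale family: presented_family C I s subobj incl "\<sigma> I" obj hull quot
proof
  fix J assume J: "J \<in> f_sets I s"
  have *: "upper_part I s (hull J) J \<and> quot J \<in> Hom C (subobj (hull J)) (obj J) \<and>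
    is_cokernel C (quot J) (family.inc (hull J - J) (hull J))"
  proof (cases "J \<in> f_sets I r")
    case True
    note up = old_hull(1) [OF True]
    have D: "hull J \<in> down_sets I r" "hull J - J \<in> down_sets I r"
      using up by (auto simp: upper_part_def)
    show ?thesis
      using upper_r_s [OF up] old_hull [OF True] pi_upper_Hom [OF up] pi_upper_cokernel [OF up]
        emb_old [OF D(1)] inc_old [OF D(2,1)] by auto
  next
    case False
    then have up: "upper_part I s (hull J) J"
      using upper_part_down_closure [OF order_s J] by (simp add: hull_def)
    have inc: "family.inc (hull J - J) (hull J) \<in> Hom C (subobj (hull J - J)) (subobj (hull J))"
      using family.inc_Hom up by (auto simp: upper_part_def)
    then have "\<exists>c. is_cokernel C c (family.inc (hull J - J) (hull J))"
      using ex_cokernel by (auto simp: Hom_def)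
    then have "is_cokernel C (SOME c. is_cokernel C c (family.inc (hull J - J) (hull J)))
        (family.inc (hull J - J) (hull J))"
      by (rule someI_ex)
    then have c: "is_cokernel C (quot J) (family.inc (hull J - J) (hull J))"
      using False by (simp add: quot_def)
    then have "quot J \<in> Hom C (subobj (hull J)) (obj J)"
      using inc by (auto simp: is_cokernel_def Hom_def obj_def)
    then show ?thesis using up c by blast
  qed
  then show "upper_part I s (hull J) J" "quot J \<in> Hom C (subobj (hull J)) (obj J)"
    "is_cokernel C (quot J) (family.inc (hull J - J) (hull J))" by auto
qed

lemma proj_old:
  assumes up: "upper_part I r U J"
  shows "family.proj U J = \<pi> U J"
proof (rule family.proj_eqI [OF upper_r_s [OF up]])
  have J: "J \<in> f_sets I r" using upper_part_f_sets [OF up] .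
  note h = old_hull [OF J]
  have D: "U \<in> down_sets I r" "U - J \<in> down_sets I r" "hull J \<in> down_sets I r" "J \<subseteq> U" "J \<subseteq> hull J"
    using up h(1) by (auto simp: upper_part_def)
  have M: "U \<inter> hull J \<in> down_sets I r" using down_sets_Int D by blast
  have "\<pi> U J \<bullet> \<iota> (U \<inter> hull J) U = \<pi> (hull J) J \<bullet> \<iota> (U \<inter> hull J) (hull J)"
    using pi_iota_restrict [OF up M] pi_iota_restrict [OF h(1) M] D by auto
  moreover have "\<pi> U J \<bullet> \<iota> (U - J) U = Zero C (\<sigma> (U - J)) (\<sigma> J)"
    using pi_iota_disjoint [OF up D(2)] by blast
  ultimately show "family.is_proj U J (\<pi> U J)"
    unfolding family.is_proj_def
    using pi_upper_Hom [OF up] h emb_old(2) D inc_old [OF M D(1)] inc_old [OF M D(3)]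
      inc_old [OF D(2,1)] by simp
qed

text \<open>
  The given \<open>\<iota>\<close> and \<open>\<pi>\<close> satisfy the equation that characterizes induced morphisms, so the new
  configuration restricts to them.
\<close>

lemma induced_old:
  assumes l: "linked I r U V J K" and f: "f \<in> Hom C (\<sigma> J) (\<sigma> K)"
    and eq: "f \<bullet> \<pi> U J = \<pi> V K \<bullet> \<iota> U V"
  shows "family.induced J K = f"
proof (rule family.induced_eqI)
  have up: "upper_part I r U J" "upper_part I r V K" "U \<subseteq> V" using l by (auto simp: linked_def)
  have JK: "J \<in> f_sets I r" "K \<in> f_sets I r" using upper_part_f_sets up by auto
  have D: "U \<in> down_sets I r" "V \<in> down_sets I r" using up by (auto simp: upper_part_def)
  show "linked I s U V J K" using l upper_r_s by (auto simp: linked_def)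
  show "f \<in> Hom C (obj J) (obj K)" using f old_hull JK by simp
  show "f \<bullet> family.proj U J = family.proj V K \<bullet> family.inc U V"
    using eq proj_old [OF up(1)] proj_old [OF up(2)] inc_old [OF D up(3)] by simp
qed

theorem strict_improvement:
  "\<exists>s \<sigma>' \<iota>' \<pi>'. improvement C A I r \<sigma> \<iota> \<pi> s \<sigma>' \<iota>' \<pi>' \<and> s \<noteq> r"
proof (intro exI conjI)
  show "s \<noteq> r" using ij(1) by blast
  have obj: "obj J = \<sigma> J" if "J \<in> f_sets I r" for J using old_hull(3) [OF that] .
  have single: "{k} \<in> f_sets I r" if "k \<in> I" for k using f_sets_singleton [OF order that] .
  have "is_zero_object C (obj {})" using sigma_empty obj [OF f_sets_empty] by simp
  then have cfg: "configuration C (Obj C) I s obj family.induced family.induced"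
    by (rule family.induced_configuration)
  have "configuration C A I s obj family.induced family.induced"
    using configuration_in_exact [OF cfg order_s finite] sigma_A obj f_sets_empty single by metis
  moreover have "family.induced J K = \<iota> J K" if JK: "(J, K) \<in> g_pairs I r" for J K
  proof (rule induced_old [OF linked_g_pair [OF order JK] iota_Hom [OF JK]])
    note l = linked_g_pair [OF order JK]
    have up: "upper_part I r (down_closure r J) J" "upper_part I r (down_closure r K) K"
      "down_closure r J \<subseteq> down_closure r K" "down_closure r J \<inter> K = J"
      using l g_pairs_f [OF JK] by (auto simp: linked_def upper_part_def)
    have "down_closure r J \<in> down_sets I r" using up(1) by (simp add: upper_part_def)
    then show "\<iota> J K \<bullet> \<pi> (down_closure r J) J =
      \<pi> (down_closure r K) K \<bullet> \<iota> (down_closure r J) (down_closure r K)"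
      using pi_iota_down [OF up(2) _ up(3)] up(4) by simp
  qed
  moreover have "family.induced J K = \<pi> J K" if JK: "(J, K) \<in> h_pairs I r" for J K
  proof (rule induced_old [OF linked_h_pair [OF order JK] pi_Hom [OF JK]])
    have up: "upper_part I r (down_closure r J) J" "upper_part I r (down_closure r J) K"
      using linked_h_pair [OF order JK] by (auto simp: linked_def)
    have D: "down_closure r J \<in> down_sets I r" using up(1) by (simp add: upper_part_def)
    have "\<pi> (down_closure r J) K \<bullet> \<iota> (down_closure r J) (down_closure r J) = \<pi> (down_closure r J) K"
      using iota_Ident [OF down_sets_f_sets [OF D]] Comp_Ident [OF pi_upper_Hom [OF up(2)]] by simp
    then show "\<pi> J K \<bullet> \<pi> (down_closure r J) J =
      \<pi> (down_closure r J) K \<bullet> \<iota> (down_closure r J) (down_closure r J)"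
      using pi_Comp [OF upper_part_h_pairs [OF up(1)] JK] by simp
  qed
  ultimately show "improvement C A I r \<sigma> \<iota> \<pi> s obj family.induced family.induced"
    unfolding improvement_def using order_s obj by auto
qed

end

section \<open>Split sequences\<close>

context preadditive_category
begin

lemma split_sequenceD:
  assumes split: "split_sequence C f g" and f: "f \<in> Hom C X Y" and g: "g \<in> Hom C Y Z"
  obtains q e where "q \<in> Hom C Y X" "e \<in> Hom C Z Y" "q \<bullet> f = Ident C X" "g \<bullet> e = Ident C Z"
    "q \<bullet> e = Zero C Z X"
    "\<And>W x. x \<in> Hom C W Y \<Longrightarrow> q \<bullet> x = Zero C W X \<Longrightarrow> g \<bullet> x = Zero C W Z \<Longrightarrow> x = Zero C W Y"
proof -
  have eqs: "Dom C f = X" "Cod C f = Y" "Cod C g = Z" using f g by (auto simp: Hom_def)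
  obtain S i1 i2 p1 p2 \<phi> where S: "is_direct_sum C X Z S i1 i2 p1 p2" and \<phi>: "\<phi> \<in> Hom C S Y"
    and iso: "iso_arrow C \<phi>" and \<phi>i: "\<phi> \<bullet> i1 = f" and g\<phi>: "g \<bullet> \<phi> = p2"
    using split unfolding split_sequence_def eqs by blast
  obtain \<psi> where \<psi>: "\<psi> \<in> Hom C Y S" "\<psi> \<bullet> \<phi> = Ident C S" "\<phi> \<bullet> \<psi> = Ident C Y"
    using iso \<phi> by (auto simp: iso_arrow_def Hom_def)
  have i1: "i1 \<in> Hom C X S" and i2: "i2 \<in> Hom C Z S" and p1: "p1 \<in> Hom C S X"
    and p2: "p2 \<in> Hom C S Z" and pi: "p1 \<bullet> i1 = Ident C X" "p2 \<bullet> i2 = Ident C Z"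
      "p1 \<bullet> i2 = Zero C Z X" and sum: "Plus C (i1 \<bullet> p1) (i2 \<bullet> p2) = Ident C S"
    using S by (auto simp: is_direct_sum_def)
  have q\<phi>: "(p1 \<bullet> \<psi>) \<bullet> (\<phi> \<bullet> k) = p1 \<bullet> k" if k: "k \<in> Hom C V S" for V k
    using Comp_assoc [OF Comp_Hom [OF k \<phi>] \<psi>(1) p1] Comp_assoc [OF k \<phi> \<psi>(1)] \<psi>(2) Ident_Comp [OF k]
    by simp
  show thesis
  proof (rule that [of "p1 \<bullet> \<psi>" "\<phi> \<bullet> i2"])
    show "p1 \<bullet> \<psi> \<in> Hom C Y X" using Comp_Hom \<psi>(1) p1 .
    show "\<phi> \<bullet> i2 \<in> Hom C Z Y" using Comp_Hom i2 \<phi> .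
    show "(p1 \<bullet> \<psi>) \<bullet> f = Ident C X" using q\<phi> [OF i1] \<phi>i pi by simp
    show "g \<bullet> (\<phi> \<bullet> i2) = Ident C Z" using Comp_assoc [OF i2 \<phi> g] g\<phi> pi by simp
    show "(p1 \<bullet> \<psi>) \<bullet> (\<phi> \<bullet> i2) = Zero C Z X" using q\<phi> [OF i2] pi by simp
    fix W x assume x: "x \<in> Hom C W Y" and 1: "(p1 \<bullet> \<psi>) \<bullet> x = Zero C W X" and 2: "g \<bullet> x = Zero C W Z"
    have W: "W \<in> Obj C" using x Hom_Obj by blast
    have \<psi>x: "\<psi> \<bullet> x \<in> Hom C W S" using Comp_Hom x \<psi>(1) .
    have x_eq: "x = \<phi> \<bullet> (\<psi> \<bullet> x)" using Comp_assoc [OF x \<psi>(1) \<phi>] \<psi>(3) Ident_Comp [OF x] by simp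
    have 1: "p1 \<bullet> (\<psi> \<bullet> x) = Zero C W X" using Comp_assoc [OF x \<psi>(1) p1] 1 by simp
    have 2: "p2 \<bullet> (\<psi> \<bullet> x) = Zero C W Z" using Comp_assoc [OF \<psi>x \<phi> g] g\<phi> x_eq 2 by simp
    have "\<psi> \<bullet> x = Plus C (i1 \<bullet> p1) (i2 \<bullet> p2) \<bullet> (\<psi> \<bullet> x)" using sum Ident_Comp [OF \<psi>x] by simp
    also have "\<dots> = Plus C (Zero C W S) (Zero C W S)"
      using Plus_Comp [OF \<psi>x Comp_Hom [OF p1 i1] Comp_Hom [OF p2 i2]] 1 2
        Comp_assoc [OF \<psi>x p1 i1] Comp_assoc [OF \<psi>x p2 i2] Comp_Zero [OF i1 W] Comp_Zero [OF i2 W]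
      by simp
    also have "\<dots> = Zero C W S" using Plus_Zero Zero_Hom W Hom_Obj [OF \<psi>x] by blast
    finally show "x = Zero C W Y" using x_eq Comp_Zero [OF \<phi> W] by simp
  qed
qed

lemma split_sequenceI:
  assumes S: "is_direct_sum C X Z Y f i2 p1 g"
  shows "split_sequence C f g"
proof -
  have f: "f \<in> Hom C X Y" and g: "g \<in> Hom C Y Z" using S by (auto simp: is_direct_sum_def)
  then have eqs: "Dom C f = X" "Cod C f = Y" "Cod C g = Z" by (auto simp: Hom_def)
  have id: "Ident C Y \<in> Hom C Y Y" using Ident_Hom Hom_Obj f by blast
  then have "iso_arrow C (Ident C Y)"
    using Ident_Comp [OF id] by (auto simp: iso_arrow_def Hom_def)
  then show ?thesis
    unfolding split_sequence_def eqs using S id Ident_Comp [OF f] Comp_Ident [OF g] by blast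
qed

end

text \<open>
  The difference \<open>d\<close> between the identity and \<open>\<iota>\<^sub>i \<pi>\<^sub>i + \<iota>\<^sub>j \<pi>\<^sub>j\<close> vanishes on \<open>\<sigma> {i}\<close>, so by
  exactness it factors through \<open>\<sigma> {i, j} \<rightarrow> \<sigma> {j}\<close>. It also vanishes on \<open>\<sigma> {j}\<close>, and the
  inclusion of \<open>\<sigma> {j}\<close> is a section of that projection; so \<open>d\<close> is zero.
\<close>

lemma (in poset_configuration) incomparable_split:
  assumes i: "i \<in> I" and j: "j \<in> I" and ij: "(i, j) \<notin> r" "(j, i) \<notin> r"
    and f: "{i, j} \<in> f_sets I r"
  shows "split_sequence C (\<iota> {i} {i, j}) (\<pi> {i, j} {j})"
proof -
  have ne: "i \<noteq> j" using order_refl [OF order i] ij by auto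
  have fi: "{i} \<in> f_sets I r" and fj: "{j} \<in> f_sets I r"
    using f_sets_singleton [OF order] i j by auto
  have gi: "({i}, {i, j}) \<in> g_pairs I r" and gj: "({j}, {i, j}) \<in> g_pairs I r"
    and hi: "({i, j}, {i}) \<in> h_pairs I r" and hj: "({i, j}, {j}) \<in> h_pairs I r"
    using fi fj f ij by (auto simp: g_pairs_def h_pairs_def)
  note iH = iota_Hom [OF gi] and jH = iota_Hom [OF gj] and piH = pi_Hom [OF hi] and pjH = pi_Hom [OF hj]
  have diff: "{i, j} - {i} = {j}" "{i, j} - {j} = {i}" using ne by auto
  have exi: "short_exact C (\<iota> {i} {i, j}) (\<pi> {i, j} {j})"
    and exj: "short_exact C (\<iota> {j} {i, j}) (\<pi> {i, j} {i})"
    using exact [OF gi refl] exact [OF gj refl] unfolding diff by auto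
  have Oi: "\<sigma> {i} \<in> Obj C" and Oj: "\<sigma> {j} \<in> Obj C" using sigma_Obj fi fj by auto
  have 1: "\<pi> {i, j} {i} \<bullet> \<iota> {i} {i, j} = Ident C (\<sigma> {i})"
    using pi_iota [OF gi hi] iota_Ident [OF fi] pi_Ident [OF fi] Comp_Ident
      [OF Ident_Hom [OF Oi]] by simp
  have 2: "\<pi> {i, j} {j} \<bullet> \<iota> {j} {i, j} = Ident C (\<sigma> {j})"
    using pi_iota [OF gj hj] iota_Ident [OF fj] pi_Ident [OF fj] Comp_Ident
      [OF Ident_Hom [OF Oj]] by simp
  have 3: "\<pi> {i, j} {j} \<bullet> \<iota> {i} {i, j} = Zero C (\<sigma> {i}) (\<sigma> {j})"
    using kernel_zero [OF _ iH pjH] exi by (simp add: short_exact_def)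
  have 4: "\<pi> {i, j} {i} \<bullet> \<iota> {j} {i, j} = Zero C (\<sigma> {j}) (\<sigma> {i})"
    using kernel_zero [OF _ jH piH] exj by (simp add: short_exact_def)
  let ?s = "Plus C (\<iota> {i} {i, j} \<bullet> \<pi> {i, j} {i}) (\<iota> {j} {i, j} \<bullet> \<pi> {i, j} {j})"
  have a: "\<iota> {i} {i, j} \<bullet> \<pi> {i, j} {i} \<in> Hom C (\<sigma> {i, j}) (\<sigma> {i, j})"
    and b: "\<iota> {j} {i, j} \<bullet> \<pi> {i, j} {j} \<in> Hom C (\<sigma> {i, j}) (\<sigma> {i, j})"
    using Comp_Hom iH jH piH pjH by blast+
  have s: "?s \<in> Hom C (\<sigma> {i, j}) (\<sigma> {i, j})" using Plus_Hom a b .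
  have id: "Ident C (\<sigma> {i, j}) \<in> Hom C (\<sigma> {i, j}) (\<sigma> {i, j})" using Ident_Hom sigma_Obj f by blast
  obtain d where d: "d \<in> Hom C (\<sigma> {i, j}) (\<sigma> {i, j})" "Ident C (\<sigma> {i, j}) = Plus C d ?s"
    using ex_difference [OF id s] .
  have si: "?s \<bullet> \<iota> {i} {i, j} = \<iota> {i} {i, j}"
    using Plus_Comp [OF iH a b] Comp_assoc [OF iH piH iH] Comp_assoc [OF iH pjH jH] 1 3
      Comp_Ident [OF iH] Comp_Zero [OF jH Oi] Plus_Zero [OF iH] by simp
  have di: "d \<bullet> \<iota> {i} {i, j} = Zero C (\<sigma> {i}) (\<sigma> {i, j})"
    using Plus_Comp [OF iH d(1) s] d(2) si Ident_Comp [OF iH]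
      Plus_eq_right [OF Comp_Hom [OF iH d(1)] iH] by simp
  have sj: "?s \<bullet> \<iota> {j} {i, j} = \<iota> {j} {i, j}"
    using Plus_Comp [OF jH a b] Comp_assoc [OF jH piH iH] Comp_assoc [OF jH pjH jH] 2 4
      Comp_Ident [OF jH] Comp_Zero [OF iH Oj] Zero_Plus [OF jH] by simp
  have dj: "d \<bullet> \<iota> {j} {i, j} = Zero C (\<sigma> {j}) (\<sigma> {i, j})"
    using Plus_Comp [OF jH d(1) s] d(2) sj Ident_Comp [OF jH]
      Plus_eq_right [OF Comp_Hom [OF jH d(1)] jH] by simp
  obtain g where g: "g \<in> Hom C (\<sigma> {j}) (\<sigma> {i, j})" "g \<bullet> \<pi> {i, j} {j} = d"
    using cokernel_desc [OF _ pjH iH d(1) di] exi by (auto simp: short_exact_def)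
  have "g = (g \<bullet> \<pi> {i, j} {j}) \<bullet> \<iota> {j} {i, j}"
    using Comp_assoc [OF jH pjH g(1)] 2 Comp_Ident [OF g(1)] by simp
  then have "d = Zero C (\<sigma> {i, j}) (\<sigma> {i, j})"
    using g(2) dj Zero_Comp [OF pjH sigma_Obj [OF f]] by simp
  then have "?s = Ident C (\<sigma> {i, j})" using d(2) Zero_Plus [OF s] by simp
  then have "is_direct_sum C (\<sigma> {i}) (\<sigma> {j}) (\<sigma> {i, j})
      (\<iota> {i} {i, j}) (\<iota> {j} {i, j}) (\<pi> {i, j} {i}) (\<pi> {i, j} {j})"
    using iH jH piH pjH 1 2 3 4 by (simp add: is_direct_sum_def)
  then show ?thesis by (rule split_sequenceI)
qed

section \<open>Best configurations\<close>

text \<open>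
  A pair in \<open>r\<close> outside \<open>s\<close> whose interval has the fewest elements is a covering pair: an
  element strictly between would split it into two pairs with smaller intervals, both of which
  would be in \<open>s\<close>, and \<open>s\<close> is transitive.
\<close>

lemma ex_cover_outside:
  assumes r: "partial_order_on I r" and s: "partial_order_on I s" and sub: "s \<subseteq> r" "s \<noteq> r"
    and fin: "finite I"
  obtains i j where "(i, j) \<in> r" "(i, j) \<notin> s" "i \<noteq> j"
    "\<not> (\<exists>k\<in>I. i \<noteq> k \<and> k \<noteq> j \<and> (i, k) \<in> r \<and> (k, j) \<in> r)"
proof -
  define between where "between p = {k. (fst p, k) \<in> r \<and> (k, snd p) \<in> r}" for p
  have fin': "finite (between p)" for p
    by (rule finite_subset [OF _ fin]) (use order_in [OF r] in \<open>auto simp: between_def\<close>)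
  obtain p0 where p0: "p0 \<in> r - s" using sub by blast
  obtain p where p: "p \<in> r - s" "\<And>p'. p' \<in> r - s \<Longrightarrow> card (between p) \<le> card (between p')"
    using ex_has_least_nat [of "\<lambda>p. p \<in> r - s" p0 "\<lambda>p. card (between p)"] p0 by blast
  obtain i j where ij: "p = (i, j)" by (cases p)
  have rij: "(i, j) \<in> r" "(i, j) \<notin> s" using p(1) ij by auto
  have "i \<noteq> j" using rij order_refl [OF s] order_in [OF r rij(1)] by auto
  moreover have False if k: "i \<noteq> k" "k \<noteq> j" "(i, k) \<in> r" "(k, j) \<in> r" for k
  proof -
    have "i \<in> between p" "j \<in> between p"
      using ij rij order_refl [OF r] order_in [OF r rij(1)] by (auto simp: between_def)
    moreover have "j \<notin> between (i, k)" "i \<notin> between (k, j)"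
      using k order_antisym [OF r] by (auto simp: between_def)
    moreover have "between (i, k) \<subseteq> between p" "between (k, j) \<subseteq> between p"
      using k order_trans [OF r] ij unfolding between_def by auto
    ultimately have "between (i, k) \<subset> between p" "between (k, j) \<subset> between p" by blast+
    then have "card (between (i, k)) < card (between p)" "card (between (k, j)) < card (between p)"
      using fin' psubset_card_mono by blast+
    moreover have "(i, k) \<in> r - s \<or> (k, j) \<in> r - s" using k rij order_trans [OF s] by blast
    ultimately show False using p(2) by fastforce
  qed
  ultimately show thesis using that rij by blast
qed

theorem theorem6p10:
  fixes C :: "('o, 'm) addcat" and A :: "'o set"
    and I :: "'i set" and r :: "'i rel"
    and \<sigma> :: "'i set \<Rightarrow> 'o"
    and \<iota> \<pi> :: "'i set \<Rightarrow> 'i set \<Rightarrow> 'm"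
  assumes "exact_category C A"
    and "finite I" and "partial_order_on I r"
    and "configuration C A I r \<sigma> \<iota> \<pi>"
  shows "best C A I r \<sigma> \<iota> \<pi> \<longleftrightarrow>
    (\<forall>i\<in>I. \<forall>j\<in>I. i \<noteq> j \<and> (i, j) \<in> r \<and>
        \<not> (\<exists>k\<in>I. i \<noteq> k \<and> k \<noteq> j \<and> (i, k) \<in> r \<and> (k, j) \<in> r) \<longrightarrow>
      \<not> split_sequence C (\<iota> {i} {i, j}) (\<pi> {i, j} {j}))"
proof -
  interpret poset_configuration C A I r \<sigma> \<iota> \<pi>
    using assms by (simp add: poset_configuration_def poset_configuration_axioms_def)
  show ?thesis
  proof (intro iffI ballI impI notI)
    fix i j
    assume best: "best C A I r \<sigma> \<iota> \<pi>"
      and "i \<noteq> j \<and> (i, j) \<in> r \<and> \<not> (\<exists>k\<in>I. i \<noteq> k \<and> k \<noteq> j \<and> (i, k) \<in> r \<and> (k, j) \<in> r)"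
      and split: "split_sequence C (\<iota> {i} {i, j}) (\<pi> {i, j} {j})"
    then have ij: "i \<noteq> j" "(i, j) \<in> r"
      and cover: "\<not> (\<exists>k\<in>I. i \<noteq> k \<and> k \<noteq> j \<and> (i, k) \<in> r \<and> (k, j) \<in> r)" by auto
    note f = cover_pairs [OF order ij(2,1) cover]
    obtain q e where "q \<in> Hom C (\<sigma> {i, j}) (\<sigma> {i})" "e \<in> Hom C (\<sigma> {j}) (\<sigma> {i, j})"
      "Comp C q (\<iota> {i} {i, j}) = Ident C (\<sigma> {i})" "Comp C (\<pi> {i, j} {j}) e = Ident C (\<sigma> {j})"
      "Comp C q e = Zero C (\<sigma> {j}) (\<sigma> {i})"
      "\<And>W x. x \<in> Hom C W (\<sigma> {i, j}) \<Longrightarrow> Comp C q x = Zero C W (\<sigma> {i}) \<Longrightarrow>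
        Comp C (\<pi> {i, j} {j}) x = Zero C W (\<sigma> {j}) \<Longrightarrow> x = Zero C W (\<sigma> {i, j})"
      using split_sequenceD [OF split iota_Hom [OF f(4)] pi_Hom [OF f(5)]] by blast
    then interpret split_cover C A I r \<sigma> \<iota> \<pi> i j q e
      using ij cover by unfold_locales auto
    show False using strict_improvement best by (simp add: best_def)
  next
    assume *: "\<forall>i\<in>I. \<forall>j\<in>I. i \<noteq> j \<and> (i, j) \<in> r \<and>
        \<not> (\<exists>k\<in>I. i \<noteq> k \<and> k \<noteq> j \<and> (i, k) \<in> r \<and> (k, j) \<in> r) \<longrightarrow>
      \<not> split_sequence C (\<iota> {i} {i, j}) (\<pi> {i, j} {j})"
    show "best C A I r \<sigma> \<iota> \<pi>"
      unfolding best_def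
    proof
      assume "\<exists>s \<sigma>' \<iota>' \<pi>'. improvement C A I r \<sigma> \<iota> \<pi> s \<sigma>' \<iota>' \<pi>' \<and> s \<noteq> r"
      then obtain s \<sigma>' \<iota>' \<pi>' where imp: "improvement C A I r \<sigma> \<iota> \<pi> s \<sigma>' \<iota>' \<pi>'" and "s \<noteq> r"
        by blast
      then have s: "partial_order_on I s" "s \<subseteq> r" "configuration C A I s \<sigma>' \<iota>' \<pi>'"
        by (auto simp: improvement_def)
      obtain i j where ij: "(i, j) \<in> r" "(i, j) \<notin> s" "i \<noteq> j"
        and cover: "\<not> (\<exists>k\<in>I. i \<noteq> k \<and> k \<noteq> j \<and> (i, k) \<in> r \<and> (k, j) \<in> r)"
        using ex_cover_outside [OF order s(1,2) \<open>s \<noteq> r\<close> finite] .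
      interpret s: poset_configuration C A I s \<sigma>' \<iota>' \<pi>'
        using assms s by (simp add: poset_configuration_def poset_configuration_axioms_def)
      note f = cover_pairs [OF order ij(1,3) cover]
      have I: "i \<in> I" "j \<in> I" using order_in [OF order ij(1)] by auto
      have "(j, i) \<notin> s" using s(2) order_antisym [OF order ij(1)] ij(3) by blast
      moreover have "{i, j} \<in> f_sets I s" using f(3) s(2) unfolding f_sets_def by blast
      ultimately have "split_sequence C (\<iota>' {i} {i, j}) (\<pi>' {i, j} {j})"
        using s.incomparable_split [OF I ij(2)] by blast
      moreover have "\<iota>' {i} {i, j} = \<iota> {i} {i, j}" "\<pi>' {i, j} {j} = \<pi> {i, j} {j}"
        using imp f(4,5) by (auto simp: improvement_def)
      ultimately show False using * I ij cover by auto
    qed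
  qed
qed

end
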